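(* For $w\in\mathfrak{h}^{0}$, we have \[ Z^{\mathbin{\sqcup\!\sqcup}}\circ\sigma\circ\tau\left(\frac{1}{1-xA}w\frac{1}{1-yB}\right)=Z^{\mathbin{\sqcup\!\sqcup}}\circ\sigma\left(\frac{1}{1-xA}w\frac{1}{1-yB}\right)\times\frac{\Gamma(1+A)\Gamma(1-T+B)}{\Gamma(1+B)\Gamma(1-T+A)}. \]
   Context: Multiple zeta values are $\zeta(k_1,\dots,k_d)=\sum_{0<m_1<\cdots<m_d}m_1^{-k_1}\cdots m_d^{-k_d}$ for positive integers $k_i$ with $k_d>1$. Let $\mathfrak{h}=\mathbb{Q}\langle x,y\rangle$ and $\mathfrak{h}^0=\mathbb{Q}\oplus y\mathfrak{h}x$. Let $Z:\mathfrak{h}^0\to\mathbb{R}$ be the linear map with $Z(yx^{k_1-1}\cdots yx^{k_d-1})=\zeta(k_1,\dots,k_d)$ (and $Z(1)=1$). Let $\sigma:\mathfrak{h}\to\mathfrak{h}[[T]]$ be the ring homomorphism with $\sigma(x)=x$, $\sigma(y)=y(1-xT)^{-1}$, and $\tau:\mathfrak{h}\to\mathfrak{h}$ the anti-automorphism with $\tau(x)=y$, $\tau(y)=x$. Any linear map is extended coefficientwise to formal power series in $T,A,B$; $\frac{1}{1-xA}=\sum_{n\ge0}x^nA^n$ etc. The shuffle product $\mathbin{\sqcup\!\sqcup}$ on $\mathfrak{h}$ is the bilinear map with $w\mathbin{\sqcup\!\sqcup}1=1\mathbin{\sqcup\!\sqcup}w=w$ and $u_1w_1\mathbin{\sqcup\!\sqcup}u_2w_2=u_1(w_1\mathbin{\sqcup\!\sqcup}u_2w_2)+u_2(u_1w_1\mathbin{\sqcup\!\sqcup}w_2)$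 for $u_i\in\{x,y\}$. $Z^{\mathbin{\sqcup\!\sqcup}}:\mathfrak{h}\to\mathbb{R}$ is the unique map extending $Z$ that is multiplicative for $\mathbin{\sqcup\!\sqcup}$ and satisfies $Z^{\mathbin{\sqcup\!\sqcup}}(x)=Z^{\mathbin{\sqcup\!\sqcup}}(y)=0$. The Gamma quotient is expanded as a power series in $T,A,B$ at the origin. *)

theory Defs
  imports "HOL-Analysis.Analysis" "HOL-Library.Poly_Mapping"
begin

section \<open>The free algebra on two letters over the rationals\<close>

datatype letter = LX | LY

text \<open>Words are wrapped in a type of their own so that concatenation can be the (additive)
  monoid operation on exponents in \<^theory>\<open>HOL-Library.Poly_Mapping\<close>. The convolution product
  of finitely supported functions on words is then the concatenation product.\<close>

datatype word = Word (letters: "letter list")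

instantiation word :: monoid_add
begin

definition zero_word :: word where "0 = Word []"

definition plus_word :: "word \<Rightarrow> word \<Rightarrow> word" where
  "u + v = Word (letters u @ letters v)"

instance
  by standard (auto simp: zero_word_def plus_word_def)

end

type_synonym ncpoly = "word \<Rightarrow>\<^sub>0 rat"

abbreviation word_poly :: "letter list \<Rightarrow> ncpoly" where
  "word_poly u \<equiv> Poly_Mapping.single (Word u) 1"

abbreviation scalar :: "rat \<Rightarrow> ncpoly" where
  "scalar c \<equiv> Poly_Mapping.single 0 c"

text \<open>The letters \<open>x\<close> and \<open>y\<close> as elements of the algebra.\<close>

abbreviation lx :: ncpoly where "lx \<equiv> word_poly [LX]"
abbreviation ly :: ncpoly where "ly \<equiv> word_poly [LY]"

text \<open>\<open>lin_ext \<iota> f\<close> is the linear map with value \<open>f u\<close> on each word \<open>u\<close>; the target is a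
  \<open>\<rat>\<close>-algebra with structure map \<open>\<iota>\<close>.\<close>

definition lin_ext :: "(rat \<Rightarrow> 'b) \<Rightarrow> (letter list \<Rightarrow> 'b) \<Rightarrow> ncpoly \<Rightarrow> 'b::semiring_0" where
  "lin_ext \<iota> f p =
     (\<Sum>u\<in>Poly_Mapping.keys p. \<iota> (Poly_Mapping.lookup p u) * f (letters u))"

definition h0 :: "ncpoly set" where
  "h0 = {scalar c + ly * p * lx | c p. True}"


section \<open>Multiple zeta values and the map Z\<close>

definition mzv :: "nat list \<Rightarrow> real" where
  "mzv ks = (\<Sum>\<^sub>\<infinity>ms\<in>{ms. length ms = length ks \<and> sorted_wrt (<) ms \<and> (\<forall>m\<in>set ms. 0 < m)}.
               \<Prod>i<length ks. 1 / real (ms ! i) ^ (ks ! i))"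

text \<open>The index \<open>(k\<^sub>1, \<dots>, k\<^sub>d)\<close> of the word \<open>y x\<^bsup>k\<^sub>1-1\<^esup> \<cdots> y x\<^bsup>k\<^sub>d-1\<^esup>\<close>. Letters \<open>x\<close> before the
  first \<open>y\<close> are dropped, but no word in the support of an element of \<^term>\<open>h0\<close> has any.\<close>

fun index_of :: "letter list \<Rightarrow> nat list" where
  "index_of [] = []"
| "index_of (LX # u) = index_of u"
| "index_of (LY # u) = Suc (length (takeWhile (\<lambda>a. a = LX) u)) # index_of u"

definition index_word :: "nat list \<Rightarrow> letter list" where
  "index_word ks = concat (map (\<lambda>k. LY # replicate (k - 1) LX) ks)"

definition Z :: "ncpoly \<Rightarrow> real" where
  "Z = lin_ext of_rat (\<lambda>u. mzv (index_of u))"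


section \<open>Shuffle product and shuffle regularization\<close>

fun shuffle_words :: "letter list \<Rightarrow> letter list \<Rightarrow> ncpoly" where
  "shuffle_words [] v = word_poly v"
| "shuffle_words u [] = word_poly u"
| "shuffle_words (a # u) (b # v) =
     word_poly [a] * shuffle_words u (b # v) + word_poly [b] * shuffle_words (a # u) v"

definition shuffle_prod :: "ncpoly \<Rightarrow> ncpoly \<Rightarrow> ncpoly" where
  "shuffle_prod p q = lin_ext scalar (\<lambda>u. lin_ext scalar (\<lambda>v. shuffle_words u v) q) p"

definition is_shuffle_regularization :: "(ncpoly \<Rightarrow> real) \<Rightarrow> bool" where
  "is_shuffle_regularization f \<longleftrightarrow>
     (\<forall>p q. f (p + q) = f p + f q) \<and>
     (\<forall>c p. f (scalar c * p) = of_rat c * f p) \<and>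
     (\<forall>p\<in>h0. f p = Z p) \<and>
     (\<forall>p q. f (shuffle_prod p q) = f p * f q) \<and>
     f lx = 0 \<and> f ly = 0"

definition Z_sh :: "ncpoly \<Rightarrow> real" where
  "Z_sh = (THE f. is_shuffle_regularization f)"


section \<open>Power series and the maps sigma and tau\<close>

text \<open>The series \<open>1/(1 - p t)\<close> in the variable \<open>t\<close>. The ring need not be commutative, so
  \<^const>\<open>inverse\<close> on formal power series is not available.\<close>

definition geom :: "'a::semiring_1 \<Rightarrow> 'a fps" where
  "geom p = Abs_fps (\<lambda>n. p ^ n)"

definition coeffwise :: "('a \<Rightarrow> 'b) \<Rightarrow> 'a fps \<Rightarrow> 'b fps" where
  "coeffwise f F = Abs_fps (\<lambda>n. f (fps_nth F n))"

text \<open>The variable of the power series ring in the range of \<open>\<sigma>\<close> is \<open>T\<close>.\<close>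

fun sigma_letter :: "letter \<Rightarrow> ncpoly fps" where
  "sigma_letter LX = fps_const lx"
| "sigma_letter LY = fps_const ly * geom lx"

definition \<sigma> :: "ncpoly \<Rightarrow> ncpoly fps" where
  "\<sigma> = lin_ext (\<lambda>c. fps_const (scalar c)) (\<lambda>u. prod_list (map sigma_letter u))"

fun swap_letter :: "letter \<Rightarrow> letter" where
  "swap_letter LX = LY"
| "swap_letter LY = LX"

definition \<tau> :: "ncpoly \<Rightarrow> ncpoly" where
  "\<tau> = lin_ext scalar (\<lambda>u. word_poly (rev (map swap_letter u)))"

text \<open>Series in \<open>A, B\<close> over \<open>\<hh>\<close> are elements of \<open>\<hh>[[A]][[B]]\<close> (\<open>\<hh>\<close> being \<^typ>\<open>ncpoly\<close>), and series in \<open>T, A, B\<close> are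
  elements of \<open>R[[T]][[A]][[B]]\<close>: the outermost \<^typ>\<open>'a fps\<close> is always in \<open>B\<close>.
  The following is \<open>1/(1 - xA) \<cdot> w \<cdot> 1/(1 - yB)\<close>.\<close>

definition sandwich :: "ncpoly \<Rightarrow> ncpoly fps fps" where
  "sandwich w = fps_const (geom lx * fps_const w) * geom (fps_const ly)"

text \<open>Taylor series at the origin. The Gamma quotient below is real analytic there, so its iterated
  partial derivatives give the coefficients of its power series expansion.\<close>

definition taylor_TAB :: "(real \<Rightarrow> real \<Rightarrow> real \<Rightarrow> real) \<Rightarrow> real fps fps fps" where
  "taylor_TAB f =
     Abs_fps (\<lambda>k. Abs_fps (\<lambda>j. Abs_fps (\<lambda>i.
       (deriv ^^ i) (\<lambda>T. (deriv ^^ j) (\<lambda>A. (deriv ^^ k) (\<lambda>B. f T A B) 0) 0) 0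
         / (fact i * fact j * fact k))))"

definition gamma_quotient :: "real \<Rightarrow> real \<Rightarrow> real \<Rightarrow> real" where
  "gamma_quotient T A B =
     Gamma (1 + A) * Gamma (1 - T + B) / (Gamma (1 + B) * Gamma (1 - T + A))"


section \<open>Agreement with the defining properties\<close>

lemma index_of_index_word:
  assumes "\<forall>k\<in>set ks. 0 < k"
  shows "index_of (index_word ks) = ks"
proof -
  have skip: "index_of (replicate n LX @ v) = index_of v" for n v
    by (induction n) auto
  have len: "length (takeWhile (\<lambda>a. a = LX) (replicate n LX @ index_word ls)) = n" for n ls
    by (induction n) (cases ls; simp add: index_word_def)+
  show ?thesis
    using assms
  proof (induction ks)
    case Nil
    then show ?case by (simp add: index_word_def)
  next
    case (Cons k ks)
    have "index_word (k # ks) = LY # replicate (k - 1) LX @ index_word ks"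
      by (simp add: index_word_def)
    then show ?case using Cons by (simp add: skip len)
  qed
qed

lemma lin_ext_word_poly [simp]: "\<iota> 1 = 1 \<Longrightarrow> lin_ext \<iota> f (word_poly u) = (f u :: 'b::semiring_1)"
  by (simp add: lin_ext_def)

lemma Z_index_word: "\<forall>k\<in>set ks. 0 < k \<Longrightarrow> Z (word_poly (index_word ks)) = mzv ks"
  by (simp add: Z_def index_of_index_word)

lemma lin_ext_superset:
  assumes "finite S" "Poly_Mapping.keys p \<subseteq> S" "\<iota> 0 = 0"
  shows "lin_ext \<iota> f p = (\<Sum>u\<in>S. \<iota> (Poly_Mapping.lookup p u) * f (letters u))"
  unfolding lin_ext_def using assms
  by (intro sum.mono_neutral_left) (auto simp: in_keys_iff)

lemma lin_ext_single:
  assumes "\<iota> 0 = 0"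
  shows "lin_ext \<iota> f (Poly_Mapping.single u c) = \<iota> c * f (letters u)"
  by (subst lin_ext_superset[where S = "{u}"]) (auto simp: assms)

lemma lin_ext_add:
  assumes "\<iota> 0 = 0" "\<And>a b. \<iota> (a + b) = \<iota> a + \<iota> b"
  shows "lin_ext \<iota> f (p + q) = lin_ext \<iota> f p + lin_ext \<iota> f q"
proof -
  let ?S = "Poly_Mapping.keys p \<union> Poly_Mapping.keys q"
  have "Poly_Mapping.keys (p + q) \<subseteq> ?S" by (rule Poly_Mapping.keys_add)
  then show ?thesis
    by (simp add: lin_ext_superset[where S = ?S] assms lookup_add distrib_right sum.distrib)
qed

lemma ncpoly_induct [case_names zero single_add]:
  fixes p :: ncpoly
  assumes "P 0" "\<And>u c q. P q \<Longrightarrow> P (Poly_Mapping.single u c + q)"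
  shows "P p"
proof (induction p rule: update_induct)
  case const
  then show ?case using assms(1) by simp
next
  case (update q u c)
  have "Poly_Mapping.update u c q = Poly_Mapping.single u c + q"
    using update(1) by (intro poly_mapping_eqI)
      (auto simp: lookup_update lookup_add lookup_single in_keys_iff when_def)
  then show ?case using assms(2)[OF update.IH] by simp
qed

lemma lin_ext_mult:
  fixes f :: "letter list \<Rightarrow> 'b::semiring_1"
  assumes \<iota>: "\<iota> 0 = 0" "\<And>a b. \<iota> (a + b) = \<iota> a + \<iota> b" "\<And>a b. \<iota> (a * b) = \<iota> a * \<iota> b"
    and central: "\<And>c r. \<iota> c * r = r * \<iota> c"
    and f: "\<And>u v. f (u @ v) = f u * f v"
  shows "lin_ext \<iota> f (p * q) = lin_ext \<iota> f p * lin_ext \<iota> f q"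
proof (induction p rule: ncpoly_induct)
  case zero
  then show ?case by (simp add: lin_ext_def)
next
  case (single_add u c p)
  have "lin_ext \<iota> f (Poly_Mapping.single u c * q) =
        lin_ext \<iota> f (Poly_Mapping.single u c) * lin_ext \<iota> f q"
  proof (induction q rule: ncpoly_induct)
    case zero
    then show ?case by (simp add: lin_ext_def)
  next
    case (single_add v d q)
    have "\<iota> c * \<iota> d * (f (letters u) * f (letters v)) =
          \<iota> c * f (letters u) * (\<iota> d * f (letters v))"
      by (metis central mult.assoc)
    then show ?case using single_add
      by (simp add: distrib_left lin_ext_add \<iota> mult_single lin_ext_single plus_word_def f)
  qed
  then show ?case using single_add
    by (simp add: distrib_right lin_ext_add \<iota>)
qed

lemma scalar_central: "scalar c * p = p * scalar c"
proof (induction p rule: ncpoly_induct)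
  case zero
  then show ?case by simp
next
  case (single_add u d q)
  then show ?case by (simp add: distrib_left distrib_right mult_single mult.commute)
qed

lemma sigma_hom:
  "\<sigma> 1 = 1" "\<sigma> (p + q) = \<sigma> p + \<sigma> q" "\<sigma> (p * q) = \<sigma> p * \<sigma> q"
  "\<sigma> lx = fps_const lx" "\<sigma> ly = fps_const ly * geom lx"
proof -
  have "\<sigma> (word_poly []) = 1" by (simp add: \<sigma>_def)
  then show "\<sigma> 1 = 1" by (simp flip: zero_word_def)
  show "\<sigma> (p + q) = \<sigma> p + \<sigma> q"
    unfolding \<sigma>_def by (rule lin_ext_add) (auto simp: single_add)
  show "\<sigma> (p * q) = \<sigma> p * \<sigma> q"
    unfolding \<sigma>_def
  proof (rule lin_ext_mult)
    show "fps_const (scalar c) * r = r * fps_const (scalar c)" for c r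
      by (rule fps_ext) (simp add: scalar_central)
  qed (auto simp: single_add mult_single)
qed (simp_all add: \<sigma>_def)

lemma tau_antihom:
  "\<tau> 1 = 1" "\<tau> (p + q) = \<tau> p + \<tau> q" "\<tau> (p * q) = \<tau> q * \<tau> p" "\<tau> lx = ly" "\<tau> ly = lx"
proof -
  have "\<tau> (word_poly []) = 1" unfolding \<tau>_def by (subst lin_ext_word_poly, simp) (simp flip: zero_word_def)
  then show "\<tau> 1 = 1" by (simp flip: zero_word_def)
  have add: "\<tau> (p + q) = \<tau> p + \<tau> q" for p q
    unfolding \<tau>_def by (rule lin_ext_add) (auto simp: single_add)
  then show "\<tau> (p + q) = \<tau> p + \<tau> q" .
  have single: "\<tau> (Poly_Mapping.single u c) =
      Poly_Mapping.single (Word (rev (map swap_letter (letters u)))) c" for u c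
    by (simp add: \<tau>_def lin_ext_single mult_single plus_word_def zero_word_def)
  have zero: "\<tau> 0 = 0" by (simp add: \<tau>_def lin_ext_def)
  show "\<tau> (p * q) = \<tau> q * \<tau> p"
  proof (induction p rule: ncpoly_induct)
    case (single_add u c p)
    have "\<tau> (Poly_Mapping.single u c * q) = \<tau> q * \<tau> (Poly_Mapping.single u c)"
      by (induction q rule: ncpoly_induct)
        (simp_all add: zero distrib_left distrib_right add mult_single single plus_word_def
           mult.commute)
    then show ?case using single_add by (simp add: distrib_left distrib_right add)
  qed (simp add: zero)
qed (simp_all add: \<tau>_def)

lemma geom_inverse:
  fixes p :: "'a::ring_1"
  shows "(1 - fps_const p * fps_X) * geom p = 1"
  by (rule fps_ext)
    (auto simp: geom_def left_diff_distrib mult.assoc power_Suc[symmetric] split: nat.splits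
       simp del: power_Suc simp flip: power_Suc)

lemma sandwich_nth: "fps_nth (fps_nth (sandwich w) b) a = lx ^ a * w * ly ^ b"
proof -
  have "fps_const ly ^ b = fps_const (ly ^ b)" for b
    by (rule fps_const_power)
  then show ?thesis
    by (simp add: sandwich_def geom_def)
qed

end

theory Submission
  imports Defs "HOL-Complex_Analysis.Complex_Analysis" "HOL-Real_Asymp.Real_Asymp"
begin

text \<open>The regularized value of a word is a composition of regularized iterated integrals, from \<open>0\<close> to \<open>t\<close>
  and from \<open>t\<close> to \<open>1\<close>, of the two parts of the word at a cut; it does not depend on \<open>t\<close>. Cutting at the last
  letter \<open>x\<close> of \<open>w\<close> and summing over the words produced by \<open>\<sigma>\<close>, \<open>1/(1 - xA)\<close> and \<open>1/(1 - yB)\<close>, one gets for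
  \<open>w = y x\<^sup>k\<^sup>1\<^sup>-\<^sup>1 \<cdots> y x\<^sup>k\<^sup>d\<^sup>-\<^sup>1\<close> the series
  \<open>\<Sum> (\<Prod> (m\<^sub>i + A)\<^sup>1\<^sup>-\<^sup>k\<^sup>i (m\<^sub>i + A - T)\<^sup>-\<^sup>1) \<Gamma>(m\<^sub>d + A - T + 1) \<Gamma>(B + 1) / \<Gamma>(m\<^sub>d + A - T + B + 1)\<close>
  over \<open>0 < m\<^sub>1 < \<cdots> < m\<^sub>d\<close>. For \<open>T > 0 > A, B\<close> all terms have constant sign, so the summations can be
  interchanged freely. Up to a Gamma factor the series is a connected sum in the sense of Seki and Yamamoto
  with one side empty; transporting the letters one by one to the other side replaces \<open>w\<close> by \<open>\<tau> w\<close>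
  and exchanges \<open>A\<close> and \<open>B\<close>. For \<open>w = 1\<close> the sum is \<open>\<Gamma>(1 + A - T) \<Gamma>(1 + B) / \<Gamma>(1 + A + B - T)\<close>.\<close>

section \<open>Words, shuffles and uniqueness of the regularization\<close>

text \<open>\<open>Z_sh\<close> is a definite description: before any value can be computed, one
  regularization (\<open>reg_zeta\<close>) has to be exhibited and uniqueness proved. The form of
  the tails comes from sigma (1/(1 - yB)) = (1 - xT)/(1 - xT - yB): behind the cut stand all words
  with given numbers of \<open>x\<close> and \<open>y\<close>, and their sum is a shuffle product
  that integrates to powers of logarithms. The factor 1 - xT makes the series of a nonempty word a
  difference of two tail series. The Gamma quotient is a ratio of prefactors: the series of
  \<open>w\<close> is Gamma (1 + B) / Gamma (1 + B - T) times a connected sum, and the connected sum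
  of \<open>w\<close> at (A, B) is that of \<open>\<tau> w\<close> at (B, A). Transport works by
  telescoping: the difference of the connectors at \<open>n\<close> and \<open>n + 1\<close> is the
  one at \<open>n + 1\<close> times (m - alpha) / (n + 1 - beta - T). The empty word has no
  \<open>x\<close> to cut at; there an \<open>x\<close> of 1/(1 - xA) is used, and the series
  depends on A - T and B only.\<close>

fun shuffle_sum :: "(letter list \<Rightarrow> real) \<Rightarrow> letter list \<Rightarrow> letter list \<Rightarrow> real" where
  "shuffle_sum \<phi> [] v = \<phi> v"
| "shuffle_sum \<phi> (a # u) [] = \<phi> (a # u)"
| "shuffle_sum \<phi> (a # u) (b # v) = shuffle_sum (\<lambda>w. \<phi> (a # w)) u (b # v) + shuffle_sum (\<lambda>w. \<phi> (b # w)) (a # u) v"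

lemma shuffle_sum_Nil2 [simp]: "shuffle_sum \<phi> u [] = \<phi> u"
  by (cases u) auto

definition ev :: "(letter list \<Rightarrow> real) \<Rightarrow> ncpoly \<Rightarrow> real" where
  "ev = lin_ext of_rat"

lemma ev_add: "ev \<phi> (p + q) = ev \<phi> p + ev \<phi> q"
  unfolding ev_def by (rule lin_ext_add) (auto simp: of_rat_add)

lemma ev_0 [simp]: "ev \<phi> 0 = 0"
  by (simp add: ev_def lin_ext_def)

lemma ev_single [simp]: "ev \<phi> (Poly_Mapping.single u c) = of_rat c * \<phi> (letters u)"
  unfolding ev_def by (rule lin_ext_single) auto

lemma ev_uminus: "ev \<phi> (- p) = - ev \<phi> p"
  using ev_add[of \<phi> p "- p"] by simp

lemma ev_diff: "ev \<phi> (p - q) = ev \<phi> p - ev \<phi> q"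
  using ev_add[of \<phi> p "- q"] by (simp add: ev_uminus)

lemma ev_sum: "ev \<phi> (sum f A) = (\<Sum>i\<in>A. ev \<phi> (f i))"
  by (induction A rule: infinite_finite_induct) (auto simp: ev_add)

lemma ev_add_fun: "ev (\<lambda>u. \<phi> u + \<psi> u) p = ev \<phi> p + ev \<psi> p"
  by (simp add: ev_def lin_ext_def sum.distrib algebra_simps)

lemma ev_cmult_fun: "ev (\<lambda>u. c * \<phi> u) p = c * ev \<phi> p"
  by (simp add: ev_def lin_ext_def sum_distrib_left mult_ac)

lemma ev_mult_right_fun: "ev (\<lambda>u. \<phi> u * c) p = ev \<phi> p * c"
  by (simp add: ev_def lin_ext_def sum_distrib_left mult_ac)

lemma ev_mult: "ev \<phi> (p * q) = ev (\<lambda>u. ev (\<lambda>v. \<phi> (u @ v)) q) p"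
proof (induction p rule: ncpoly_induct)
  case zero
  then show ?case by simp
next
  case (single_add u c p)
  have "ev \<phi> (Poly_Mapping.single u c * q) = of_rat c * ev (\<lambda>v. \<phi> (letters u @ v)) q"
  proof (induction q rule: ncpoly_induct)
    case (single_add v d q)
    then show ?case
      by (simp add: distrib_left ev_add mult_single plus_word_def of_rat_mult)
  qed simp
  then show ?case using single_add by (simp add: distrib_right ev_add)
qed

lemma ev_scalar_mult: "ev \<phi> (scalar c * p) = of_rat c * ev \<phi> p"
  by (simp add: ev_mult zero_word_def)

lemma ev_eq_sum: "ev \<phi> p = (\<Sum>u\<in>Poly_Mapping.keys p. of_rat (Poly_Mapping.lookup p u) * \<phi> (letters u))"
  by (simp add: ev_def lin_ext_def)

lemma ev_lin_ext: "ev \<phi> (lin_ext scalar g p) = ev (\<lambda>u. ev \<phi> (g u)) p"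
  unfolding lin_ext_def ev_sum ev_scalar_mult ev_eq_sum[of _ p] ..

text \<open>\<open>shuffle_sum\<close> moves the leading letters into the functional, so shuffle
  identities can be proved for real functions on words, without polynomials; this is the bridge
  back.\<close>

lemma ev_shuffle_words: "ev \<phi> (shuffle_words u v) = shuffle_sum \<phi> u v"
  by (induction u v arbitrary: \<phi> rule: shuffle_words.induct) (simp_all add: ev_add ev_mult)

lemma ev_shuffle_prod: "ev \<phi> (shuffle_prod p q) = ev (\<lambda>u. ev (\<lambda>v. shuffle_sum \<phi> u v) q) p"
  by (simp add: shuffle_prod_def ev_lin_ext ev_shuffle_words)

definition shuffle_hom :: "(letter list \<Rightarrow> real) \<Rightarrow> bool" where
  "shuffle_hom \<phi> \<longleftrightarrow> \<phi> [] = 1 \<and> (\<forall>u v. shuffle_sum \<phi> u v = \<phi> u * \<phi> v)"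

lemma shuffle_sum_add: "shuffle_sum (\<lambda>w. \<phi> w + \<psi> w) u v = shuffle_sum \<phi> u v + shuffle_sum \<psi> u v"
  by (simp add: ev_add_fun flip: ev_shuffle_words)

lemma shuffle_sum_diff: "shuffle_sum (\<lambda>w. \<phi> w - \<psi> w) u v = shuffle_sum \<phi> u v - shuffle_sum \<psi> u v"
  using shuffle_sum_add[of "\<lambda>w. \<phi> w - \<psi> w" \<psi> u v] by simp

lemma shuffle_sum_cmult: "shuffle_sum (\<lambda>w. c * \<phi> w) u v = c * shuffle_sum \<phi> u v"
  by (simp add: ev_cmult_fun flip: ev_shuffle_words)

text \<open>Iterated integrals are differentiated in the last letter, so the shuffle recursion is
  needed at that end too. Peeling off first letters reduces it to shorter words.\<close>

lemma shuffle_sum_snoc: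
  "shuffle_sum \<phi> (u @ [a]) (v @ [b]) =
     shuffle_sum (\<lambda>w. \<phi> (w @ [a])) u (v @ [b]) + shuffle_sum (\<lambda>w. \<phi> (w @ [b])) (u @ [a]) v"
proof (induction "length u + length v" arbitrary: \<phi> u v rule: less_induct)
  case less
  show ?case
  proof (cases u)
    case Nil
    show ?thesis
    proof (cases v)
      case (Cons d v')
      then show ?thesis using less[of "[]" v' "\<lambda>w. \<phi> (d # w)"] Nil by simp
    qed (simp add: Nil)
  next
    case (Cons c u')
    show ?thesis
    proof (cases v)
      case Nil
      then show ?thesis using less[of u' "[]" "\<lambda>w. \<phi> (c # w)"] Cons by simp
    next
      case (Cons d v')
      then show ?thesis
        using less[of u' v "\<lambda>w. \<phi> (c # w)"] less[of u v' "\<lambda>w. \<phi> (d # w)"] \<open>u = c # u'\<close> by simp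
    qed
  qed
qed

lemma shuffle_sum_rev: "shuffle_sum \<phi> (rev u) (rev v) = shuffle_sum (\<lambda>w. \<phi> (rev w)) u v"
proof (induction u v arbitrary: \<phi> rule: shuffle_words.induct)
  case (3 a u b v)
  then show ?case
    using shuffle_sum_snoc[of \<phi> "rev u" a "rev v" b] by simp
qed auto

lemma shuffle_sum_map: "shuffle_sum \<phi> (map f u) (map f v) = shuffle_sum (\<lambda>w. \<phi> (map f w)) u v"
  by (induction u v arbitrary: \<phi> rule: shuffle_words.induct) auto

lemma shuffle_sum_letter:
  "shuffle_sum \<phi> [a] u = (\<Sum>i\<le>length u. \<phi> (take i u @ a # drop i u))"
proof (induction u arbitrary: \<phi>)
  case (Cons b u)
  then show ?case by (simp add: sum.atMost_Suc_shift del: sum.atMost_Suc)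
qed simp

text \<open>Shuffling \<open>a\<close> into \<open>u a^b\<close> produces \<open>u a^(b+1)\<close>
  once for each of the \<open>b + 1\<close> positions at the trailing block. Every other insertion
  is killed by the hypothesis, and \<open>b + 1\<close> is invertible.\<close>

lemma shuffle_sum_eqI_last:
  assumes "shuffle_sum \<phi> [a] (u @ replicate b a) = 0"
    and "\<And>i. i < length u \<Longrightarrow> \<phi> (take i u @ a # drop i u @ replicate b a) = 0"
  shows "\<phi> (u @ replicate (Suc b) a) = (0::real)"
proof -
  have *: "\<phi> (take i (u @ replicate b a) @ a # drop i (u @ replicate b a)) =
    (if i < length u then 0 else \<phi> (u @ replicate (Suc b) a))" if "i \<le> length u + b" for i
  proof (cases "i < length u")
    case True
    then show ?thesis using assms(2) by simp
  next
    case False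
    then have "replicate (i - length u) a @ a # replicate (b - (i - length u)) a = replicate (Suc b) a"
      using that by (simp flip: replicate_Suc replicate_add)
    then show ?thesis using False that by simp
  qed
  have "0 = (\<Sum>i\<le>length u + b. if i < length u then 0 else \<phi> (u @ replicate (Suc b) a))"
    using assms(1) * by (simp add: shuffle_sum_letter)
  also have "\<dots> = (\<Sum>i\<in>{length u..length u + b}. \<phi> (u @ replicate (Suc b) a))"
    by (rule sum.mono_neutral_cong_right) auto
  finally show ?thesis by simp
qed

lemma shuffle_sum_eqI_first:
  assumes "shuffle_sum \<phi> [a] (replicate b a @ u) = 0"
    and "\<And>i. 0 < i \<Longrightarrow> i \<le> length u \<Longrightarrow> \<phi> (replicate b a @ take i u @ a # drop i u) = 0"
  shows "\<phi> (replicate (Suc b) a @ u) = (0::real)"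
proof -
  have "shuffle_sum (\<lambda>w. \<phi> (rev w)) [a] (rev u @ replicate b a) = 0"
    using assms(1) shuffle_sum_rev[of \<phi> "[a]" "rev u @ replicate b a"] by simp
  moreover have "\<phi> (rev (take i (rev u) @ a # drop i (rev u) @ replicate b a)) = 0"
    if "i < length (rev u)" for i
    using assms(2)[of "length u - i"] that by (simp add: rev_take rev_drop)
  ultimately have "\<phi> (rev (rev u @ replicate (Suc b) a)) = 0"
    by (rule shuffle_sum_eqI_last)
  then show ?thesis by (simp add: replicate_app_Cons_same)
qed

definition admissible :: "letter list \<Rightarrow> bool" where
  "admissible u \<longleftrightarrow> u = [] \<or> (\<exists>v. u = LY # v @ [LX])"

lemma word_split_last: "\<exists>v b. u = v @ replicate b a \<and> (v = [] \<or> last v \<noteq> a)"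
proof (induction u rule: rev_induct)
  case (snoc c u)
  then obtain v b where vb: "u = v @ replicate b a" "v = [] \<or> last v \<noteq> a" by blast
  show ?case
  proof (cases "c = a")
    case True
    then have "u @ [c] = v @ replicate (Suc b) a"
      using vb by (simp add: replicate_append_same)
    then show ?thesis using vb by blast
  next
    case False
    then have "u @ [c] = (u @ [c]) @ replicate 0 a" "last (u @ [c]) \<noteq> a" by auto
    then show ?thesis by blast
  qed
qed auto

text \<open>Uniqueness of the regularization in disguise, with \<open>D\<close> the difference of
  two candidates. Trailing \<open>y\<close> and then leading \<open>x\<close> are stripped one at a
  time by shuffling with a single letter, until an admissible word is left.\<close>

lemma shuffle_sum_vanish:
  assumes adm: "\<And>u. admissible u \<Longrightarrow> D u = 0"
    and x: "\<And>u. shuffle_sum D [LX] u = 0" and y: "\<And>u. shuffle_sum D [LY] u = 0"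
  shows "D u = (0::real)"
proof -
  have 1: "D (v @ replicate b LY) = 0" if "v = [] \<or> hd v = LY" "v = [] \<or> last v = LX" for v b
    using that
  proof (induction b arbitrary: v)
    case 0
    have "admissible v"
    proof (cases v)
      case (Cons c v')
      then have "v' \<noteq> []" "c = LY" using 0 by auto
      then have "v = LY # butlast v' @ [LX]" using 0 Cons append_butlast_last_id[of v'] by auto
      then show ?thesis by (auto simp: admissible_def)
    qed (simp add: admissible_def)
    then show ?case by (simp add: adm)
  next
    case (Suc b)
    show ?case
    proof (rule shuffle_sum_eqI_last[OF y])
      fix i assume i: "i < length v"
      \<comment> \<open>An insertion before the last \<open>x\<close> leaves only \<open>b\<close>
        trailing letters \<open>y\<close> and a core that still runs from \<open>y\<close> to
        \<open>x\<close>; hence the induction over arbitrary \<open>v\<close>.\<close>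
      have "D ((take i v @ LY # drop i v) @ replicate b LY) = 0"
      proof (rule Suc.IH)
        show "take i v @ LY # drop i v = [] \<or> hd (take i v @ LY # drop i v) = LY"
          using i Suc.prems by (cases i; cases v) auto
        show "take i v @ LY # drop i v = [] \<or> last (take i v @ LY # drop i v) = LX"
          using i Suc.prems by auto
      qed
      then show "D (take i v @ LY # drop i v @ replicate b LY) = 0" by simp
    qed
  qed
  have 2: "D u = 0" if "u = [] \<or> hd u = LY" for u
  proof -
    obtain v b where vb: "u = v @ replicate b LY" "v = [] \<or> last v \<noteq> LY"
      using word_split_last[of u LY] by blast
    moreover have "c = LX" if "c \<noteq> LY" for c using that by (cases c) auto
    ultimately show ?thesis using 1[of v b] that by (cases "v = []") auto
  qed
  have 3: "D (replicate b LX @ v) = 0" if "v = [] \<or> hd v = LY" for v b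
    using that
  proof (induction b arbitrary: v)
    case (Suc b)
    show ?case
    proof (rule shuffle_sum_eqI_first[OF x])
      fix i assume i: "0 < i" "i \<le> length v"
      show "D (replicate b LX @ take i v @ LX # drop i v) = 0"
        by (rule Suc.IH) (use i Suc.prems in \<open>auto simp: hd_append\<close>)
    qed
  qed (simp add: 2)
  obtain v b where vb: "rev u = v @ replicate b LX" "v = [] \<or> last v \<noteq> LX"
    using word_split_last[of "rev u" LX] by blast
  have "c = LY" if "c \<noteq> LX" for c using that by (cases c) auto
  then have "D (replicate b LX @ rev v) = 0"
    using vb(2) by (intro 3) (auto simp: hd_rev)
  also have "replicate b LX @ rev v = u" using arg_cong[OF vb(1), of rev] by simp
  finally show ?thesis .
qed

lemma word_poly_in_h0: "admissible u \<Longrightarrow> word_poly u \<in> h0"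
proof -
  assume "admissible u"
  then consider "u = []" | v where "u = LY # v @ [LX]" by (auto simp: admissible_def)
  then show ?thesis
  proof cases
    case 1
    then have "word_poly u = scalar 1 + ly * 0 * lx" by (simp add: zero_word_def)
    then show ?thesis unfolding h0_def by blast
  next
    case 2
    then have "word_poly u = scalar 0 + ly * word_poly v * lx" by (simp add: mult_single plus_word_def)
    then show ?thesis unfolding h0_def by blast
  qed
qed

lemma ev_h0_cong:
  assumes "p \<in> h0" "\<And>u. admissible u \<Longrightarrow> \<phi> u = \<psi> u"
  shows "ev \<phi> p = ev \<psi> p"
proof -
  obtain c q where p: "p = scalar c + ly * q * lx" using assms(1) by (auto simp: h0_def)
  have "ev \<phi> (ly * q * lx) = ev \<psi> (ly * q * lx)"
  proof (induction q rule: ncpoly_induct)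
    case (single_add u c q)
    have "\<phi> (LY # letters u @ [LX]) = \<psi> (LY # letters u @ [LX])"
      by (rule assms(2)) (auto simp: admissible_def)
    then show ?case using single_add by (simp add: distrib_left distrib_right ev_add ev_mult)
  qed simp
  moreover have "\<phi> [] = \<psi> []" by (rule assms(2)) (auto simp: admissible_def)
  ultimately show ?thesis by (simp add: p ev_add zero_word_def)
qed

lemma regularization_ev:
  assumes f: "is_shuffle_regularization f"
  shows "f = ev (\<lambda>u. f (word_poly u))"
proof
  fix p
  have add: "f (p + q) = f p + f q" and sc: "f (scalar c * p) = of_rat c * f p" for p q c
    using f by (auto simp: is_shuffle_regularization_def)
  show "f p = ev (\<lambda>u. f (word_poly u)) p"
  proof (induction p rule: ncpoly_induct)
    case zero
    then show ?case using add[of 0 0] by simp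
  next
    case (single_add u c q)
    have "Poly_Mapping.single u c = scalar c * word_poly (letters u)"
      by (simp add: mult_single)
    then show ?case using single_add by (simp add: add ev_add sc ev_scalar_mult)
  qed
qed

text \<open>\<open>\<phi>\<close> is a witness for the definite description, and any other solution
  differs from it by a functional to which \<open>shuffle_sum_vanish\<close> applies, since both are
  multiplicative and vanish at \<open>x\<close> and \<open>y\<close>.\<close>

lemma Z_sh_eqI:
  assumes hom: "shuffle_hom \<phi>" and adm: "\<And>u. admissible u \<Longrightarrow> \<phi> u = mzv (index_of u)"
    and xy: "\<phi> [LX] = 0" "\<phi> [LY] = 0"
  shows "Z_sh = ev \<phi>"
proof -
  have "Z = ev (\<lambda>u. mzv (index_of u))" by (simp add: Z_def ev_def)
  then have Z: "ev \<phi> p = Z p" if "p \<in> h0" for p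
    using ev_h0_cong[OF that adm] by simp
  have "is_shuffle_regularization (ev \<phi>)"
    unfolding is_shuffle_regularization_def
    using hom xy Z by (simp add: ev_add ev_scalar_mult ev_shuffle_prod shuffle_hom_def ev_cmult_fun ev_mult_right_fun)
  moreover have "f = ev \<phi>" if f: "is_shuffle_regularization f" for f
  proof -
    let ?\<psi> = "\<lambda>u. f (word_poly u)"
    have evf: "f = ev ?\<psi>" by (rule regularization_ev[OF f])
    have sh: "shuffle_sum ?\<psi> [a] u = 0" for a u
    proof -
      have "ev ?\<psi> (shuffle_prod (word_poly [a]) (word_poly u)) = shuffle_sum ?\<psi> [a] u"
        by (simp add: ev_shuffle_prod)
      moreover have "f (shuffle_prod (word_poly [a]) (word_poly u)) = f (word_poly [a]) * f (word_poly u)"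
        "f (word_poly [a]) = 0"
        using f by (cases a; simp add: is_shuffle_regularization_def)+
      ultimately show ?thesis using evf by simp
    qed
    have "?\<psi> u - \<phi> u = 0" for u
    proof (rule shuffle_sum_vanish[where D = "\<lambda>u. ?\<psi> u - \<phi> u"])
      fix u assume u: "admissible u"
      then have "f (word_poly u) = Z (word_poly u)"
        using word_poly_in_h0[OF u] f by (auto simp: is_shuffle_regularization_def)
      then show "?\<psi> u - \<phi> u = 0" by (simp add: adm[OF u] Z_def)
    next
      fix u
      show "shuffle_sum (\<lambda>u. ?\<psi> u - \<phi> u) [LX] u = 0" "shuffle_sum (\<lambda>u. ?\<psi> u - \<phi> u) [LY] u = 0"
        using hom xy unfolding shuffle_sum_diff sh by (auto simp: shuffle_hom_def)
    qed
    then have "?\<psi> = \<phi>" by (simp add: fun_eq_iff)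
    then have "ev ?\<psi> = ev \<phi>" by (rule arg_cong)
    then show ?thesis by (rule trans[OF evf])
  qed
  ultimately show ?thesis unfolding Z_sh_def by (rule the_equality)
qed

text \<open>Convolution with respect to deconcatenation. For iterated integrals along two
  consecutive paths this is Chen's formula for the composed path.\<close>

fun conv :: "(letter list \<Rightarrow> real) \<Rightarrow> (letter list \<Rightarrow> real) \<Rightarrow> letter list \<Rightarrow> real" where
  "conv \<phi> \<psi> [] = \<phi> [] * \<psi> []"
| "conv \<phi> \<psi> (a # u) = \<phi> [] * \<psi> (a # u) + conv (\<lambda>w. \<phi> (a # w)) \<psi> u"

lemma conv_eq_sum: "conv \<phi> \<psi> u = (\<Sum>i\<le>length u. \<phi> (take i u) * \<psi> (drop i u))"
  by (induction u arbitrary: \<phi>) (simp_all add: sum.atMost_Suc_shift del: sum.atMost_Suc)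

text \<open>Deconcatenation is multiplicative for the shuffle product: cutting an interleaving of
  \<open>u\<close> and \<open>v\<close> cuts both of them. Therefore convolution preserves shuffle
  homomorphisms.\<close>

lemma shuffle_sum_conv:
  "shuffle_sum (conv \<phi> \<psi>) u v =
     (\<Sum>i\<le>length u. \<Sum>j\<le>length v. shuffle_sum \<phi> (take i u) (take j v) * shuffle_sum \<psi> (drop i u) (drop j v))"
proof (induction u v arbitrary: \<phi> rule: shuffle_words.induct)
  case (3 a u b v)
  let ?Q = "\<lambda>\<phi> u v. (\<Sum>i\<le>length u. \<Sum>j\<le>length v. shuffle_sum \<phi> (take i u) (take j v) * shuffle_sum \<psi> (drop i u) (drop j v))"
  have "shuffle_sum (conv \<phi> \<psi>) (a # u) (b # v) =
    \<phi> [] * shuffle_sum \<psi> (a # u) (b # v) + ?Q (\<lambda>w. \<phi> (a # w)) u (b # v) + ?Q (\<lambda>w. \<phi> (b # w)) (a # u) v"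
    unfolding shuffle_sum.simps conv.simps shuffle_sum_add shuffle_sum_cmult 3[symmetric] by (simp add: algebra_simps)
  also have "\<dots> = ?Q \<phi> (a # u) (b # v)"
    by (simp add: sum.atMost_Suc_shift sum.distrib algebra_simps del: sum.atMost_Suc)
  finally show ?case .
qed (simp_all add: conv_eq_sum)

lemma shuffle_hom_conv:
  assumes "shuffle_hom \<phi>" "shuffle_hom \<psi>"
  shows "shuffle_hom (conv \<phi> \<psi>)"
proof -
  have "shuffle_sum (conv \<phi> \<psi>) u v = conv \<phi> \<psi> u * conv \<phi> \<psi> v" for u v
  proof -
    have "shuffle_sum (conv \<phi> \<psi>) u v = (\<Sum>i\<le>length u. \<Sum>j\<le>length v.
        (\<phi> (take i u) * \<psi> (drop i u)) * (\<phi> (take j v) * \<psi> (drop j v)))"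
      using assms unfolding shuffle_sum_conv by (intro sum.cong) (auto simp: shuffle_hom_def)
    also have "\<dots> = conv \<phi> \<psi> u * conv \<phi> \<psi> v"
      unfolding conv_eq_sum sum_product ..
    finally show ?thesis .
  qed
  then show ?thesis using assms by (simp add: shuffle_hom_def)
qed

section \<open>Polylogarithms and the regularization\<close>

text \<open>The Taylor coefficients of \<open>(1 - t) powr - (1/4)\<close>. By
  \<open>sum_ew\<close>, summing over \<open>k < m\<close> and dividing by \<open>m\<close> costs
  only a factor 4, so bounds by multiples of \<open>ew\<close> survive both letters. The exponent
  1/4 stays below the 1/2 used in the boundary limits.\<close>

definition ew :: "nat \<Rightarrow> real" where "ew m = pochhammer (1/4) m / fact m"

lemma ew_pos: "ew m > 0"
  by (simp add: ew_def pochhammer_pos)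

lemma ew_Suc: "ew (Suc m) = ew m * (1/4 + real m) / (real m + 1)"
  by (simp add: ew_def pochhammer_rec' field_simps)

lemma ew_Suc_le: "ew (Suc m) \<le> ew m"
  using ew_pos[of m] by (simp add: ew_Suc divide_le_eq mult_left_mono)

lemma sum_ew: "(\<Sum>k<m. ew k) = 4 * real m * ew m"
  by (induction m) (simp_all add: ew_Suc field_simps)

lemma sums_ew: "\<bar>t\<bar> < 1 \<Longrightarrow> (\<lambda>m. ew m * t ^ m) sums ((1 - t) powr - (1/4))"
proof -
  assume "\<bar>t\<bar> < 1"
  moreover have "(- (1/4) gchoose n) * (- t) ^ n = ew n * t ^ n" for n
    by (simp add: gbinomial_pochhammer ew_def power_minus[of t])
  ultimately show ?thesis
    using Generalised_Binomial_Theorem.gen_binomial_real[of "- t" "- (1/4)"] by simp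
qed

text \<open>The coefficient of \<open>\<alpha>^j\<close> in
  \<open>(\<Sum> q i \<alpha>^i) / (m - \<alpha>)\<close>, where alpha stands for -A.\<close>

definition dv :: "nat \<Rightarrow> (nat \<Rightarrow> real) \<Rightarrow> nat \<Rightarrow> real" where
  "dv m q j = (\<Sum>i\<le>j. q i / real m ^ (Suc (j - i)))"

lemma dv_0: "real m * dv m q 0 = (if m = 0 then 0 else q 0)"
  by (simp add: dv_def)

lemma dv_Suc: "m > 0 \<Longrightarrow> real m * dv m q (Suc j) = q (Suc j) + dv m q j"
proof -
  assume m: "m > 0"
  have "real m * (q i / real m ^ Suc (Suc j - i)) = q i / real m ^ (Suc (j - i))" if "i \<le> j" for i
    using m that by (simp add: Suc_diff_le)
  then have "(\<Sum>i\<le>j. real m * (q i / real m ^ Suc (Suc j - i))) = dv m q j"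
    unfolding dv_def by (intro sum.cong) auto
  then show ?thesis using m by (simp add: dv_def[of _ _ "Suc j"] distrib_left sum_distrib_left)
qed

lemma dv_nonneg: "(\<And>i. q i \<ge> 0) \<Longrightarrow> dv m q j \<ge> 0"
  unfolding dv_def by (intro sum_nonneg) auto

lemma dv_le: "(\<And>i. q i \<ge> 0) \<Longrightarrow> m > 0 \<Longrightarrow> dv m q j \<le> (\<Sum>i\<le>j. q i) / real m"
  unfolding dv_def sum_divide_distrib
  by (intro sum_mono divide_left_mono) (auto intro: self_le_power)

lemma dv_at_0 [simp]: "dv 0 q j = 0"
  by (simp add: dv_def)

text \<open>Let \<open>u = rev r\<close> be empty or start with \<open>y\<close>. The polylogarithms of the words \<open>x\<^sup>a u\<close> have the
  generating function \<open>\<Sum> Li(x\<^sup>a u) A\<^sup>a = \<Sum> c\<^sub>m(A) t\<^sup>m\<^sup>+\<^sup>A\<close>, and \<open>pcoef r m j\<close> is \<open>(-1)\<^sup>j\<close> times the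
  coefficient of \<open>A\<^sup>j\<close> in \<open>c\<^sub>m(A)\<close>. A last letter \<open>x\<close> divides by \<open>m + A\<close>, which is what \<open>dv\<close> does;
  at \<open>m = 0\<close> it gives \<open>0\<close> since \<open>x / 0 = 0\<close>.\<close>

fun pcoef :: "letter list \<Rightarrow> nat \<Rightarrow> nat \<Rightarrow> real" where
  "pcoef [] m j = (if m = 0 \<and> j = 0 then 1 else 0)"
| "pcoef (LX # r) m j = dv m (pcoef r m) j"
| "pcoef (LY # r) m j = dv m (\<lambda>i. \<Sum>k<m. pcoef r k i) j"

lemma pcoef_nonneg: "pcoef r m j \<ge> 0"
  by (induction r m j rule: pcoef.induct) (auto intro!: dv_nonneg sum_nonneg)

lemma pcoef_at_0: "r \<noteq> [] \<Longrightarrow> pcoef r 0 j = 0"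
  by (cases "(r, 0::nat, j)" rule: pcoef.cases) auto

text \<open>Induction over the letters: an \<open>x\<close> only divides, a \<open>y\<close> uses
  \<open>sum_ew\<close>. The constant is uniform for \<open>j \<le> J\<close> because
  \<open>dv\<close> mixes all coefficients up to \<open>j\<close>.\<close>

lemma pcoef_bound: "\<exists>K\<ge>0. \<forall>j\<le>J. \<forall>m. pcoef r m j \<le> K * ew m"
proof (induction r)
  case Nil
  show ?case using ew_pos by (intro exI[of _ 1]) (auto simp: ew_def intro: divide_nonneg_pos less_imp_le pochhammer_pos)
next
  case (Cons c r)
  then obtain K where K: "K \<ge> 0" "\<And>j m. j \<le> J \<Longrightarrow> pcoef r m j \<le> K * ew m" by blast
  have x: "dv m (pcoef r m) j \<le> (real J + 1) * K * ew m" if "j \<le> J" for j m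
  proof (cases "m = 0")
    case False
    have "dv m (pcoef r m) j \<le> (\<Sum>i\<le>j. pcoef r m i) / real m"
      using False by (intro dv_le pcoef_nonneg) auto
    also have "\<dots> \<le> (\<Sum>i\<le>j. pcoef r m i)"
      using divide_left_mono[of 1 "real m" "\<Sum>i\<le>j. pcoef r m i"] False
      by (simp add: sum_nonneg pcoef_nonneg)
    also have "\<dots> \<le> (\<Sum>i\<le>j. K * ew m)"
      using K(2) that by (intro sum_mono) auto
    also have "\<dots> = (real j + 1) * (K * ew m)" by simp
    also have "\<dots> \<le> (real J + 1) * (K * ew m)"
      using that K(1) ew_pos[of m] by (intro mult_right_mono) auto
    finally show ?thesis by (simp add: mult_ac)
  qed (use K ew_pos[of 0] in \<open>auto intro!: mult_nonneg_nonneg\<close>)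
  have y: "dv m (\<lambda>i. \<Sum>k<m. pcoef r k i) j \<le> (real J + 1) * K * 4 * ew m" if "j \<le> J" for j m
  proof (cases "m = 0")
    case False
    have "dv m (\<lambda>i. \<Sum>k<m. pcoef r k i) j \<le> (\<Sum>i\<le>j. \<Sum>k<m. pcoef r k i) / real m"
      using False by (intro dv_le sum_nonneg pcoef_nonneg) auto
    also have "\<dots> \<le> (\<Sum>i\<le>j. \<Sum>k<m. K * ew k) / real m"
      using K(2) that by (intro divide_right_mono sum_mono) auto
    also have "\<dots> = (real j + 1) * (K * 4 * ew m)"
      using False by (simp add: sum_ew flip: sum_distrib_left)
    also have "\<dots> \<le> (real J + 1) * (K * 4 * ew m)"
      using that K(1) ew_pos[of m] by (intro mult_right_mono) auto
    finally show ?thesis by (simp add: mult_ac)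
  qed (use K ew_pos[of 0] in \<open>auto intro!: mult_nonneg_nonneg\<close>)
  show ?case
  proof (cases c)
    case LX
    then show ?thesis using x K(1) by (intro exI[of _ "(real J + 1) * K"]) auto
  next
    case LY
    then show ?thesis using y K(1) by (intro exI[of _ "(real J + 1) * K * 4"]) auto
  qed
qed

definition PS :: "letter list \<Rightarrow> nat \<Rightarrow> real \<Rightarrow> real" where
  "PS r j t = (suminf (\<lambda>m. pcoef r m j * t ^ m))"

lemma summable_PS:
  assumes "\<bar>t\<bar> < 1" shows "summable (\<lambda>m. pcoef r m j * t ^ m)"
proof -
  obtain K where K: "K \<ge> 0" "\<And>m. pcoef r m j \<le> K * ew m" using pcoef_bound[of j r] by blast
  show ?thesis
  proof (rule summable_comparison_test')
    show "summable (\<lambda>m. K * (ew m * \<bar>t\<bar> ^ m))"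
      using sums_ew[of "\<bar>t\<bar>"] assms by (intro summable_mult sums_summable) auto
    show "norm (pcoef r m j * t ^ m) \<le> K * (ew m * \<bar>t\<bar> ^ m)" for m
      using mult_right_mono[OF K(2)[of m], of "\<bar>t\<bar> ^ m"] pcoef_nonneg[of r m j]
      by (simp add: abs_mult power_abs mult_ac)
  qed
qed

lemma PS_nonneg: "0 \<le> t \<Longrightarrow> t < 1 \<Longrightarrow> PS r j t \<ge> 0"
  unfolding PS_def by (intro suminf_nonneg summable_PS) (auto intro!: mult_nonneg_nonneg pcoef_nonneg)

lemma PS_Nil: "PS [] j t = (if j = 0 then 1 else 0)"
proof -
  have "(\<lambda>m. pcoef [] m j * t ^ m) sums (\<Sum>m\<in>{0}. pcoef [] m j * t ^ m)"
    by (rule sums_finite) auto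
  then show ?thesis by (auto simp: PS_def sums_iff)
qed

lemma PS_le: "\<exists>K\<ge>0. \<forall>t. 0 \<le> t \<longrightarrow> t < 1 \<longrightarrow> PS r j t \<le> K * (1 - t) powr - (1/4)"
proof -
  obtain K where K: "K \<ge> 0" "\<And>m. pcoef r m j \<le> K * ew m" using pcoef_bound[of j r] by blast
  have "PS r j t \<le> K * (1 - t) powr - (1/4)" if "0 \<le> t" "t < 1" for t
  proof -
    have "PS r j t \<le> (suminf (\<lambda>m. K * (ew m * t ^ m)))" unfolding PS_def
    proof (rule suminf_le)
      show "pcoef r m j * t ^ m \<le> K * (ew m * t ^ m)" for m
        using mult_right_mono[OF K(2)[of m], of "t ^ m"] that by (simp add: mult_ac)
      show "summable (\<lambda>m. K * (ew m * t ^ m))"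
        using sums_ew[of t] that by (intro summable_mult sums_summable) auto
    qed (use that in \<open>simp add: summable_PS\<close>)
    also have "\<dots> = K * (1 - t) powr - (1/4)"
      using sums_ew[of t] that by (simp add: suminf_mult sums_iff)
    finally show ?thesis .
  qed
  then show ?thesis using K(1) by blast
qed

text \<open>A nonempty word has no constant term (\<open>pcoef_at_0\<close>), which gains a factor
  \<open>t\<close> over \<open>PS_le\<close>.\<close>

lemma PS_le_0:
  assumes "r \<noteq> []"
  shows "\<exists>K\<ge>0. \<forall>t. 0 \<le> t \<longrightarrow> t < 1 \<longrightarrow> PS r j t \<le> K * t * (1 - t) powr - (1/4)"
proof -
  obtain K where K: "K \<ge> 0" "\<And>m. pcoef r m j \<le> K * ew m" using pcoef_bound[of j r] by blast
  have "PS r j t \<le> K * t * (1 - t) powr - (1/4)" if "0 \<le> t" "t < 1" for t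
  proof -
    have "PS r j t = (suminf (\<lambda>m. pcoef r (Suc m) j * t ^ Suc m))"
      unfolding PS_def using that summable_PS[of t r j]
      by (subst suminf_split_head) (simp_all add: pcoef_at_0[OF assms])
    also have "\<dots> \<le> (suminf (\<lambda>m. K * t * (ew m * t ^ m)))"
    proof (rule suminf_le)
      show "pcoef r (Suc m) j * t ^ Suc m \<le> K * t * (ew m * t ^ m)" for m
      proof -
        have "pcoef r (Suc m) j \<le> K * ew m"
          using K(2)[of "Suc m"] mult_left_mono[OF ew_Suc_le[of m] K(1)] by simp
        from mult_right_mono[OF this, of "t ^ Suc m"] show ?thesis using that by (simp add: mult_ac)
      qed
      show "summable (\<lambda>m. K * t * (ew m * t ^ m))"
        using sums_ew[of t] that by (intro summable_mult sums_summable) auto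
      show "summable (\<lambda>m. pcoef r (Suc m) j * t ^ Suc m)"
        using that summable_PS[of t r j] by (subst summable_Suc_iff) auto
    qed
    also have "\<dots> = K * t * (1 - t) powr - (1/4)"
      using sums_ew[of t] that by (simp add: suminf_mult sums_iff)
    finally show ?thesis .
  qed
  then show ?thesis using K(1) by blast
qed

definition PS' :: "letter list \<Rightarrow> nat \<Rightarrow> real \<Rightarrow> real" where
  "PS' r j t = (suminf (\<lambda>m. diffs (\<lambda>m. pcoef r m j) m * t ^ m))"

lemma PS_deriv: "\<bar>t\<bar> < 1 \<Longrightarrow> (PS r j has_real_derivative PS' r j t) (at t)"
  unfolding PS_def[abs_def] PS'_def by (rule termdiffs_strong'[of 1]) (auto intro: summable_PS)

lemma PS'_sums:
  assumes "\<bar>t\<bar> < 1" shows "(\<lambda>m. real m * pcoef r m j * t ^ m) sums (t * PS' r j t)"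
proof -
  have "summable (\<lambda>m. diffs (\<lambda>m. pcoef r m j) m * t ^ m)"
    by (rule termdiff_converges[of _ 1]) (use assms in \<open>auto intro: summable_PS\<close>)
  then have "(\<lambda>m. t * (diffs (\<lambda>m. pcoef r m j) m * t ^ m)) sums (t * PS' r j t)"
    unfolding PS'_def by (intro sums_mult summable_sums)
  then have "(\<lambda>m. real (Suc m) * pcoef r (Suc m) j * t ^ Suc m) sums (t * PS' r j t)"
    by (simp add: diffs_def mult_ac)
  then show ?thesis by (subst (asm) sums_Suc_iff) simp
qed

text \<open>The common shape of the differential equations satisfied by the coefficient series:
  \<open>Q\<close> is \<open>PS r\<close> for the letter \<open>x\<close> and \<open>t/(1 - t) \<cdot> PS r\<close> for the letter \<open>y\<close>.\<close>

lemma PS_Cons_deriv_aux: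
  assumes t: "\<bar>t\<bar> < 1" and eq: "\<And>m j. pcoef r' m j = dv m (q m) j"
    and q0: "\<And>j. q 0 j = 0" and Q: "\<And>j. (\<lambda>m. q m j * t ^ m) sums Q j"
  shows "t * PS' r' j t = Q j + (if j = 0 then 0 else PS r' (j - 1) t)"
proof (cases j)
  case 0
  have "real m * pcoef r' m 0 = q m 0" for m using dv_0[of m "q m"] by (simp add: eq q0)
  then show ?thesis using PS'_sums[OF t, of r' 0] Q[of 0] 0 by (simp add: sums_iff)
next
  case (Suc i)
  have *: "real m * pcoef r' m (Suc i) = q m (Suc i) + pcoef r' m i" for m
    by (cases "m = 0") (simp_all add: eq q0 dv_Suc)
  have "(\<lambda>m. q m (Suc i) * t ^ m + pcoef r' m i * t ^ m) sums (Q (Suc i) + PS r' i t)"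
    unfolding PS_def by (intro sums_add Q summable_sums summable_PS t)
  then show ?thesis using PS'_sums[OF t, of r' "Suc i"] Suc
    by (simp add: * distrib_right sums_iff)
qed

lemma PS_LX_deriv:
  assumes "\<bar>t\<bar> < 1" "r \<noteq> []"
  shows "t * PS' (LX # r) j t = PS r j t + (if j = 0 then 0 else PS (LX # r) (j - 1) t)"
  by (rule PS_Cons_deriv_aux[where q = "pcoef r"])
     (use assms in \<open>auto simp: pcoef_at_0 PS_def intro: summable_sums summable_PS\<close>)

text \<open>Multiplication by \<open>t / (1 - t)\<close> replaces the coefficients of a power series
  by their sums over \<open>k < m\<close>, which is the operation of a letter
  \<open>y\<close>.\<close>

lemma PS_LY_deriv:
  assumes "\<bar>t\<bar> < 1"
  shows "t * PS' (LY # r) j t = t / (1 - t) * PS r j t + (if j = 0 then 0 else PS (LY # r) (j - 1) t)"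
proof (rule PS_Cons_deriv_aux[where q = "\<lambda>m i. \<Sum>k<m. pcoef r k i"])
  fix j
  have "(\<lambda>k. \<Sum>i\<le>k. (pcoef r i j * t ^ i) * t ^ (k - i)) sums (PS r j t * (suminf (\<lambda>k. t ^ k)))"
    unfolding PS_def
    by (rule Cauchy_product_sums)
       (use assms summable_PS[of "\<bar>t\<bar>" r j] pcoef_nonneg in
         \<open>auto simp: abs_mult power_abs intro: summable_geometric\<close>)
  also have "(\<lambda>k. \<Sum>i\<le>k. (pcoef r i j * t ^ i) * t ^ (k - i)) = (\<lambda>k. (\<Sum>i<Suc k. pcoef r i j) * t ^ k)"
    by (auto simp: sum_distrib_right mult.assoc lessThan_Suc_atMost simp flip: power_add intro!: sum.cong)
  finally have "(\<lambda>k. t * ((\<Sum>i<Suc k. pcoef r i j) * t ^ k)) sums (t * (PS r j t * (suminf (\<lambda>k. t ^ k))))"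
    by (rule sums_mult)
  then have "(\<lambda>k. (\<Sum>i<Suc k. pcoef r i j) * t ^ Suc k) sums (t / (1 - t) * PS r j t)"
    using suminf_geometric[of t] assms by (simp add: mult_ac del: sum.lessThan_Suc)
  then show "(\<lambda>m. (\<Sum>k<m. pcoef r k j) * t ^ m) sums (t / (1 - t) * PS r j t)"
    by (subst (asm) sums_Suc_iff) simp
qed (use assms in auto)

text \<open>\<open>(-1)^a\<close> times the coefficient of \<open>A^a\<close> in the series of
  \<open>t^(m+A)\<close>: the powers of \<open>- ln t\<close> come from expanding
  \<open>t^A\<close>, and the sign makes the function nonnegative.\<close>

definition Li_abs :: "nat \<Rightarrow> letter list \<Rightarrow> real \<Rightarrow> real" where
  "Li_abs a r t = (\<Sum>j\<le>a. (- ln t) ^ j / fact j * PS r (a - j) t)"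

lemma Li_abs_Nil: "Li_abs a [] t = (- ln t) ^ a / fact a"
proof -
  have "Li_abs a [] t = (\<Sum>j\<le>a. if j = a then (- ln t) ^ a / fact a else 0)"
    unfolding Li_abs_def by (intro sum.cong) (auto simp: PS_Nil)
  then show ?thesis by simp
qed

lemma Li_abs_nonneg: "0 < t \<Longrightarrow> t < 1 \<Longrightarrow> Li_abs a r t \<ge> 0"
  unfolding Li_abs_def by (intro sum_nonneg mult_nonneg_nonneg divide_nonneg_pos zero_le_power PS_nonneg) auto

text \<open>Differentiating the powers of \<open>- ln t\<close> produces the terms
  \<open>PS r' (j - 1)\<close> of the equation for the series with the opposite sign. Only the part
  with \<open>PS r\<close> survives, so logarithms and series together obey the equation of an
  iterated integral.\<close>

lemma Li_abs_deriv_aux: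
  assumes t: "0 < t" "t < 1"
    and eq: "\<And>j. t * PS' r' j t = c * PS r j t + (if j = 0 then 0 else PS r' (j - 1) t)"
  shows "(Li_abs a r' has_real_derivative Li_abs a r t * (c / t)) (at t)"
proof -
  let ?l = "- ln t"
  have "(Li_abs a r' has_real_derivative
     (\<Sum>j\<le>a. (real j * ?l ^ (j - 1) * (- (1 / t)) / fact j) * PS r' (a - j) t
         + PS' r' (a - j) t * (?l ^ j / fact j))) (at t)"
    unfolding Li_abs_def[abs_def] using t
    by (auto intro!: derivative_eq_intros PS_deriv sum.cong simp: field_simps)
  also have "(\<Sum>j\<le>a. (real j * ?l ^ (j - 1) * (- (1 / t)) / fact j) * PS r' (a - j) t
         + PS' r' (a - j) t * (?l ^ j / fact j)) =
      (\<Sum>j\<le>a. (real j * ?l ^ (j - 1) * (- (1 / t)) / fact j) * PS r' (a - j) t)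
         + (\<Sum>j\<le>a. PS' r' (a - j) t * (?l ^ j / fact j))"
    by (rule sum.distrib)
  also have "(\<Sum>j\<le>a. (real j * ?l ^ (j - 1) * (- (1 / t)) / fact j) * PS r' (a - j) t) =
     - (\<Sum>j<a. ?l ^ j / fact j * PS r' (a - Suc j) t) / t"
    by (simp add: lessThan_Suc_atMost[symmetric] sum.lessThan_Suc_shift sum_negf[symmetric]
        sum_divide_distrib mult_ac del: sum.lessThan_Suc)
  also have "(\<Sum>j\<le>a. PS' r' (a - j) t * (?l ^ j / fact j)) =
     (\<Sum>j\<le>a. c * PS r (a - j) t * (?l ^ j / fact j)) / t
      + (\<Sum>j\<le>a. (if a - j = 0 then 0 else PS r' (a - j - 1) t) * (?l ^ j / fact j)) / t"
    unfolding sum_divide_distrib sum.distrib[symmetric]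
  proof (rule sum.cong[OF refl])
    fix j
    have "PS' r' (a - j) t = (c * PS r (a - j) t + (if a - j = 0 then 0 else PS r' (a - j - 1) t)) / t"
      using eq[of "a - j"] t by (simp add: field_simps)
    then show "PS' r' (a - j) t * (?l ^ j / fact j) = c * PS r (a - j) t * (?l ^ j / fact j) / t
       + (if a - j = 0 then 0 else PS r' (a - j - 1) t) * (?l ^ j / fact j) / t"
      by (simp only: add_divide_distrib distrib_right times_divide_eq_left)
  qed
  also have "(\<Sum>j\<le>a. (if a - j = 0 then 0 else PS r' (a - j - 1) t) * (?l ^ j / fact j)) =
     (\<Sum>j<a. ?l ^ j / fact j * PS r' (a - Suc j) t)"
    by (rule sum.mono_neutral_cong_right) auto
  also have "(\<Sum>j\<le>a. c * PS r (a - j) t * (?l ^ j / fact j)) = c * Li_abs a r t"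
    by (simp add: Li_abs_def sum_distrib_left mult_ac)
  finally show ?thesis by (simp add: mult_ac)
qed

lemma Li_abs_LX_deriv:
  "0 < t \<Longrightarrow> t < 1 \<Longrightarrow> r \<noteq> [] \<Longrightarrow> (Li_abs a (LX # r) has_real_derivative Li_abs a r t * (1 / t)) (at t)"
  by (rule Li_abs_deriv_aux) (auto simp: PS_LX_deriv)

lemma Li_abs_LY_deriv:
  "0 < t \<Longrightarrow> t < 1 \<Longrightarrow> (Li_abs a (LY # r) has_real_derivative Li_abs a r t * (1 / (1 - t))) (at t)"
  using Li_abs_deriv_aux[of t "LY # r" "t / (1 - t)" r a] by (simp add: PS_LY_deriv)

section \<open>Boundary behaviour of polylogarithms at 0 and 1\<close>

lemma ev_at_right_0: "\<forall>\<^sub>F t::real in at_right 0. 0 < t \<and> t < 1"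
  by (auto simp: eventually_at_right[of 0 1] intro: exI[of _ 1])

lemma ev_at_left_1: "\<forall>\<^sub>F t::real in at_left 1. 0 < t \<and> t < 1"
  by (auto simp: eventually_at_left[of 0 1] intro: exI[of _ 0])

text \<open>In the applications one factor vanishes almost like \<open>t\<close> and the other grows
  only like a power of a logarithm; the two half powers, which cancel, separate these
  estimates.\<close>

lemma tendsto_0_powr_half:
  assumes "((\<lambda>t. f t * t powr - (1/2)) \<longlongrightarrow> 0) (at_right 0)" "((\<lambda>t. g t * t powr (1/2)) \<longlongrightarrow> 0) (at_right 0)"
  shows "((\<lambda>t. f t * g t :: real) \<longlongrightarrow> 0) (at_right 0)"
proof -
  have "((\<lambda>t. (f t * t powr - (1/2)) * (g t * t powr (1/2))) \<longlongrightarrow> 0 * 0) (at_right 0)"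
    by (intro tendsto_mult assms)
  moreover have "\<forall>\<^sub>F t in at_right 0. (f t * t powr - (1/2)) * (g t * t powr (1/2)) = f t * g t"
    using ev_at_right_0 by eventually_elim (simp add: powr_minus field_simps)
  ultimately show ?thesis by (simp add: filterlim_cong)
qed

lemma PS_tendsto:
  assumes le: "\<And>t. 0 \<le> t \<Longrightarrow> t < 1 \<Longrightarrow> PS r j t \<le> g t" and F: "\<forall>\<^sub>F t in F. 0 < t \<and> t < 1"
    and h: "\<And>t. h t \<ge> 0" and lim: "((\<lambda>t. (- ln t) ^ i * g t * h t) \<longlongrightarrow> 0) F"
  shows "((\<lambda>t. (- ln t) ^ i * PS r j t * h t) \<longlongrightarrow> 0) F"
proof (rule real_tendsto_sandwich[OF _ _ _ lim])
  show "\<forall>\<^sub>F t in F. 0 \<le> (- ln t) ^ i * PS r j t * h t"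
    using F by eventually_elim (auto intro!: mult_nonneg_nonneg PS_nonneg h)
  show "\<forall>\<^sub>F t in F. (- ln t) ^ i * PS r j t * h t \<le> (- ln t) ^ i * g t * h t"
    using F by eventually_elim (intro mult_right_mono mult_left_mono le h; simp)
qed auto

lemma PS_tendsto_0:
  assumes "r \<noteq> []"
  shows "((\<lambda>t. (- ln t) ^ i * PS r j t * t powr - (1/2)) \<longlongrightarrow> 0) (at_right 0)"
proof -
  obtain K where K: "\<And>t. 0 \<le> t \<Longrightarrow> t < 1 \<Longrightarrow> PS r j t \<le> K * t * (1 - t) powr - (1/4)"
    using PS_le_0[OF assms] by blast
  show ?thesis by (rule PS_tendsto[OF K ev_at_right_0]) (simp, simp, simp, real_asymp)
qed

lemma PS_tendsto_0':
  "((\<lambda>t. (- ln t) ^ i * PS r j t * t powr (1/2)) \<longlongrightarrow> 0) (at_right 0)"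
proof -
  obtain K where K: "\<And>t. 0 \<le> t \<Longrightarrow> t < 1 \<Longrightarrow> PS r j t \<le> K * (1 - t) powr - (1/4)"
    using PS_le by blast
  show ?thesis by (rule PS_tendsto[OF K ev_at_right_0]) (simp, simp, simp, real_asymp)
qed

lemma PS_tendsto_1:
  "((\<lambda>t. (- ln t) ^ i * PS r j t * (1 - t) powr (1/2)) \<longlongrightarrow> 0) (at_left 1)"
proof -
  obtain K where K: "\<And>t. 0 \<le> t \<Longrightarrow> t < 1 \<Longrightarrow> PS r j t \<le> K * (1 - t) powr - (1/4)"
    using PS_le by blast
  show ?thesis by (rule PS_tendsto[OF K ev_at_left_1]) (simp, simp, simp, real_asymp)
qed

lemma Li_abs_tendsto_0:
  assumes "r \<noteq> []" shows "((\<lambda>t. Li_abs a r t * t powr - (1/2)) \<longlongrightarrow> 0) (at_right 0)"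
  unfolding Li_abs_def sum_distrib_right
proof (rule tendsto_null_sum)
  fix j
  show "((\<lambda>t. (- ln t) ^ j / fact j * PS r (a - j) t * t powr - (1/2)) \<longlongrightarrow> 0) (at_right 0)"
    using tendsto_mult_right_zero[OF PS_tendsto_0[OF assms, of j "a - j"], of "1 / fact j"]
    by (simp add: mult_ac)
qed

lemma Li_abs_tendsto_0': "((\<lambda>t. Li_abs a r t * t powr (1/2)) \<longlongrightarrow> 0) (at_right 0)"
  unfolding Li_abs_def sum_distrib_right
proof (rule tendsto_null_sum)
  fix j
  show "((\<lambda>t. (- ln t) ^ j / fact j * PS r (a - j) t * t powr (1/2)) \<longlongrightarrow> 0) (at_right 0)"
    using tendsto_mult_right_zero[OF PS_tendsto_0'[of j r "a - j"], of "1 / fact j"]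
    by (simp add: mult_ac)
qed

lemma Li_abs_tendsto_1: "((\<lambda>t. Li_abs a r t * (1 - t) powr (1/2)) \<longlongrightarrow> 0) (at_left 1)"
  unfolding Li_abs_def sum_distrib_right
proof (rule tendsto_null_sum)
  fix j
  show "((\<lambda>t. (- ln t) ^ j / fact j * PS r (a - j) t * (1 - t) powr (1/2)) \<longlongrightarrow> 0) (at_left 1)"
    using tendsto_mult_right_zero[OF PS_tendsto_1[of j r "a - j"], of "1 / fact j"]
    by (simp add: mult_ac)
qed

definition form_of :: "letter \<Rightarrow> real \<Rightarrow> real" where
  "form_of c t = (case c of LX \<Rightarrow> 1 / t | LY \<Rightarrow> 1 / (1 - t))"

text \<open>Iterated integrals from the tangential base point at \<open>0\<close>: a last letter \<open>c\<close> integrates against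
  \<open>form_of c\<close>, and \<open>Li (x\<^sup>a)\<close> is \<open>ln\<^sup>a / a!\<close>.\<close>

definition Li :: "letter list \<Rightarrow> real \<Rightarrow> real" where
  "Li u t = (- 1) ^ length (takeWhile (\<lambda>c. c = LX) u) *
     Li_abs (length (takeWhile (\<lambda>c. c = LX) u)) (rev (dropWhile (\<lambda>c. c = LX) u)) t"

lemma only_LX: "LY \<notin> set u \<Longrightarrow> u = replicate (length u) LX"
  by (induction u) (auto, metis letter.exhaust)

lemma Li_LX_LY:
  assumes "v = [] \<or> hd v = LY"
  shows "Li (replicate a LX @ v) t = (- 1) ^ a * Li_abs a (rev v) t"
proof -
  have 1: "takeWhile (\<lambda>c. c = LX) v = []" "dropWhile (\<lambda>c. c = LX) v = v"
    using assms by (cases v; auto)+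
  then have "takeWhile (\<lambda>c. c = LX) (replicate a LX @ v) = replicate a LX"
    "dropWhile (\<lambda>c. c = LX) (replicate a LX @ v) = v" by (induction a) auto
  then show ?thesis by (simp add: Li_def)
qed

lemma Li_replicate_LX: "Li (replicate a LX) t = ln t ^ a / fact a"
  using Li_LX_LY[of "[]" a t] by (simp add: Li_abs_Nil power_minus[of "ln t"])

lemma Li_Nil [simp]: "Li [] t = 1"
  using Li_replicate_LX[of 0 t] by simp

lemma word_split_first:
  obtains a v where "u = replicate a LX @ v" "v = [] \<or> hd v = LY"
proof -
  obtain v b where vb: "rev u = v @ replicate b LX" "v = [] \<or> last v \<noteq> LX"
    using word_split_last[of "rev u" LX] by blast
  have "u = replicate b LX @ rev v" using arg_cong[OF vb(1), of rev] by simp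
  moreover have "rev v = [] \<or> hd (rev v) = LY"
    using vb(2) letter.exhaust[of "last v"] by (auto simp: hd_rev)
  ultimately show ?thesis using that by blast
qed

text \<open>The differential equation characterizing iterated integrals. A pure power of
  \<open>x\<close> is a power of \<open>ln t\<close> and falls outside the series; in all other
  cases appending \<open>c\<close> keeps the form \<open>x^a v\<close> with \<open>v\<close>
  starting with \<open>y\<close>.\<close>

lemma Li_snoc_deriv:
  assumes t: "0 < t" "t < 1"
  shows "(Li (u @ [c]) has_real_derivative Li u t * form_of c t) (at t)"
proof -
  obtain a v where v: "u = replicate a LX @ v" "v = [] \<or> hd v = LY" by (rule word_split_first)
  have Lu: "Li u t = (- 1) ^ a * Li_abs a (rev v) t" using v by (simp add: Li_LX_LY)
  show ?thesis
  proof (cases "v = [] \<and> c = LX")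
    case True
    then have "u @ [c] = replicate (Suc a) LX" "u = replicate a LX" using v by (simp_all add: replicate_append_same)
    then have "Li (u @ [c]) = (\<lambda>t. ln t ^ Suc a / fact (Suc a))" "Li u t = ln t ^ a / fact a"
      by (simp_all only: Li_replicate_LX[abs_def])
    moreover have "((\<lambda>t. ln t ^ Suc a / fact (Suc a)) has_real_derivative ln t ^ a / fact a * (1 / t)) (at t)"
    proof -
      have "((\<lambda>t. ln t ^ Suc a / fact (Suc a)) has_real_derivative
          real (Suc a) * (1 / t * ln t ^ (Suc a - Suc 0)) / fact (Suc a)) (at t)"
        by (intro DERIV_cdivide DERIV_power DERIV_ln_divide t)
      moreover have "k * (1 / t * x) / (k * f) = x / f * (1 / t)" if "k \<noteq> 0" for k x f :: real
        using that by simp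
      from this[of "real (Suc a)"]
      have "real (Suc a) * (1 / t * ln t ^ (Suc a - Suc 0)) / fact (Suc a) = ln t ^ a / fact a * (1 / t)"
        by (simp only: fact_Suc of_nat_mult of_nat_fact) simp
      ultimately show ?thesis by (simp only:)
    qed
    ultimately show ?thesis using True by (simp add: form_of_def)
  next
    case False
    then have h: "v @ [c] = [] \<or> hd (v @ [c]) = LY"
      using v letter.exhaust[of c] by (cases v) auto
    have "Li (u @ [c]) = (\<lambda>t. (- 1) ^ a * Li_abs a (c # rev v) t)"
      using Li_LX_LY[OF h, of a] v by auto
    moreover have "(Li_abs a (c # rev v) has_real_derivative Li_abs a (rev v) t * form_of c t) (at t)"
      using Li_abs_LX_deriv[OF t, of "rev v" a] Li_abs_LY_deriv[OF t, of a "rev v"] False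
      by (cases c) (auto simp: form_of_def)
    ultimately show ?thesis by (auto simp: Lu intro!: derivative_eq_intros)
  qed
qed

lemma Li_tendsto_0: "LY \<in> set u \<Longrightarrow> ((\<lambda>t. Li u t * t powr - (1/2)) \<longlongrightarrow> 0) (at_right 0)"
proof -
  assume "LY \<in> set u"
  moreover obtain a v where v: "u = replicate a LX @ v" "v = [] \<or> hd v = LY" by (rule word_split_first)
  ultimately have "rev v \<noteq> []" by auto
  from tendsto_mult_right_zero[OF Li_abs_tendsto_0[OF this, of a], of "(- 1) ^ a"]
  show ?thesis using v by (simp add: Li_LX_LY mult.assoc)
qed

lemma Li_tendsto_0': "((\<lambda>t. Li u t * t powr (1/2)) \<longlongrightarrow> 0) (at_right 0)"
proof -
  obtain a v where v: "u = replicate a LX @ v" "v = [] \<or> hd v = LY" by (rule word_split_first)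
  from tendsto_mult_right_zero[OF Li_abs_tendsto_0'[of a "rev v"], of "(- 1) ^ a"]
  show ?thesis using v by (simp add: Li_LX_LY mult.assoc)
qed

lemma Li_tendsto_1: "((\<lambda>t. Li u t * (1 - t) powr (1/2)) \<longlongrightarrow> 0) (at_left 1)"
proof -
  obtain a v where v: "u = replicate a LX @ v" "v = [] \<or> hd v = LY" by (rule word_split_first)
  from tendsto_mult_right_zero[OF Li_abs_tendsto_1[of a "rev v"], of "(- 1) ^ a"]
  show ?thesis using v by (simp add: Li_LX_LY mult.assoc)
qed

text \<open>The substitution t -> 1 - t exchanges dt/t with dt/(1 - t) and reverses the path, so
  this is the regularized iterated integral of \<open>u\<close> from \<open>t\<close> to 1.\<close>

definition Li_dual :: "letter list \<Rightarrow> real \<Rightarrow> real" where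
  "Li_dual u t = Li (rev (map swap_letter u)) (1 - t)"

lemma Li_dual_Nil [simp]: "Li_dual [] t = 1"
  by (simp add: Li_dual_def)

lemma Li_dual_Cons_deriv:
  assumes t: "0 < t" "t < 1"
  shows "(Li_dual (c # u) has_real_derivative - (Li_dual u t * form_of c t)) (at t)"
proof -
  have "((\<lambda>t. Li (rev (map swap_letter u) @ [swap_letter c]) (1 - t)) has_real_derivative
      Li (rev (map swap_letter u)) (1 - t) * form_of (swap_letter c) (1 - t) * (- 1)) (at t)"
    by (rule DERIV_chain'[where f = "\<lambda>t. 1 - t"])
       (use t in \<open>auto intro!: derivative_eq_intros Li_snoc_deriv\<close>)
  moreover have "form_of (swap_letter c) (1 - t) = form_of c t" by (cases c) (auto simp: form_of_def)
  ultimately show ?thesis by (simp add: Li_dual_def[abs_def])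
qed

lemma Li_dual_tendsto_1: "LX \<in> set u \<Longrightarrow> ((\<lambda>t. Li_dual u t * (1 - t) powr - (1/2)) \<longlongrightarrow> 0) (at_left 1)"
proof -
  assume u: "LX \<in> set u"
  have "swap_letter LX \<in> swap_letter ` set u" using u by (rule imageI)
  then have 1: "LY \<in> set (rev (map swap_letter u))" by simp
  have 2: "filterlim (\<lambda>t::real. 1 - t) (at_right 0) (at_left 1)" by real_asymp
  show ?thesis using filterlim_compose[OF Li_tendsto_0[OF 1] 2] by (simp add: Li_dual_def)
qed

lemma Li_dual_tendsto_0: "((\<lambda>t. Li_dual u t * t powr (1/2)) \<longlongrightarrow> 0) (at_right 0)"
proof -
  have 2: "filterlim (\<lambda>t::real. 1 - t) (at_left 1) (at_right 0)" by real_asymp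
  show ?thesis using filterlim_compose[OF Li_tendsto_1 2] by (simp add: Li_dual_def)
qed

lemma LR_tendsto_0:
  assumes "LY \<in> set u" shows "((\<lambda>t. Li u t * Li_dual w t) \<longlongrightarrow> 0) (at_right 0)"
  by (rule tendsto_0_powr_half[OF Li_tendsto_0[OF assms] Li_dual_tendsto_0])

text \<open>A letter \<open>x\<close> of \<open>w\<close> becomes a \<open>y\<close> under the
  substitution and makes \<open>Li_dual w\<close> small at 1; this outweighs the growth of
  \<open>Li u\<close>, which is weaker than (1 - t)^(-1/2).\<close>

lemma LR_tendsto_1:
  assumes "LX \<in> set w" shows "((\<lambda>t. Li u t * Li_dual w t) \<longlongrightarrow> 0) (at_left 1)"
proof -
  have "((\<lambda>t. (Li u t * (1 - t) powr (1/2)) * (Li_dual w t * (1 - t) powr - (1/2))) \<longlongrightarrow> 0 * 0) (at_left 1)"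
    by (intro tendsto_mult Li_tendsto_1 Li_dual_tendsto_1 assms)
  moreover have "\<forall>\<^sub>F t in at_left 1. (Li u t * (1 - t) powr (1/2)) * (Li_dual w t * (1 - t) powr - (1/2)) = Li u t * Li_dual w t"
    using ev_at_left_1 by eventually_elim (simp add: powr_minus field_simps)
  ultimately show ?thesis by (simp add: filterlim_cong)
qed

section \<open>Shuffle relations for polylogarithms and composition of paths\<close>

lemma shuffle_sum_tendsto:
  assumes "\<And>w. mset w = mset u + mset v \<Longrightarrow> ((\<lambda>t. \<phi> t w) \<longlongrightarrow> 0) F"
  shows "((\<lambda>t. shuffle_sum (\<phi> t) u v) \<longlongrightarrow> 0) F"
  using assms
proof (induction u v arbitrary: \<phi> rule: shuffle_words.induct)
  case (3 a u b v)
  have "((\<lambda>t. shuffle_sum (\<lambda>w. \<phi> t (a # w)) u (b # v)) \<longlongrightarrow> 0) F"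
    by (rule 3(1)) (rule 3(3), simp)
  moreover have "((\<lambda>t. shuffle_sum (\<lambda>w. \<phi> t (b # w)) (a # u) v) \<longlongrightarrow> 0) F"
    by (rule 3(2)) (rule 3(3), simp)
  ultimately show ?case by (auto intro!: tendsto_add_zero)
qed auto

lemma shuffle_sum_deriv:
  assumes "\<And>w. ((\<lambda>t. \<phi> t w) has_real_derivative \<phi>' w) (at t)"
  shows "((\<lambda>t. shuffle_sum (\<phi> t) u v) has_real_derivative shuffle_sum \<phi>' u v) (at t)"
  using assms
  by (induction u v arbitrary: \<phi> \<phi>' rule: shuffle_words.induct) (auto intro!: derivative_intros)

lemma const_on_unit_interval:
  assumes "\<And>t. 0 < t \<Longrightarrow> t < 1 \<Longrightarrow> (f has_real_derivative 0) (at t)"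
    and "0 < s" "s < 1" "0 < t" "t < (1::real)"
  shows "f s = f t"
  using DERIV_isconst3[of 0 1 s t f] assms by auto

lemma zero_on_unit_interval:
  assumes f: "\<And>t. 0 < t \<Longrightarrow> t < 1 \<Longrightarrow> (f has_real_derivative 0) (at t)"
    and lim: "(f \<longlongrightarrow> 0) (at_right 0) \<or> (f \<longlongrightarrow> 0) (at_left 1)" and t: "0 < t" "t < (1::real)"
  shows "f t = (0::real)"
proof -
  have eq: "f s = f t" if "0 < s \<and> s < 1" for s
    using const_on_unit_interval[OF f] that t by blast
  from lim show ?thesis
  proof
    assume "(f \<longlongrightarrow> 0) (at_right 0)"
    moreover have "((\<lambda>s. f t) \<longlongrightarrow> f t) (at_right 0)" by simp
    moreover have "\<forall>\<^sub>F s in at_right 0. f s = f t" using ev_at_right_0 by eventually_elim (rule eq)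
    ultimately show "f t = 0" by (simp add: filterlim_cong tendsto_const_iff)
  next
    assume "(f \<longlongrightarrow> 0) (at_left 1)"
    moreover have "\<forall>\<^sub>F s in at_left 1. f s = f t" using ev_at_left_1 by eventually_elim (rule eq)
    ultimately show "f t = 0" by (simp add: filterlim_cong tendsto_const_iff)
  qed
qed

text \<open>By induction on the total length both sides have the same derivative, so their
  difference is constant. If a \<open>y\<close> occurs, the constant is found at 0; words in
  \<open>x\<close> alone are powers of \<open>ln t\<close> and are compared at 1 instead.\<close>

lemma shuffle_hom_Li:
  assumes t: "0 < t" "t < 1" shows "shuffle_hom (\<lambda>w. Li w t)"
proof -
  have "shuffle_sum (\<lambda>w. Li w t) u v = Li u t * Li v t" if "0 < t" "t < 1" for u v t
    using that
  proof (induction "length u + length v" arbitrary: u v t rule: less_induct)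
    case less
    consider "u = []" | "v = []" | u' a v' b where "u = u' @ [a]" "v = v' @ [b]"
      by (cases u rule: rev_cases; cases v rule: rev_cases) auto
    then show ?case
    proof cases
      case 3
      have "shuffle_sum (\<lambda>w. Li w t) u v - Li u t * Li v t = 0"
      proof (rule zero_on_unit_interval[where f = "\<lambda>t. shuffle_sum (\<lambda>w. Li w t) u v - Li u t * Li v t"])
        fix s :: real assume s: "0 < s" "s < 1"
        have "((\<lambda>t. shuffle_sum (\<lambda>w. Li w t) u v) has_real_derivative
           (shuffle_sum (\<lambda>w. Li w s * form_of a s) u' v + shuffle_sum (\<lambda>w. Li w s * form_of b s) u v')) (at s)"
          unfolding 3 shuffle_sum_snoc by (intro derivative_intros shuffle_sum_deriv Li_snoc_deriv s)
        also have "shuffle_sum (\<lambda>w. Li w s * form_of a s) u' v = form_of a s * (Li u' s * Li v s)"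
          using less.hyps[of u' v s] s 3 shuffle_sum_cmult[of "form_of a s" "\<lambda>w. Li w s" u' v] by (simp add: mult_ac)
        also have "shuffle_sum (\<lambda>w. Li w s * form_of b s) u v' = form_of b s * (Li u s * Li v' s)"
          using less.hyps[of u v' s] s 3 shuffle_sum_cmult[of "form_of b s" "\<lambda>w. Li w s" u v'] by (simp add: mult_ac)
        finally have 1: "((\<lambda>t. shuffle_sum (\<lambda>w. Li w t) u v) has_real_derivative
            (form_of a s * (Li u' s * Li v s) + form_of b s * (Li u s * Li v' s))) (at s)" .
        have 2: "((\<lambda>t. Li u t * Li v t) has_real_derivative
            (Li u' s * form_of a s) * Li v s + (Li v' s * form_of b s) * Li u s) (at s)"
          unfolding 3 by (intro DERIV_mult Li_snoc_deriv s)
        show "((\<lambda>t. shuffle_sum (\<lambda>w. Li w t) u v - Li u t * Li v t) has_real_derivative 0) (at s)"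
          using DERIV_diff[OF 1 2] by (simp add: algebra_simps)
      next
        show "((\<lambda>t. shuffle_sum (\<lambda>w. Li w t) u v - Li u t * Li v t) \<longlongrightarrow> 0) (at_right 0) \<or>
           ((\<lambda>t. shuffle_sum (\<lambda>w. Li w t) u v - Li u t * Li v t) \<longlongrightarrow> 0) (at_left 1)"
        proof (cases "LY \<in> set u \<union> set v")
          case True
          have lim: "((\<lambda>t. Li w t) \<longlongrightarrow> 0) (at_right 0)" if "LY \<in> set w" for w
            using LR_tendsto_0[OF that, of "[]"] by simp
          have lim2: "((\<lambda>t. Li w t * Li w' t) \<longlongrightarrow> 0) (at_right 0)" if "LY \<in> set w" for w w'
            by (rule tendsto_0_powr_half[OF Li_tendsto_0[OF that] Li_tendsto_0'])
          have "((\<lambda>t. shuffle_sum (\<lambda>w. Li w t) u v) \<longlongrightarrow> 0) (at_right 0)"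
          proof (rule shuffle_sum_tendsto)
            fix w assume "mset w = mset u + mset v"
            then have "set w = set u \<union> set v" by (metis set_mset_mset set_mset_union)
            then show "(Li w \<longlongrightarrow> 0) (at_right 0)" using True by (intro lim) auto
          qed
          moreover have "((\<lambda>t. Li u t * Li v t) \<longlongrightarrow> 0) (at_right 0)"
            using lim2[of u v] lim2[of v u] True by (auto simp: mult.commute)
          ultimately have "((\<lambda>t. shuffle_sum (\<lambda>w. Li w t) u v - Li u t * Li v t) \<longlongrightarrow> 0 - 0) (at_right 0)"
            by (intro tendsto_diff)
          then show ?thesis by simp
        next
          case False
          have lim: "((\<lambda>t. Li w t) \<longlongrightarrow> 0) (at_left 1)" if "LY \<notin> set w" "w \<noteq> []" for w
          proof -
            have "Li w = (\<lambda>t. ln t ^ length w / fact (length w))"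
              using only_LX[OF that(1)] Li_replicate_LX by metis
            moreover have "((\<lambda>t::real. ln t ^ n / fact n) \<longlongrightarrow> 0) (at_left 1)" if "n > 0" for n
            proof -
              have "((\<lambda>t::real. ln t ^ n / fact n) \<longlongrightarrow> ln 1 ^ n / fact n) (at_left 1)"
                by (intro tendsto_intros) auto
              then show ?thesis using that by (simp add: zero_power)
            qed
            ultimately show ?thesis using that(2) by simp
          qed
          have "((\<lambda>t. shuffle_sum (\<lambda>w. Li w t) u v) \<longlongrightarrow> 0) (at_left 1)"
          proof (rule shuffle_sum_tendsto)
            fix w assume w: "mset w = mset u + mset v"
            then have "set w = set u \<union> set v" by (metis set_mset_mset set_mset_union)
            moreover have "w \<noteq> []" using w 3 by auto
            ultimately show "(Li w \<longlongrightarrow> 0) (at_left 1)" using False by (intro lim) auto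
          qed
          moreover have "((\<lambda>t. Li u t * Li v t) \<longlongrightarrow> 0 * 0) (at_left 1)"
            using False 3 by (intro tendsto_mult lim) auto
          ultimately have "((\<lambda>t. shuffle_sum (\<lambda>w. Li w t) u v - Li u t * Li v t) \<longlongrightarrow> 0 - 0) (at_left 1)"
            by (intro tendsto_diff) auto
          then show ?thesis by simp
        qed
      qed (use less.prems in auto)
      then show ?thesis by simp
    qed auto
  qed
  then show ?thesis using t by (simp add: shuffle_hom_def)
qed

lemma shuffle_hom_Li_dual:
  assumes "0 < t" "t < 1" shows "shuffle_hom (\<lambda>w. Li_dual w t)"
proof -
  have "shuffle_sum (\<lambda>w. Li_dual w t) u v = Li_dual u t * Li_dual v t" for u v
  proof -
    have "shuffle_sum (\<lambda>w. Li_dual w t) u v = shuffle_sum (\<lambda>w. Li w (1 - t)) (rev (map swap_letter u)) (rev (map swap_letter v))"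
      by (simp add: Li_dual_def shuffle_sum_rev shuffle_sum_map)
    then show ?thesis using shuffle_hom_Li[of "1 - t"] assms by (simp add: shuffle_hom_def Li_dual_def)
  qed
  then show ?thesis by (simp add: shuffle_hom_def)
qed

text \<open>The regularization is composition of paths: the part of the word left of the cut is
  integrated from \<open>0\<close> to \<open>t\<close>, the part right of it from \<open>t\<close> to \<open>1\<close>.\<close>

definition reg_zeta :: "letter list \<Rightarrow> real" where
  "reg_zeta u = conv (\<lambda>w. Li w (1/2)) (\<lambda>w. Li_dual w (1/2)) u"

lemma shuffle_hom_reg_zeta: "shuffle_hom reg_zeta"
proof -
  have "shuffle_hom (conv (\<lambda>w. Li w (1/2)) (\<lambda>w. Li_dual w (1/2)))" by (intro shuffle_hom_conv shuffle_hom_Li shuffle_hom_Li_dual) auto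
  then show ?thesis by (simp add: reg_zeta_def[abs_def])
qed

text \<open>Differentiation telescopes over the position of the cut: the letter leaving the left
  part in one summand leaves the right part in its neighbour, with the opposite sign. Only the last
  letter of the fixed prefix \<open>v\<close> has no partner, so nothing remains for empty
  \<open>v\<close>.\<close>

lemma conv_LR_deriv:
  assumes t: "0 < t" "t < 1"
  shows "((\<lambda>t. conv (\<lambda>w. Li (v @ w) t) (\<lambda>w. Li_dual w t) h) has_real_derivative
     (if v = [] then 0 else Li (butlast v) t * form_of (last v) t * Li_dual h t)) (at t)"
proof (induction h arbitrary: v)
  case Nil
  show ?case
  proof (cases v rule: rev_cases)
    case (snoc v' c)
    then show ?thesis using Li_snoc_deriv[OF t, of v' c] by simp
  qed simp
next
  case (Cons a h)
  have L': "(Li v has_real_derivative (if v = [] then 0 else Li (butlast v) t * form_of (last v) t)) (at t)"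
  proof (cases v rule: rev_cases)
    case (snoc v' c)
    then show ?thesis using Li_snoc_deriv[OF t, of v' c] by simp
  next
    case Nil
    then show ?thesis by (simp add: Li_Nil[abs_def])
  qed
  have "((\<lambda>t. conv (\<lambda>w. Li ((v @ [a]) @ w) t) (\<lambda>w. Li_dual w t) h) has_real_derivative
     Li v t * form_of a t * Li_dual h t) (at t)"
    using Cons.IH[of "v @ [a]"] by simp
  from DERIV_add[OF DERIV_mult[OF L' Li_dual_Cons_deriv[OF t, of a h]] this]
  show ?case by (simp add: algebra_simps split: if_splits)
qed

lemma reg_zeta_eq_conv:
  assumes "0 < t" "t < 1" shows "conv (\<lambda>w. Li w t) (\<lambda>w. Li_dual w t) u = reg_zeta u"
  unfolding reg_zeta_def
  by (rule const_on_unit_interval[where f = "\<lambda>t. conv (\<lambda>w. Li w t) (\<lambda>w. Li_dual w t) u"])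
     (use conv_LR_deriv[of _ "[]"] assms in auto)

text \<open>Among the summands of the path composition for \<open>v x h\<close>, those with the cut
  to the right of the marked \<open>x\<close>. By \<open>cut_sum_deriv\<close> this is, up to a
  constant, the integral over the position of that \<open>x\<close>.\<close>

definition cut_sum :: "letter list \<Rightarrow> letter list \<Rightarrow> real \<Rightarrow> real" where
  "cut_sum v h t = conv (\<lambda>w. Li (v @ LX # w) t) (\<lambda>w. Li_dual w t) h"

lemma cut_sum_deriv:
  assumes "0 < t" "t < 1"
  shows "(cut_sum v h has_real_derivative Li v t * Li_dual h t * (1 / t)) (at t)"
  using conv_LR_deriv[OF assms, of "v @ [LX]" h] by (simp add: cut_sum_def[abs_def] form_of_def mult_ac)

lemma cut_sum_tendsto_0:
  assumes "LY \<in> set v" shows "(cut_sum v h \<longlongrightarrow> 0) (at_right 0)"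
  unfolding cut_sum_def[abs_def] conv_eq_sum
  by (intro tendsto_null_sum LR_tendsto_0) (use assms in auto)

text \<open>In the missing summands the marked \<open>x\<close> lies in the right part, and those
  vanish at 1 by \<open>LR_tendsto_1\<close>.\<close>

lemma cut_sum_tendsto_1: "(cut_sum v h \<longlongrightarrow> reg_zeta (v @ LX # h)) (at_left 1)"
proof -
  have *: "((\<lambda>t. conv (\<lambda>w. Li (u @ w) t) (\<lambda>w. Li_dual w t) (v @ LX # h)
      - conv (\<lambda>w. Li (u @ v @ LX # w) t) (\<lambda>w. Li_dual w t) h) \<longlongrightarrow> 0) (at_left 1)" for u
  proof (induction v arbitrary: u)
    case Nil
    then show ?case using LR_tendsto_1[of "LX # h" u] by simp
  next
    case (Cons a v)
    have "((\<lambda>t. Li u t * Li_dual (a # v @ LX # h) t +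
      (conv (\<lambda>w. Li ((u @ [a]) @ w) t) (\<lambda>w. Li_dual w t) (v @ LX # h)
      - conv (\<lambda>w. Li ((u @ [a]) @ v @ LX # w) t) (\<lambda>w. Li_dual w t) h)) \<longlongrightarrow> 0 + 0) (at_left 1)"
      by (intro tendsto_add Cons.IH LR_tendsto_1) auto
    then show ?case by (simp add: algebra_simps)
  qed
  have "\<forall>\<^sub>F t in at_left 1. conv (\<lambda>w. Li ([] @ w) t) (\<lambda>w. Li_dual w t) (v @ LX # h)
      - conv (\<lambda>w. Li ([] @ v @ LX # w) t) (\<lambda>w. Li_dual w t) h = reg_zeta (v @ LX # h) - cut_sum v h t"
    using ev_at_left_1 by eventually_elim (simp add: reg_zeta_eq_conv cut_sum_def)
  with *[of "[]"] have "((\<lambda>t. reg_zeta (v @ LX # h) - cut_sum v h t) \<longlongrightarrow> 0) (at_left 1)"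
    by (simp add: filterlim_cong)
  then have "((\<lambda>t. reg_zeta (v @ LX # h) - (reg_zeta (v @ LX # h) - cut_sum v h t)) \<longlongrightarrow> reg_zeta (v @ LX # h) - 0) (at_left 1)"
    by (intro tendsto_diff tendsto_const)
  then show ?thesis by simp
qed

text \<open>The composition does not depend on the cut point, so it is read off at the end where
  both terms vanish: 1 for \<open>x\<close>, 0 for \<open>y\<close>.\<close>

lemma reg_zeta_letter: "reg_zeta [c] = 0"
proof -
  have eq: "Li [c] t + Li_dual [c] t = reg_zeta [c]" if "0 < t \<and> t < 1" for t
    using reg_zeta_eq_conv[of t "[c]"] that by simp
  show ?thesis
  proof (cases c)
    case LX
    have "((\<lambda>t. Li [c] t + Li_dual [c] t) \<longlongrightarrow> 0 + 0) (at_left 1)"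
    proof (intro tendsto_add)
      have "((\<lambda>t::real. ln t) \<longlongrightarrow> 0) (at_left 1)" by real_asymp
      moreover have "Li [c] = ln" using Li_replicate_LX[of 1] LX by auto
      ultimately show "(Li [c] \<longlongrightarrow> 0) (at_left 1)" by simp
      show "(Li_dual [c] \<longlongrightarrow> 0) (at_left 1)" using LR_tendsto_1[of "[c]" "[]"] LX by simp
    qed
    moreover have "\<forall>\<^sub>F t in at_left 1. Li [c] t + Li_dual [c] t = reg_zeta [c]"
      using ev_at_left_1 by eventually_elim (rule eq)
    ultimately show ?thesis by (simp add: filterlim_cong tendsto_const_iff)
  next
    case LY
    have "((\<lambda>t. Li [c] t + Li_dual [c] t) \<longlongrightarrow> 0 + 0) (at_right 0)"
    proof (intro tendsto_add)
      have "((\<lambda>t::real. ln (1 - t)) \<longlongrightarrow> 0) (at_right 0)" by real_asymp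
      then show "(Li_dual [c] \<longlongrightarrow> 0) (at_right 0)" using Li_replicate_LX[of 1] LY by (simp add: Li_dual_def[abs_def])
      show "(Li [c] \<longlongrightarrow> 0) (at_right 0)" using LR_tendsto_0[of "[c]" "[]"] LY by simp
    qed
    moreover have "\<forall>\<^sub>F t in at_right 0. Li [c] t + Li_dual [c] t = reg_zeta [c]"
      using ev_at_right_0 by eventually_elim (rule eq)
    ultimately show ?thesis by (simp add: filterlim_cong tendsto_const_iff)
  qed
qed

section \<open>Multiple zeta values as values of the regularization\<close>

text \<open>Prefixing 0 encodes positivity and gives the empty tuple the last entry 0, in accordance
  with \<open>pcoef [] 0 0 = 1\<close>.\<close>

definition incr :: "nat \<Rightarrow> nat \<Rightarrow> nat list set" where
  "incr d m = {ms. length ms = d \<and> sorted_wrt (<) (0 # ms) \<and> last (0 # ms) = m}"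

definition mterm :: "nat list \<Rightarrow> nat list \<Rightarrow> real" where
  "mterm ks ms = (\<Prod>i<length ks. 1 / real (ms ! i) ^ (ks ! i))"

lemma incr_0: "incr 0 m = (if m = 0 then {[]} else {})"
  by (auto simp: incr_def)

lemma incr_Suc: "incr (Suc d) m = (\<Union>k<m. (\<lambda>ms. ms @ [m]) ` incr d k)"
proof (intro equalityI subsetI)
  fix ms assume ms: "ms \<in> incr (Suc d) m"
  then obtain ns k where ns: "ms = ns @ [k]" by (cases ms rule: rev_cases) (auto simp: incr_def)
  have k: "k = m" using ms ns by (simp add: incr_def)
  have s: "sorted_wrt (<) ((0 # ns) @ [m])" using ms ns k by (simp add: incr_def)
  then have "last (0 # ns) < m" by (subst (asm) sorted_wrt_append) (metis last_in_set list.distinct(1) list.set_intros(1))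
  moreover have "ns \<in> incr d (last (0 # ns))"
  proof -
    have "sorted_wrt (<) (0 # ns)" using s by (simp only: sorted_wrt_append)
    then show ?thesis using ms ns by (simp add: incr_def)
  qed
  ultimately show "ms \<in> (\<Union>k<m. (\<lambda>ms. ms @ [m]) ` incr d k)" using ns k by blast
next
  fix ms assume "ms \<in> (\<Union>k<m. (\<lambda>ms. ms @ [m]) ` incr d k)"
  then obtain k ns where k: "k < m" and ns: "ns \<in> incr d k" "ms = ns @ [m]" by blast
  have "i \<le> k" if "i \<in> set (0 # ns)" for i
  proof -
    have s: "sorted_wrt (<) (0 # ns)" "0 # ns = butlast (0 # ns) @ [k]"
      using ns(1) append_butlast_last_id[of "0 # ns"] by (auto simp: incr_def)
    then have "sorted_wrt (<) (butlast (0 # ns) @ [k])" by metis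
    then have "\<forall>j\<in>set (butlast (0 # ns)). j < k" by (simp add: sorted_wrt_append)
    moreover have "i \<in> set (butlast (0 # ns) @ [k])" using that s(2) by metis
    ultimately show ?thesis by auto
  qed
  then have "sorted_wrt (<) ((0 # ns) @ [m])"
    using k ns(1) unfolding sorted_wrt_append incr_def by fastforce
  then show "ms \<in> incr (Suc d) m" using ns by (simp add: incr_def)
qed

lemma finite_incr: "finite (incr d m)"
  by (induction d arbitrary: m) (simp_all add: incr_0 incr_Suc)

lemma incr_disjoint: "k \<noteq> l \<Longrightarrow> incr d k \<inter> incr d l = {}"
  by (auto simp: incr_def)

lemma mterm_nonneg: "mterm ks ms \<ge> 0"
  unfolding mterm_def by (intro prod_nonneg) auto

lemma mterm_snoc: "length ms = length ks \<Longrightarrow> mterm (ks @ [k]) (ms @ [m]) = mterm ks ms / real m ^ k"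
  by (simp add: mterm_def nth_append)

lemma index_of_snoc_LY: "index_of (u @ [LY]) = index_of u @ [1]"
proof (induction u rule: index_of.induct)
  case (3 u)
  have "takeWhile (\<lambda>a. a = LX) (u @ [LY]) = takeWhile (\<lambda>a. a = LX) u" by (induction u) auto
  then show ?case using 3 by simp
qed auto

lemma index_of_Nil_iff: "index_of u = [] \<longleftrightarrow> LY \<notin> set u"
  by (induction u rule: index_of.induct) auto

lemma index_of_snoc_LX:
  "LY \<in> set u \<Longrightarrow> index_of (u @ [LX]) = butlast (index_of u) @ [Suc (last (index_of u))]"
proof (induction u rule: index_of.induct)
  case (3 u)
  show ?case
  proof (cases "LY \<in> set u")
    case True
    then have "takeWhile (\<lambda>a. a = LX) (u @ [LX]) = takeWhile (\<lambda>a. a = LX) u"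
      by (induction u) auto
    then show ?thesis using 3 True by (simp add: index_of_Nil_iff)
  next
    case False
    then obtain n where u: "u = replicate n LX" using only_LX by blast
    have "index_of (replicate n LX @ [LX]) = []" "index_of (replicate n LX) = []"
      "takeWhile (\<lambda>a. a = LX) (replicate n LX @ [LX]) = replicate (Suc n) LX"
      "takeWhile (\<lambda>a. a = LX) (replicate n LX) = replicate n LX" for n
      by (induction n) auto
    then show ?thesis unfolding u by simp
  qed
qed auto

text \<open>At \<open>j = 0\<close> the operation \<open>dv\<close> is division by \<open>m\<close>:
  a final \<open>y\<close> adds a new largest index, a final \<open>x\<close> raises the exponent of
  the largest index.\<close>

lemma pcoef_eq_sum_incr:
  "u = [] \<or> hd u = LY \<Longrightarrow>
     pcoef (rev u) m 0 = (\<Sum>ms\<in>incr (length (index_of u)) m. mterm (index_of u) ms)"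
proof (induction u arbitrary: m rule: rev_induct)
  case Nil
  then show ?case by (simp add: incr_0 mterm_def)
next
  case (snoc c u)
  have IH: "pcoef (rev u) m 0 = (\<Sum>ms\<in>incr (length (index_of u)) m. mterm (index_of u) ms)" for m
    using snoc by (cases u) auto
  let ?ks = "index_of u"
  show ?case
  proof (cases c)
    case LY
    have "(\<Sum>ms\<in>incr (Suc (length ?ks)) m. mterm (?ks @ [1]) ms) =
      (\<Sum>k<m. \<Sum>ms\<in>(\<lambda>ms. ms @ [m]) ` incr (length ?ks) k. mterm (?ks @ [1]) ms)"
      unfolding incr_Suc
      by (rule sum.UNION_disjoint) (use incr_disjoint in \<open>fastforce simp: finite_incr\<close>)+
    also have "\<dots> = (\<Sum>k<m. \<Sum>ms\<in>incr (length ?ks) k. mterm (?ks @ [1]) (ms @ [m]))"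
      by (subst sum.reindex) (auto simp: inj_on_def)
    also have "\<dots> = (\<Sum>k<m. \<Sum>ms\<in>incr (length ?ks) k. mterm ?ks ms / real m)"
      by (intro sum.cong refl) (auto simp: incr_def mterm_snoc)
    also have "\<dots> = pcoef (rev (u @ [c])) m 0"
      using LY by (simp add: dv_def IH sum_divide_distrib)
    finally show ?thesis using LY by (simp add: index_of_snoc_LY)
  next
    case LX
    then have "u \<noteq> []" "hd u = LY" using snoc.prems by (cases u; auto)+
    then have yu: "LY \<in> set u" using hd_in_set by metis
    then have ks: "?ks \<noteq> []" by (simp add: index_of_Nil_iff)
    let ?ks' = "butlast ?ks @ [Suc (last ?ks)]"
    have *: "mterm ?ks' ms = mterm ?ks ms / real m" if "ms \<in> incr (length ?ks) m" for ms
    proof -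
      have "ms \<noteq> []" using that ks by (auto simp: incr_def)
      then have ms: "ms = butlast ms @ [m]" "length (butlast ms) = length (butlast ?ks)"
        using that append_butlast_last_id[of ms] by (auto simp: incr_def)
      have "mterm ?ks' ms = mterm (butlast ?ks) (butlast ms) / real m ^ Suc (last ?ks)"
        by (subst ms(1)) (rule mterm_snoc[OF ms(2)])
      also have "\<dots> = mterm (butlast ?ks @ [last ?ks]) (butlast ms @ [m]) / real m"
        by (simp add: mterm_snoc[OF ms(2)])
      also have "\<dots> = mterm ?ks ms / real m"
        using ks ms(1) by simp
      finally show ?thesis .
    qed
    have "pcoef (rev (u @ [c])) m 0 = (\<Sum>ms\<in>incr (length ?ks) m. mterm ?ks ms / real m)"
      using LX by (simp add: dv_def IH sum_divide_distrib)
    also have "\<dots> = (\<Sum>ms\<in>incr (length ?ks') m. mterm ?ks' ms)"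
      using * ks by (intro sum.cong) auto
    finally show ?thesis using LX yu by (simp add: index_of_snoc_LX)
  qed
qed

text \<open>The converse of Abel's theorem for nonnegative coefficients: partial sums are bounded by
  the limit, and \<open>c n * t ^ n \<le> c n\<close> gives the reverse inequality.\<close>

lemma nonneg_power_series_limit_sums:
  assumes nn: "\<And>n. 0 \<le> c n" and summable: "\<And>t. 0 < t \<Longrightarrow> t < 1 \<Longrightarrow> summable (\<lambda>n. c n * t ^ n)"
    and lim: "((\<lambda>t::real. suminf (\<lambda>n. c n * t ^ n)) \<longlongrightarrow> l) (at_left 1)"
  shows "c sums (l::real)"
proof -
  have partial: "(\<Sum>n<N. c n) \<le> l" for N
  proof (rule tendsto_le[OF _ lim])
    show "((\<lambda>t. \<Sum>n<N. c n * t ^ n) \<longlongrightarrow> (\<Sum>n<N. c n)) (at_left 1)"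
      by (rule tendsto_eq_intros refl | simp)+
    show "\<forall>\<^sub>F t in at_left 1. (\<Sum>n<N. c n * t ^ n) \<le> suminf (\<lambda>n. c n * t ^ n)"
      using ev_at_left_1 by eventually_elim (auto intro!: sum_le_suminf summable nn mult_nonneg_nonneg)
  qed auto
  then have sm: "summable c" by (intro summableI_nonneg_bounded[of _ l] nn) auto
  have "l \<le> suminf c"
  proof (rule tendsto_upperbound[OF lim])
    show "\<forall>\<^sub>F t in at_left 1. suminf (\<lambda>n. c n * t ^ n) \<le> suminf c"
      using ev_at_left_1
    proof eventually_elim
      case (elim t)
      have "c n * t ^ n \<le> c n" for n
        using mult_left_mono[OF power_le_one[of t n] nn[of n]] elim by simp
      then show ?case using elim by (intro suminf_le summable sm) auto
    qed
  qed auto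
  moreover have "suminf c \<le> l" by (intro suminf_le_const sm partial)
  ultimately show ?thesis using sm by (simp add: sums_iff)
qed

text \<open>Cutting at the final \<open>x\<close> shows that the regularized value is the limit of
  \<open>Li u\<close> at 1, where no logarithms occur. The coefficient of index \<open>m\<close> is
  the finite sum over the tuples with largest entry \<open>m\<close>.\<close>

lemma reg_zeta_mzv:
  assumes "admissible u" shows "reg_zeta u = mzv (index_of u)"
proof (cases "u = []")
  case True
  have "mzv [] = 1"
  proof -
    have E: "{ms::nat list. length ms = length [] \<and> sorted_wrt (<) ms \<and> (\<forall>m\<in>set ms. 0 < m)} = {[]}" by auto
    show ?thesis unfolding mzv_def E by simp
  qed
  then show ?thesis using True shuffle_hom_reg_zeta by (simp add: shuffle_hom_def)
next
  case False
  then obtain v where u: "u = LY # v @ [LX]" using assms by (auto simp: admissible_def)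
  have hd: "hd u = LY" using u by simp
  have Li: "Li u t = suminf (\<lambda>m. pcoef (rev u) m 0 * t ^ m)" for t
    using Li_LX_LY[of u 0 t] hd by (simp add: Li_abs_def PS_def)
  have "((\<lambda>t. Li u t) \<longlongrightarrow> reg_zeta u) (at_left 1)"
    using cut_sum_tendsto_1[of "LY # v" "[]"] by (simp add: cut_sum_def[abs_def] u)
  then have "(\<lambda>m. pcoef (rev u) m 0) sums reg_zeta u"
    by (intro nonneg_power_series_limit_sums) (auto simp: pcoef_nonneg Li summable_PS)
  then have 1: "((\<lambda>m. pcoef (rev u) m 0) has_sum reg_zeta u) UNIV"
    by (rule sums_nonneg_imp_has_sum) (rule pcoef_nonneg)
  let ?ks = "index_of u"
  let ?f = "\<lambda>(m::nat, ms). mterm ?ks ms"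
  have 2: "((\<lambda>ms. ?f (m, ms)) has_sum pcoef (rev u) m 0) (incr (length ?ks) m)" for m
    using pcoef_eq_sum_incr[of u m] hd by (auto intro!: has_sum_finiteI simp: finite_incr)
  have "(?f has_sum reg_zeta u) (Sigma UNIV (incr (length ?ks)))"
    by (intro has_sum_SigmaI[OF 2 1] summable_on_SigmaI[OF 2])
       (use 1 in \<open>auto simp: mterm_nonneg summable_on_def\<close>)
  also have "?this \<longleftrightarrow> (mterm ?ks has_sum reg_zeta u)
      {ms. length ms = length ?ks \<and> sorted_wrt (<) ms \<and> (\<forall>m\<in>set ms. 0 < m)}"
    by (rule has_sum_reindex_bij_witness[where i = "\<lambda>ms. (last (0 # ms), ms)" and j = snd])
       (auto simp: incr_def)
  finally show ?thesis unfolding mzv_def mterm_def by (simp add: infsumI)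
qed

theorem Z_sh_eq: "Z_sh = ev reg_zeta"
  by (rule Z_sh_eqI) (auto intro: shuffle_hom_reg_zeta reg_zeta_mzv reg_zeta_letter)

section \<open>Integrals for regularized values of words with a summed tail\<close>

lemma Li_replicate_LY:
  assumes "0 < t" "t < 1" shows "Li (replicate k LY) t = (- ln (1 - t)) ^ k / fact k"
  using assms
proof (induction k arbitrary: t)
  case (Suc k)
  have "Li (replicate (Suc k) LY) t - (- ln (1 - t)) ^ Suc k / fact (Suc k) = 0"
  proof (rule zero_on_unit_interval[where f = "\<lambda>t. Li (replicate (Suc k) LY) t - (- ln (1 - t)) ^ Suc k / fact (Suc k)"])
    fix s :: real assume s: "0 < s" "s < 1"
    have 1: "(Li (replicate (Suc k) LY) has_real_derivative (- ln (1 - s)) ^ k / fact k * (1 / (1 - s))) (at s)"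
      using Li_snoc_deriv[OF s, of "replicate k LY" LY] Suc.IH[OF s] by (simp add: form_of_def replicate_append_same)
    have "((\<lambda>t. (- ln (1 - t)) ^ Suc k / fact (Suc k)) has_real_derivative
        real (Suc k) * (1 / (1 - s) * (- ln (1 - s)) ^ (Suc k - Suc 0)) / fact (Suc k)) (at s)"
      using s by (intro DERIV_cdivide DERIV_power) (auto intro!: derivative_eq_intros)
    moreover have "k * (1 / t * x) / (k * f) = x / f * (1 / t)" if "k \<noteq> 0" for k x f t :: real
      using that by simp
    from this[of "real (Suc k)"]
    have "real (Suc k) * (1 / (1 - s) * (- ln (1 - s)) ^ (Suc k - Suc 0)) / fact (Suc k)
        = (- ln (1 - s)) ^ k / fact k * (1 / (1 - s))"
      by (simp only: fact_Suc of_nat_mult of_nat_fact) simp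
    ultimately have 2: "((\<lambda>t. (- ln (1 - t)) ^ Suc k / fact (Suc k)) has_real_derivative
        (- ln (1 - s)) ^ k / fact k * (1 / (1 - s))) (at s)" by (simp only:)
    from DERIV_diff[OF 1 2] show "((\<lambda>t. Li (replicate (Suc k) LY) t - (- ln (1 - t)) ^ Suc k / fact (Suc k))
        has_real_derivative 0) (at s)" by simp
  next
    have "((\<lambda>t. Li (replicate (Suc k) LY) t) \<longlongrightarrow> 0) (at_right 0)"
      using LR_tendsto_0[of "replicate (Suc k) LY" "[]"] by simp
    moreover have "((\<lambda>t::real. (- ln (1 - t)) ^ Suc k / fact (Suc k)) \<longlongrightarrow> (- ln (1 - 0)) ^ Suc k / fact (Suc k)) (at_right 0)"
      by (intro tendsto_intros) auto
    ultimately show "((\<lambda>t. Li (replicate (Suc k) LY) t - (- ln (1 - t)) ^ Suc k / fact (Suc k)) \<longlongrightarrow> 0) (at_right 0) \<or>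
      ((\<lambda>t. Li (replicate (Suc k) LY) t - (- ln (1 - t)) ^ Suc k / fact (Suc k)) \<longlongrightarrow> 0) (at_left 1)"
      using tendsto_diff by fastforce
  qed (use Suc.prems in auto)
  then show ?case by simp
qed simp

lemma Li_dual_replicate_LX: "0 < t \<Longrightarrow> t < 1 \<Longrightarrow> Li_dual (replicate k LX) t = (- ln t) ^ k / fact k"
  by (simp add: Li_dual_def Li_replicate_LY)

lemma Li_dual_replicate_LY: "Li_dual (replicate k LY) t = ln (1 - t) ^ k / fact k"
  by (simp add: Li_dual_def Li_replicate_LX)

text \<open>The integral is taken in \<open>ennreal\<close>, so that later sums and integrals can be
  exchanged freely.\<close>

lemma nn_FTC_unit_interval:
  assumes F: "\<And>t. 0 < t \<Longrightarrow> t < 1 \<Longrightarrow> (F has_real_derivative f t) (at t)"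
    and cont: "\<And>t. 0 < t \<Longrightarrow> t < 1 \<Longrightarrow> isCont f t"
    and nn: "\<And>t. 0 < t \<Longrightarrow> t < 1 \<Longrightarrow> f t \<ge> 0"
    and A: "(F \<longlongrightarrow> A) (at_right 0)" and B: "(F \<longlongrightarrow> B) (at_left 1)"
  shows "(\<integral>\<^sup>+t\<in>{0<..<1}. ennreal (f t) \<partial>lborel) = ennreal (B - A)" and "A \<le> B"
proof -
  have A': "((F \<circ> real_of_ereal) \<longlongrightarrow> A) (at_right (ereal 0))"
    using A by (simp add: ereal_tendsto_simps)
  have B': "((F \<circ> real_of_ereal) \<longlongrightarrow> B) (at_left (ereal 1))"
    using B by (simp add: ereal_tendsto_simps)
  have AE: "AE x in lborel. ereal 0 < ereal x \<longrightarrow> ereal x < ereal 1 \<longrightarrow> 0 \<le> f x"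
    using nn by auto
  note I = interval_integral_FTC_nonneg[of "ereal 0" "ereal 1" F f, OF _ _ _ AE A' B']
  have int: "set_integrable lborel {0<..<1} f" using I(1) F cont by simp
  have val: "(LBINT x:{0<..<1}. f x) = B - A"
    using I(2) F cont by (simp add: interval_lebesgue_integral_def)
  have "(\<integral>\<^sup>+t. ennreal (indicator {0<..<1} t *\<^sub>R f t) \<partial>lborel) = ennreal (B - A)"
    using int val nn unfolding set_integrable_def set_lebesgue_integral_def
    by (subst nn_integral_eq_integral) (auto simp: indicator_def)
  also have "(\<lambda>t. ennreal (indicator {0<..<1} t *\<^sub>R f t)) = (\<lambda>t. ennreal (f t) * indicator {0<..<1} t)"
    by (auto simp: indicator_def)
  finally show "(\<integral>\<^sup>+t\<in>{0<..<1}. ennreal (f t) \<partial>lborel) = ennreal (B - A)" .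
  have "0 \<le> (LBINT x:{0<..<1}. f x)"
    unfolding set_lebesgue_integral_def using nn by (intro integral_nonneg_AE AE_I2) (auto simp: indicator_def)
  then show "A \<le> B" using val by simp
qed

lemma Li_abs_isCont: 
  assumes t: "0 < t" "t < 1" shows "isCont (Li_abs a r) t"
proof -
  have "isCont (PS r j) t" for j using PS_deriv[of t r j] t by (intro DERIV_isCont) auto
  then show ?thesis unfolding Li_abs_def[abs_def] using t by (intro continuous_intros) auto
qed

text \<open>If \<open>v\<close> has no \<open>y\<close>, a single \<open>cut_sum\<close> may diverge
  at 0: the right part can have a nonzero limit and multiply a power of \<open>ln t\<close>. Only
  the whole shuffle sum is tractable; \<open>shuffle_sum_conv\<close> splits it into products whose
  right factors are products of logarithms.\<close>

lemma shuffle_sum_cut_sum_tendsto_0: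
  assumes v: "LY \<in> set v \<or> (v = replicate a LX \<and> b > 0)"
  shows "((\<lambda>t. shuffle_sum (\<lambda>h. cut_sum v h t) (replicate n LX) (replicate b LY)) \<longlongrightarrow> 0) (at_right 0)"
proof (cases "LY \<in> set v")
  case True
  then show ?thesis by (intro shuffle_sum_tendsto cut_sum_tendsto_0)
next
  case False
  then have v: "v = replicate a LX" "b > 0" using v by auto
  have term0: "((\<lambda>t. shuffle_sum (\<lambda>w. Li (v @ LX # w) t) (replicate i LX) (replicate j LY)
         * shuffle_sum (\<lambda>w. Li_dual w t) (replicate (n - i) LX) (replicate (b - j) LY)) \<longlongrightarrow> 0) (at_right 0)"
    if ij: "i \<le> n" "j \<le> b" for i j
  proof -
    have Li_dual: "\<forall>\<^sub>F t in at_right 0. shuffle_sum (\<lambda>w. Li_dual w t) (replicate k LX) (replicate l LY)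
        = (- ln t) ^ k / fact k * (ln (1 - t) ^ l / fact l)" for k l
      using ev_at_right_0
    proof eventually_elim
      case (elim t)
      then show ?case using shuffle_hom_Li_dual[of t] by (simp add: shuffle_hom_def Li_dual_replicate_LX Li_dual_replicate_LY)
    qed
    show ?thesis
    proof (cases "j = 0")
      \<comment> \<open>For \<open>j > 0\<close> the words on the left contain a \<open>y\<close>
        and vanish faster than the logarithms on the right grow.\<close>
      case False
      show ?thesis
      proof (rule tendsto_0_powr_half)
        have "((\<lambda>t. shuffle_sum (\<lambda>w. Li (v @ LX # w) t * t powr - (1/2)) (replicate i LX) (replicate j LY)) \<longlongrightarrow> 0) (at_right 0)"
        proof (rule shuffle_sum_tendsto)
          fix w assume "mset w = mset (replicate i LX) + mset (replicate j LY)"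
          then have "set w = set (replicate i LX) \<union> set (replicate j LY)" by (metis set_mset_mset set_mset_union)
          then show "((\<lambda>t. Li (v @ LX # w) t * t powr - (1/2)) \<longlongrightarrow> 0) (at_right 0)"
            using False by (intro Li_tendsto_0) auto
        qed
        then show "((\<lambda>t. shuffle_sum (\<lambda>w. Li (v @ LX # w) t) (replicate i LX) (replicate j LY) * t powr - (1/2)) \<longlongrightarrow> 0) (at_right 0)"
          using shuffle_sum_cmult[of "t powr - (1/2)" for t] by (simp add: mult.commute)
        have "((\<lambda>t::real. (- ln t) ^ (n - i) / fact (n - i) * (ln (1 - t) ^ (b - j) / fact (b - j)) * t powr (1/2)) \<longlongrightarrow> 0) (at_right 0)"
        proof -
          have "((\<lambda>t::real. (- ln t) ^ (n - i) * t powr (1/2)) \<longlongrightarrow> 0) (at_right 0)" by real_asymp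
          moreover have "((\<lambda>t::real. ln (1 - t) ^ (b - j) / fact (b - j) / fact (n - i)) \<longlongrightarrow> ln (1 - 0) ^ (b - j) / fact (b - j) / fact (n - i)) (at_right 0)"
            by (intro tendsto_intros) auto
          ultimately have "((\<lambda>t::real. ((- ln t) ^ (n - i) * t powr (1/2)) * (ln (1 - t) ^ (b - j) / fact (b - j) / fact (n - i)))
             \<longlongrightarrow> 0 * (ln (1 - 0) ^ (b - j) / fact (b - j) / fact (n - i))) (at_right 0)" by (rule tendsto_mult)
          then show ?thesis by (simp add: mult_ac)
        qed
        moreover have "\<forall>\<^sub>F t in at_right 0. (- ln t) ^ (n - i) / fact (n - i) * (ln (1 - t) ^ (b - j) / fact (b - j)) * t powr (1/2) =
           shuffle_sum (\<lambda>w. Li_dual w t) (replicate (n - i) LX) (replicate (b - j) LY) * t powr (1/2)"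
          using Li_dual[of "n - i" "b - j"] by eventually_elim simp
        ultimately show "((\<lambda>t. shuffle_sum (\<lambda>w. Li_dual w t) (replicate (n - i) LX) (replicate (b - j) LY) * t powr (1/2)) \<longlongrightarrow> 0) (at_right 0)"
          by (rule Lim_transform_eventually)
      qed
    next
      case True
      \<comment> \<open>For \<open>j = 0\<close> all \<open>b > 0\<close> letters \<open>y\<close>
        stand on the right; one factor \<open>ln (1 - t)\<close> is of order \<open>t\<close> and
        absorbs every power of \<open>ln t\<close>.\<close>
      obtain b' where b': "b = Suc b'" using v(2) by (cases b) auto
      have 1: "((\<lambda>t::real. ln t ^ p * (- ln t) ^ q * ln (1 - t)) \<longlongrightarrow> 0) (at_right 0)" for p q :: nat by real_asymp
      have 2: "((\<lambda>t::real. ln (1 - t) ^ b') \<longlongrightarrow> ln (1 - 0) ^ b') (at_right 0)"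
        by (intro tendsto_intros) auto
      have "((\<lambda>t::real. ln t ^ p / fact p * ((- ln t) ^ q / fact q * (ln (1 - t) ^ b / fact b))) \<longlongrightarrow> 0) (at_right 0)" for p q
        using tendsto_mult[OF tendsto_mult[OF 1 2] tendsto_const[of "1 / (fact p * fact q * fact b)"], of p q]
        by (simp add: b' mult_ac)
      note 3 = this[of "a + Suc i" "n - i"]
      have "v @ LX # replicate i LX = replicate (a + Suc i) LX" using v(1) by (simp add: replicate_add replicate_app_Cons_same)
      then have 4: "Li (v @ LX # replicate i LX) = (\<lambda>t. ln t ^ (a + Suc i) / fact (a + Suc i))"
        by (simp only: Li_replicate_LX[abs_def])
      have "\<forall>\<^sub>F t in at_right 0. ln t ^ (a + Suc i) / fact (a + Suc i) * ((- ln t) ^ (n - i) / fact (n - i) * (ln (1 - t) ^ b / fact b))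
        = shuffle_sum (\<lambda>w. Li (v @ LX # w) t) (replicate i LX) (replicate j LY)
         * shuffle_sum (\<lambda>w. Li_dual w t) (replicate (n - i) LX) (replicate (b - j) LY)"
        using Li_dual[of "n - i" b] by eventually_elim (simp add: True 4 del: fact_Suc)
      then show ?thesis by (rule Lim_transform_eventually[OF 3])
    qed
  qed
  show ?thesis
    unfolding cut_sum_def shuffle_sum_conv
    by (intro tendsto_null_sum) (use term0 in \<open>auto simp: min_def\<close>)
qed

text \<open>The words with \<open>n\<close> letters \<open>x\<close> and \<open>b\<close> letters \<open>y\<close> sum to a shuffle product, so that the path
  integral of their sum from \<open>t\<close> to \<open>1\<close> is elementary.\<close>

lemma reg_zeta_trail:
  fixes a b n :: nat
  assumes r: "r = [] \<or> last r = LY" and rb: "r \<noteq> [] \<or> b > 0"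
  defines "X \<equiv> (- 1) ^ (a + b) *
      shuffle_sum (\<lambda>h. reg_zeta ((replicate a LX @ rev r) @ LX # h)) (replicate n LX) (replicate b LY)"
  shows "(\<integral>\<^sup>+t\<in>{0<..<1}. ennreal (Li_abs a r t * ((- ln t) ^ n / fact n) * ((- ln (1 - t)) ^ b / fact b) / t) \<partial>lborel) = ennreal X" "X \<ge> 0"
proof -
  let ?v = "replicate a LX @ rev r"
  let ?F = "\<lambda>t. (- 1) ^ (a + b) * shuffle_sum (\<lambda>h. cut_sum ?v h t) (replicate n LX) (replicate b LY)"
  let ?f = "\<lambda>t. Li_abs a r t * ((- ln t) ^ n / fact n) * ((- ln (1 - t)) ^ b / fact b) / t"
  have Li: "Li ?v t = (- 1) ^ a * Li_abs a r t" for t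
    using Li_LX_LY[of "rev r" a t] r by (auto simp: hd_rev)
  have d: "(?F has_real_derivative ?f t) (at t)" if t: "0 < t" "t < 1" for t
  proof -
    have "(?F has_real_derivative (- 1) ^ (a + b) *
        shuffle_sum (\<lambda>h. Li ?v t * Li_dual h t * (1 / t)) (replicate n LX) (replicate b LY)) (at t)"
      by (intro DERIV_cmult shuffle_sum_deriv cut_sum_deriv t)
    also have "shuffle_sum (\<lambda>h. Li ?v t * Li_dual h t * (1 / t)) (replicate n LX) (replicate b LY) =
        Li ?v t * (1 / t) * shuffle_sum (\<lambda>h. Li_dual h t) (replicate n LX) (replicate b LY)"
      using shuffle_sum_cmult[of "Li ?v t * (1 / t)" "\<lambda>h. Li_dual h t"] by (simp add: mult_ac)
    also have "shuffle_sum (\<lambda>h. Li_dual h t) (replicate n LX) (replicate b LY) = (- ln t) ^ n / fact n * (ln (1 - t) ^ b / fact b)"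
      using shuffle_hom_Li_dual[OF t] t by (simp add: shuffle_hom_def Li_dual_replicate_LX Li_dual_replicate_LY)
    also have "(- 1) ^ (a + b) * (Li ?v t * (1 / t) * ((- ln t) ^ n / fact n * (ln (1 - t) ^ b / fact b))) =
      ((- 1) ^ a * (- 1) ^ a) * Li_abs a r t * ((- ln t) ^ n / fact n) * ((- 1) ^ b * ln (1 - t) ^ b / fact b) / t"
      by (simp add: Li power_add mult_ac)
    also have "(- 1) ^ a * (- 1) ^ a = (1::real)" by (simp flip: power_add)
    also have "(- 1) ^ b * ln (1 - t) ^ b = (- ln (1 - t)) ^ b" by (simp flip: power_mult_distrib)
    finally show ?thesis by simp
  qed
  have c: "isCont ?f t" if t: "0 < t" "t < 1" for t
    using t by (intro continuous_intros Li_abs_isCont) auto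
  have nn: "?f t \<ge> 0" if t: "0 < t" "t < 1" for t
    using t by (intro divide_nonneg_pos mult_nonneg_nonneg Li_abs_nonneg zero_le_power) auto
  have "LY \<in> set ?v \<or> (?v = replicate a LX \<and> b > 0)"
    using r rb by (cases "r = []") (auto simp: last_in_set dest: last_in_set)
  from tendsto_mult_right_zero[OF shuffle_sum_cut_sum_tendsto_0[OF this]]
  have A: "(?F \<longlongrightarrow> 0) (at_right 0)" .
  have B: "(?F \<longlongrightarrow> X) (at_left 1)"
  proof -
    have "((\<lambda>t. shuffle_sum (\<lambda>h. cut_sum ?v h t - reg_zeta (?v @ LX # h)) (replicate n LX) (replicate b LY)) \<longlongrightarrow> 0) (at_left 1)"
      by (rule shuffle_sum_tendsto) (use cut_sum_tendsto_1[of ?v] in \<open>simp add: LIM_zero_iff\<close>)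
    then have "((\<lambda>t. shuffle_sum (\<lambda>h. cut_sum ?v h t) (replicate n LX) (replicate b LY)) \<longlongrightarrow>
        shuffle_sum (\<lambda>h. reg_zeta (?v @ LX # h)) (replicate n LX) (replicate b LY)) (at_left 1)"
      unfolding shuffle_sum_diff by (simp add: LIM_zero_iff)
    then show ?thesis unfolding X_def by (intro tendsto_mult tendsto_const)
  qed
  from nn_FTC_unit_interval[OF d c nn A B]
  show "(\<integral>\<^sup>+t\<in>{0<..<1}. ennreal (?f t) \<partial>lborel) = ennreal X" "X \<ge> 0" by simp_all
qed

section \<open>Convergent power series in three variables\<close>

text \<open>The nesting of the coefficients is that of \<^term>\<open>taylor_TAB\<close>: first \<open>B\<close>, then \<open>A\<close>, then \<open>T\<close>. The radius
  \<open>1/8\<close> is only a convenient small number.\<close>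

definition represents :: "real fps fps fps \<Rightarrow> (real \<Rightarrow> real \<Rightarrow> real \<Rightarrow> real) \<Rightarrow> bool" where
  "represents c f \<longleftrightarrow> (\<forall>T A B. \<bar>T\<bar> < 1/8 \<longrightarrow> \<bar>A\<bar> < 1/8 \<longrightarrow> \<bar>B\<bar> < 1/8 \<longrightarrow>
     ((\<lambda>(k, j, i). fps_nth (fps_nth (fps_nth c k) j) i * T ^ i * A ^ j * B ^ k) has_sum f T A B) UNIV)"

lemma trepD:
  "represents c f \<Longrightarrow> \<bar>T\<bar> < 1/8 \<Longrightarrow> \<bar>A\<bar> < 1/8 \<Longrightarrow> \<bar>B\<bar> < 1/8 \<Longrightarrow>
     ((\<lambda>(k, j, i). fps_nth (fps_nth (fps_nth c k) j) i * T ^ i * A ^ j * B ^ k) has_sum f T A B) UNIV"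
  by (auto simp: represents_def)

text \<open>The factor \<open>B^k\<close> is constant on a fibre, so summability at one nonzero
  \<open>B\<close>, here 1/16, gives summability of each fibre.\<close>

lemma has_sum_outer_power:
  fixes c :: "nat \<Rightarrow> 'p \<Rightarrow> real"
  assumes h: "\<And>B. \<bar>B\<bar> < 1/8 \<Longrightarrow> ((\<lambda>(k, p). c k p * B ^ k) has_sum h B) UNIV"
  shows "(c k has_sum infsum (c k) UNIV) UNIV"
    and "\<bar>B\<bar> < 1/8 \<Longrightarrow> ((\<lambda>k. infsum (c k) UNIV * B ^ k) has_sum h B) UNIV"
proof -
  have c: "(c k has_sum infsum (c k) UNIV) UNIV" for k
  proof -
    have "(\<lambda>(k, p). c k p * (1/16) ^ k) summable_on Sigma UNIV (\<lambda>_. UNIV)"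
      using h[of "1/16"] by (auto simp: summable_on_def)
    then have "(\<lambda>p. c k p * (1/16) ^ k) summable_on UNIV"
      by (rule summable_on_SigmaD1) simp
    from summable_on_cmult_left[OF this, of "16 ^ k"]
    have "c k summable_on UNIV" by (simp add: mult.assoc flip: power_mult_distrib)
    then show ?thesis by simp
  qed
  then show "(c k has_sum infsum (c k) UNIV) UNIV" .
  assume "\<bar>B\<bar> < 1/8"
  then have "((\<lambda>(k, p). c k p * B ^ k) has_sum h B) (Sigma UNIV (\<lambda>_. UNIV))" using h by simp
  then show "((\<lambda>k. infsum (c k) UNIV * B ^ k) has_sum h B) UNIV"
    by (rule has_sum_SigmaD) (use c in \<open>auto intro!: has_sum_cmult_left\<close>)
qed

text \<open>Summation over triples is unfolded into nested power series in one variable each, so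
  that the identity theorem and iterated derivatives reduce to one variable.\<close>

lemma has_sum_three_powers:
  fixes c :: "nat \<Rightarrow> nat \<Rightarrow> nat \<Rightarrow> real"
  assumes h: "\<And>T A B. \<bar>T\<bar> < 1/8 \<Longrightarrow> \<bar>A\<bar> < 1/8 \<Longrightarrow> \<bar>B\<bar> < 1/8 \<Longrightarrow>
     ((\<lambda>(k, j, i). c k j i * T ^ i * A ^ j * B ^ k) has_sum f T A B) UNIV"
  obtains F G where
    "\<forall>T A B. \<bar>T\<bar> < 1/8 \<longrightarrow> \<bar>A\<bar> < 1/8 \<longrightarrow> \<bar>B\<bar> < 1/8 \<longrightarrow> (\<lambda>k. F k T A * B ^ k) sums f T A B"
    "\<forall>k T A. \<bar>T\<bar> < 1/8 \<longrightarrow> \<bar>A\<bar> < 1/8 \<longrightarrow> (\<lambda>j. G k j T * A ^ j) sums F k T A"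
    "\<forall>k j T. \<bar>T\<bar> < 1/8 \<longrightarrow> (\<lambda>i. c k j i * T ^ i) sums G k j T"
proof -
  define F where "F k T A = infsum (\<lambda>(j, i). c k j i * T ^ i * A ^ j) UNIV" for k T A
  define G where "G k j T = infsum (\<lambda>i. c k j i * T ^ i) UNIV" for k j T
  have h': "((\<lambda>(k, p). (\<lambda>(j, i). c k j i * T ^ i * A ^ j) p * B ^ k) has_sum f T A B) UNIV"
    if "\<bar>T\<bar> < 1/8" "\<bar>A\<bar> < 1/8" "\<bar>B\<bar> < 1/8" for T A B
    using h[OF that] by (simp add: case_prod_unfold)
  have 1: "((\<lambda>(j, i). c k j i * T ^ i * A ^ j) has_sum F k T A) UNIV"
    if "\<bar>T\<bar> < 1/8" "\<bar>A\<bar> < 1/8" for k T A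
    unfolding F_def using that
    by (intro has_sum_outer_power(1)[where c = "\<lambda>k (j, i). c k j i * T ^ i * A ^ j" and h = "f T A"] h')
  have 2: "((\<lambda>k. F k T A * B ^ k) has_sum f T A B) UNIV"
    if "\<bar>T\<bar> < 1/8" "\<bar>A\<bar> < 1/8" "\<bar>B\<bar> < 1/8" for T A B
    unfolding F_def using that
    by (intro has_sum_outer_power(2)[where c = "\<lambda>k (j, i). c k j i * T ^ i * A ^ j" and h = "f T A"] h')
  have 3: "((\<lambda>i. c k j i * T ^ i) has_sum G k j T) UNIV" if "\<bar>T\<bar> < 1/8" for k j T
    unfolding G_def using that
    by (intro has_sum_outer_power(1)[where c = "\<lambda>j i. c k j i * T ^ i" and h = "F k T"] 1)
  have 4: "((\<lambda>j. G k j T * A ^ j) has_sum F k T A) UNIV" if "\<bar>T\<bar> < 1/8" "\<bar>A\<bar> < 1/8" for k T A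
    unfolding G_def using that
    by (intro has_sum_outer_power(2)[where c = "\<lambda>j i. c k j i * T ^ i" and h = "F k T"] 1)
  show ?thesis
    by (rule that[of F G]) (use 2 3 4 in \<open>auto intro: has_sum_imp_sums\<close>)
qed

text \<open>Zeros of a nonzero power series are isolated, so vanishing on one side of 0 suffices;
  \<open>s\<close> selects the side.\<close>

lemma power_series_eq_0I:
  fixes a :: "nat \<Rightarrow> real"
  assumes g: "\<And>x. \<bar>x\<bar> < r \<Longrightarrow> (\<lambda>n. a n * x ^ n) sums g x" and r: "r > 0"
    and s: "\<bar>s\<bar> = 1" and z: "\<And>x. 0 < x \<Longrightarrow> x < r \<Longrightarrow> g (s * x) = 0"
  shows "a m = 0"
proof (rule ccontr)
  assume m: "a m \<noteq> 0"
  \<comment> \<open>The series is multiplied by \<open>x\<close>, because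
    \<open>powser_0_nonzero\<close> asks for the value 0 at the centre and a nonzero coefficient of
    positive index.\<close>
  let ?b = "\<lambda>n. case n of 0 \<Rightarrow> 0 | Suc n \<Rightarrow> a n"
  have sm: "(\<lambda>n. ?b n * (x - 0) ^ n) sums (x * g x)" if "norm (x - 0) < r" for x
  proof -
    have "(\<lambda>n. x * (a n * x ^ n)) sums (x * g x)" using g[of x] that by (intro sums_mult) simp
    then have "(\<lambda>n. ?b (Suc n) * (x - 0) ^ Suc n) sums (x * g x)" by (simp add: mult_ac)
    then show ?thesis by (subst (asm) sums_Suc_iff) simp
  qed
  obtain e where e: "0 < e" "\<And>x. x \<in> cball 0 e - {0} \<Longrightarrow> x * g x \<noteq> 0"
    by (rule powser_0_nonzero[OF r sm, of "Suc m"]) (use m in auto)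
  let ?x = "min e (r / 2)"
  have x: "0 < ?x" "?x < r" "?x \<le> e" using e r by auto
  have "s * ?x \<in> cball 0 e - {0}" using x s by (auto simp: abs_mult)
  then show False using e(2) z[OF x(1,2)] by auto
qed

lemma fps3_eqI:
  assumes "\<And>k j i. fps_nth (fps_nth (fps_nth c k) j) i = fps_nth (fps_nth (fps_nth d k) j) i"
  shows "c = (d :: 'a fps fps fps)"
  using assms by (intro fps_ext)

text \<open>Identities are compared on the cone \<open>T > 0 > A, B\<close>, where the generating series below have
  terms of constant sign.\<close>

lemma represents_unique:
  assumes c: "represents c f" and d: "represents d g"
    and eq: "\<And>T A B. 0 < T \<Longrightarrow> T < 1/8 \<Longrightarrow> - (1/8) < A \<Longrightarrow> A < 0 \<Longrightarrow> - (1/8) < B \<Longrightarrow> B < 0 \<Longrightarrow> f T A B = g T A B"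
  shows "c = d"
proof -
  let ?c = "\<lambda>k j i. fps_nth (fps_nth (fps_nth c k) j) i - fps_nth (fps_nth (fps_nth d k) j) i"
  have "((\<lambda>(k, j, i). ?c k j i * T ^ i * A ^ j * B ^ k) has_sum (f T A B - g T A B)) UNIV"
    if "\<bar>T\<bar> < 1/8" "\<bar>A\<bar> < 1/8" "\<bar>B\<bar> < 1/8" for T A B
    using has_sum_add[OF trepD[OF c that] has_sum_cmult_right[OF trepD[OF d that], of "- 1"]]
    by (simp add: case_prod_unfold algebra_simps)
  then obtain F G where
      F: "\<forall>T A B. \<bar>T\<bar> < 1/8 \<longrightarrow> \<bar>A\<bar> < 1/8 \<longrightarrow> \<bar>B\<bar> < 1/8 \<longrightarrow> (\<lambda>k. F k T A * B ^ k) sums (f T A B - g T A B)"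
    and G: "\<forall>k T A. \<bar>T\<bar> < 1/8 \<longrightarrow> \<bar>A\<bar> < 1/8 \<longrightarrow> (\<lambda>j. G k j T * A ^ j) sums F k T A"
    and H: "\<forall>k j T. \<bar>T\<bar> < 1/8 \<longrightarrow> (\<lambda>i. ?c k j i * T ^ i) sums G k j T"
    by (rule has_sum_three_powers[where f = "\<lambda>T A B. f T A B - g T A B" and c = ?c])
  have F0: "F k T (- A) = 0" if "0 < T" "T < 1/8" "0 < A" "A < 1/8" for k T A
    by (rule power_series_eq_0I[where s = "-1" and r = "1/8" and g = "\<lambda>B. f T (- A) B - g T (- A) B"])
       (use that F eq in auto)
  have G0: "G k j T = 0" if "0 < T" "T < 1/8" for k j T
    by (rule power_series_eq_0I[where s = "-1" and r = "1/8" and g = "F k T"]) (use that G F0 in auto)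
  have "?c k j i = 0" for k j i
    by (rule power_series_eq_0I[where s = 1 and r = "1/8" and g = "G k j"]) (use H G0 in auto)
  then show ?thesis by (intro fps3_eqI) simp
qed

lemma power_series_iterated_deriv:
  fixes a :: "nat \<Rightarrow> real"
  assumes "r > 0" "\<And>x. \<bar>x\<bar> < r \<Longrightarrow> (\<lambda>n. a n * x ^ n) sums g x"
  shows "(deriv ^^ n) g 0 = fact n * a n"
  using assms(2)
proof (induction n arbitrary: a g)
  case 0
  then show ?case using assms(1) sums_unique2[OF 0[of 0] powser_sums_zero] by simp
next
  case (Suc n)
  have "(\<lambda>n. diffs a n * x ^ n) sums deriv g x" if x: "\<bar>x\<bar> < r" for x
  proof (rule termdiffs_sums_strong[where f = g and K = r])
    have d: "((\<lambda>x. suminf (\<lambda>n. a n * x ^ n)) has_real_derivative suminf (\<lambda>n. diffs a n * x ^ n)) (at x)"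
      by (rule termdiffs_strong'[of r]) (use Suc.prems x in \<open>auto intro: sums_summable\<close>)
    have "(g has_real_derivative suminf (\<lambda>n. diffs a n * x ^ n)) (at x)"
    proof (rule has_field_derivative_transform_within_open[OF d])
      show "open {- r<..<r}" "x \<in> {- r<..<r}" using x by auto
    qed (use Suc.prems in \<open>auto simp: sums_iff\<close>)
    then show "(g has_real_derivative deriv g x) (at x)" by (metis DERIV_imp_deriv)
  qed (use Suc.prems x in auto)
  from Suc.IH[OF this] have "(deriv ^^ n) (deriv g) 0 = fact n * diffs a n" .
  then show ?case by (simp add: funpow_swap1 diffs_def)
qed

text \<open>The nesting in \<open>has_sum_three_powers\<close> is the order in which
  \<open>taylor_TAB\<close> differentiates. Each inner derivative is known for all small values of
  the outer variables, hence can be differentiated further.\<close>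

lemma represents_taylor:
  assumes c: "represents c f" shows "taylor_TAB f = c"
proof -
  let ?c = "\<lambda>k j i. fps_nth (fps_nth (fps_nth c k) j) i"
  obtain F G where
      F: "\<forall>T A B. \<bar>T\<bar> < 1/8 \<longrightarrow> \<bar>A\<bar> < 1/8 \<longrightarrow> \<bar>B\<bar> < 1/8 \<longrightarrow> (\<lambda>k. F k T A * B ^ k) sums (f T A B)"
    and G: "\<forall>k T A. \<bar>T\<bar> < 1/8 \<longrightarrow> \<bar>A\<bar> < 1/8 \<longrightarrow> (\<lambda>j. G k j T * A ^ j) sums F k T A"
    and H: "\<forall>k j T. \<bar>T\<bar> < 1/8 \<longrightarrow> (\<lambda>i. ?c k j i * T ^ i) sums G k j T"
    using trepD[OF c] by (rule has_sum_three_powers[where f = f and c = ?c])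
  have 1: "(deriv ^^ k) (f T A) 0 = fact k * F k T A" if "\<bar>T\<bar> < 1/8" "\<bar>A\<bar> < 1/8" for k T A
    by (rule power_series_iterated_deriv[of "1/8"]) (use F that in auto)
  have 2: "(deriv ^^ j) (\<lambda>A. (deriv ^^ k) (f T A) 0) 0 = fact j * (fact k * G k j T)" if "\<bar>T\<bar> < 1/8" for k j T
    by (rule power_series_iterated_deriv[of "1/8"])
       (use sums_mult[OF G[rule_format, of T]] that in \<open>auto simp: 1 mult_ac\<close>)
  have 3: "(deriv ^^ i) (\<lambda>T. (deriv ^^ j) (\<lambda>A. (deriv ^^ k) (f T A) 0) 0) 0
      = fact i * (fact j * fact k * ?c k j i)" for k j i
    by (rule power_series_iterated_deriv[of "1/8"])
       (use sums_mult[OF H[rule_format], of _ "fact j * fact k"] in \<open>auto simp: 2 mult_ac\<close>)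
  show ?thesis
    by (rule fps3_eqI) (simp add: taylor_TAB_def 3)
qed

lemma has_sum_mult_product:
  fixes f g :: "_ \<Rightarrow> real"
  assumes f: "(f has_sum a) S" and g: "(g has_sum b) S'"
  shows "((\<lambda>(x, y). f x * g y) has_sum (a * b)) (S \<times> S')"
proof (rule has_sum_SigmaI)
  show "((\<lambda>y. case (x, y) of (x, y) \<Rightarrow> f x * g y) has_sum f x * b) S'" if "x \<in> S" for x
    using g by (auto intro: has_sum_cmult_right)
  show "((\<lambda>x. f x * b) has_sum a * b) S" by (rule has_sum_cmult_left[OF f])
  have f': "(\<lambda>x. norm (f x)) summable_on S" and g': "(\<lambda>x. norm (g x)) summable_on S'"
    using f g summable_on_iff_abs_summable_on_real by (auto simp: summable_on_def)
  have "(\<lambda>p. norm (case p of (x, y) \<Rightarrow> f x * g y)) summable_on S \<times> S'"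
  proof (rule summable_on_SigmaI)
    show "((\<lambda>y. norm (case (x, y) of (x, y) \<Rightarrow> f x * g y)) has_sum norm (f x) * infsum (\<lambda>y. norm (g y)) S') S'"
      if "x \<in> S" for x using g' by (auto simp: abs_mult intro!: has_sum_cmult_right)
    show "(\<lambda>x. norm (f x) * infsum (\<lambda>y. norm (g y)) S') summable_on S"
      using f' by (rule summable_on_cmult_left)
  qed auto
  then show "(\<lambda>(x, y). f x * g y) summable_on S \<times> S'" by (rule abs_summable_summable)
qed

text \<open>Unconditional summability permits regrouping the product family by the total exponents
  \<open>(K, J, I)\<close>; each group is a finite Cauchy sum in three indices.\<close>

lemma represents_mult:
  assumes c: "represents c f" and d: "represents d g"
  shows "represents (c * d) (\<lambda>T A B. f T A B * g T A B)"
  unfolding represents_def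
proof (intro allI impI)
  fix T A B :: real assume small: "\<bar>T\<bar> < 1/8" "\<bar>A\<bar> < 1/8" "\<bar>B\<bar> < 1/8"
  let ?c = "\<lambda>k j i. fps_nth (fps_nth (fps_nth c k) j) i"
  let ?d = "\<lambda>k j i. fps_nth (fps_nth (fps_nth d k) j) i"
  let ?x = "\<lambda>(k, j, i). ?c k j i * T ^ i * A ^ j * B ^ k"
  let ?y = "\<lambda>(k, j, i). ?d k j i * T ^ i * A ^ j * B ^ k"
  let ?I = "\<lambda>(K::nat, J::nat, I::nat). {0..K} \<times> {0..J} \<times> {0..I}"
  let ?z = "\<lambda>((K, J, I), (k, j, i)). ?x (k, j, i) * ?y (K - k, J - j, I - i)"
  have "((\<lambda>(p, q). ?x p * ?y q) has_sum f T A B * g T A B) (UNIV \<times> UNIV)"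
    by (rule has_sum_mult_product[OF trepD[OF c small] trepD[OF d small]])
  also have "?this \<longleftrightarrow> (?z has_sum f T A B * g T A B) (Sigma UNIV ?I)"
    by (rule has_sum_reindex_bij_witness[where
          j = "\<lambda>((k, j, i), (k', j', i')). ((k + k', j + j', i + i'), (k, j, i))" and
          i = "\<lambda>((K, J, I), (k, j, i)). ((k, j, i), (K - k, J - j, I - i))"]) auto
  finally have s: "(?z has_sum f T A B * g T A B) (Sigma UNIV ?I)" .
  show "((\<lambda>(k, j, i). fps_nth (fps_nth (fps_nth (c * d) k) j) i * T ^ i * A ^ j * B ^ k)
      has_sum f T A B * g T A B) UNIV"
  proof (rule has_sum_SigmaD[OF s])
    fix p :: "nat \<times> nat \<times> nat"
    obtain K J I where p: "p = (K, J, I)" by (metis prod_cases3)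
    have "(case p of (k, j, i) \<Rightarrow> fps_nth (fps_nth (fps_nth (c * d) k) j) i * T ^ i * A ^ j * B ^ k) =
      (\<Sum>k=0..K. \<Sum>j=0..J. \<Sum>i=0..I. ?c k j i * ?d (K - k) (J - j) (I - i)) * T ^ I * A ^ J * B ^ K"
      by (simp add: p fps_mult_nth fps_sum_nth)
    also have "\<dots> = (\<Sum>k=0..K. \<Sum>j=0..J. \<Sum>i=0..I. ?x (k, j, i) * ?y (K - k, J - j, I - i))"
      unfolding sum_distrib_right
    proof (intro sum.cong refl)
      fix k j i assume "k \<in> {0..K}" "j \<in> {0..J}" "i \<in> {0..I}"
      then have e: "T ^ I = T ^ i * T ^ (I - i)" "A ^ J = A ^ j * A ^ (J - j)" "B ^ K = B ^ k * B ^ (K - k)"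
        by (simp_all flip: power_add)
      show "?c k j i * ?d (K - k) (J - j) (I - i) * T ^ I * A ^ J * B ^ K = ?x (k, j, i) * ?y (K - k, J - j, I - i)"
        unfolding e by (simp add: mult_ac)
    qed
    also have "\<dots> = (\<Sum>q\<in>?I p. ?z (p, q))"
      by (simp add: p sum.cartesian_product case_prod_unfold)
    finally show "((\<lambda>q. ?z (p, q)) has_sum
       (case p of (k, j, i) \<Rightarrow> fps_nth (fps_nth (fps_nth (c * d) k) j) i * T ^ i * A ^ j * B ^ k)) (?I p)"
      by (intro has_sum_finiteI) (auto simp: p)
  qed
qed

definition swapAB :: "real fps fps fps \<Rightarrow> real fps fps fps" where
  "swapAB c = Abs_fps (\<lambda>k. Abs_fps (\<lambda>j. fps_nth (fps_nth c j) k))"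

lemma represents_swap:
  assumes "represents c f" shows "represents (swapAB c) (\<lambda>T A B. f T B A)"
  unfolding represents_def
proof (intro allI impI)
  fix T A B :: real assume small: "\<bar>T\<bar> < 1/8" "\<bar>A\<bar> < 1/8" "\<bar>B\<bar> < 1/8"
  have "((\<lambda>(k, j, i). fps_nth (fps_nth (fps_nth c k) j) i * T ^ i * B ^ j * A ^ k) has_sum f T B A) UNIV"
    using assms small by (intro trepD) auto
  also have "?this \<longleftrightarrow> ((\<lambda>(k, j, i). fps_nth (fps_nth (fps_nth (swapAB c) k) j) i * T ^ i * A ^ j * B ^ k)
      has_sum f T B A) UNIV"
    by (rule has_sum_reindex_bij_witness[where j = "\<lambda>(k, j, i). (j, k, i)" and i = "\<lambda>(k, j, i). (j, k, i)"])
       (auto simp: swapAB_def)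
  finally show "((\<lambda>(k, j, i). fps_nth (fps_nth (fps_nth (swapAB c) k) j) i * T ^ i * A ^ j * B ^ k)
      has_sum f T B A) UNIV" .
qed

text \<open>The coefficients of \<open>\<Sum> d l k (A - T)\<^sup>l B\<^sup>k\<close>.\<close>

definition subst_AmT :: "(nat \<Rightarrow> nat \<Rightarrow> real) \<Rightarrow> real fps fps fps" where
  "subst_AmT d = Abs_fps (\<lambda>k. Abs_fps (\<lambda>j. Abs_fps (\<lambda>i.
     (- 1) ^ i * real ((i + j) choose i) * d (i + j) k)))"

text \<open>The radius 1/4 covers \<open>|A| + |T|\<close>. Evaluating the given series there
  provides the majorant for the binomial expansion of \<open>(A - T)^l\<close>.\<close>

lemma represents_subst_AmT:
  assumes d: "\<And>z B. \<bar>z\<bar> < 1/4 \<Longrightarrow> \<bar>B\<bar> < 1/8 \<Longrightarrow> ((\<lambda>(l, k). d l k * z ^ l * B ^ k) has_sum g z B) UNIV"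
  shows "represents (subst_AmT d) (\<lambda>T A B. g (A - T) B)"
  unfolding represents_def
proof (intro allI impI)
  fix T A B :: real assume small: "\<bar>T\<bar> < 1/8" "\<bar>A\<bar> < 1/8" "\<bar>B\<bar> < 1/8"
  let ?x = "\<lambda>((l, k), i). d l k * (real (l choose i) * (- T) ^ i * A ^ (l - i)) * B ^ k"
  have bin: "(\<Sum>i\<le>l. d l k * (real (l choose i) * x ^ i * y ^ (l - i)) * z) = d l k * (x + y) ^ l * z"
    for l k x y z
    by (simp add: binomial_ring sum_distrib_left sum_distrib_right)
  have "(?x has_sum g (A - T) B) (Sigma UNIV (\<lambda>(l, k). {..l}))"
  proof (rule has_sum_SigmaI)
    show "((\<lambda>(l, k). d l k * (A - T) ^ l * B ^ k) has_sum g (A - T) B) UNIV"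
    proof (rule d)
      show "\<bar>A - T\<bar> < 1/4" using small abs_triangle_ineq4[of A T] by linarith
    qed (use small in auto)
    show "((\<lambda>i. ?x (p, i)) has_sum (case p of (l, k) \<Rightarrow> d l k * (A - T) ^ l * B ^ k)) (case p of (l, k) \<Rightarrow> {..l})" for p
      using bin[of "fst p" "snd p" "- T" A "B ^ snd p"] by (intro has_sum_finiteI) (auto simp: case_prod_unfold)
    have "(\<lambda>p. norm (?x p)) summable_on (Sigma UNIV (\<lambda>(l, k). {..l}))"
    proof (rule summable_on_SigmaI)
      let ?g = "\<lambda>(l, k). \<bar>d l k\<bar> * (\<bar>T\<bar> + \<bar>A\<bar>) ^ l * \<bar>B\<bar> ^ k"
      have n: "norm (?x ((l, k), i)) = \<bar>d l k\<bar> * (real (l choose i) * \<bar>T\<bar> ^ i * \<bar>A\<bar> ^ (l - i)) * \<bar>B\<bar> ^ k" for l k i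
        by (simp add: abs_mult power_abs)
      have bin': "(\<Sum>i\<le>l. norm (?x ((l, k), i))) = ?g (l, k)" for l k
        unfolding n by (simp add: binomial_ring sum_distrib_left sum_distrib_right)
      show "((\<lambda>i. norm (?x (p, i))) has_sum ?g p) (case p of (l, k) \<Rightarrow> {..l})" for p
        using bin'[of "fst p" "snd p"] by (intro has_sum_finiteI) (auto simp: case_prod_unfold)
      have "(\<lambda>(l, k). d l k * (\<bar>T\<bar> + \<bar>A\<bar>) ^ l * \<bar>B\<bar> ^ k) summable_on UNIV"
        using d[of "\<bar>T\<bar> + \<bar>A\<bar>" "\<bar>B\<bar>"] small by (auto simp: summable_on_def)
      from iffD1[OF summable_on_iff_abs_summable_on_real this]
      show "?g summable_on UNIV" by (simp add: case_prod_unfold abs_mult power_abs)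
    qed auto
    then show "?x summable_on (Sigma UNIV (\<lambda>(l, k). {..l}))" by (rule abs_summable_summable)
  qed
  also have "?this \<longleftrightarrow> ((\<lambda>(k, j, i). fps_nth (fps_nth (fps_nth (subst_AmT d) k) j) i * T ^ i * A ^ j * B ^ k)
      has_sum g (A - T) B) UNIV"
    by (rule has_sum_reindex_bij_witness[where j = "\<lambda>((l, k), i). (k, l - i, i)" and
         i = "\<lambda>(k, j, i). ((i + j, k), i)"]) (auto simp: subst_AmT_def power_minus[of T] mult_ac)
  finally show "((\<lambda>(k, j, i). fps_nth (fps_nth (fps_nth (subst_AmT d) k) j) i * T ^ i * A ^ j * B ^ k)
      has_sum g (A - T) B) UNIV" .
qed

section \<open>Power series of the Gamma quotient\<close>

lemma real_power_series:
  fixes f :: "complex \<Rightarrow> complex"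
  assumes hol: "f holomorphic_on ball 1 1" and re: "\<And>x. f (of_real x) = of_real (g x)"
  obtains a where "\<forall>z. \<bar>z\<bar> < 1 \<longrightarrow> ((\<lambda>n. a n * z ^ n) has_sum g (1 + z)) UNIV"
proof -
  define a where "a n = Re ((deriv ^^ n) f 1 / fact n)" for n
  have s: "(\<lambda>n. a n * z ^ n) sums g (1 + z)" if "\<bar>z\<bar> < 1" for z
  proof -
    have "(\<lambda>n. (deriv ^^ n) f 1 / fact n * (of_real (1 + z) - 1) ^ n) sums f (of_real (1 + z))"
      by (rule holomorphic_power_series[OF hol]) (use that in \<open>simp add: dist_norm\<close>)
    then have "(\<lambda>n. Re ((deriv ^^ n) f 1 / fact n * of_real z ^ n)) sums Re (f (of_real (1 + z)))"
      by (intro sums_Re) simp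
    moreover have "Re (c * of_real z ^ n) = Re c * z ^ n" for c n
      by (simp flip: of_real_power)
    then have "(\<lambda>n. Re ((deriv ^^ n) f 1 / fact n * of_real z ^ n)) = (\<lambda>n. a n * z ^ n)"
      by (simp only: a_def)
    ultimately show ?thesis unfolding re by simp
  qed
  have "((\<lambda>n. a n * z ^ n) has_sum g (1 + z)) UNIV" if z: "\<bar>z\<bar> < 1" for z
  proof (rule norm_summable_imp_has_sum[OF _ s[OF z]])
    obtain w where w: "\<bar>z\<bar> < w" "w < 1" using z dense by blast
    then have "\<bar>w\<bar> < 1" "\<bar>z\<bar> < \<bar>w\<bar>" by auto
    then show "summable (\<lambda>n. norm (a n * z ^ n))"
      using powser_insidea[of a w z] s[of w] by (auto simp: sums_iff)
  qed
  then show ?thesis using that by blast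
qed

lemma represents_AmT:
  fixes a :: "nat \<Rightarrow> real"
  assumes "\<And>z. \<bar>z\<bar> < 1 \<Longrightarrow> ((\<lambda>n. a n * z ^ n) has_sum g z) UNIV"
  obtains c where "represents c (\<lambda>T A B. g (A - T))"
proof -
  have "represents (subst_AmT (\<lambda>l k. if k = 0 then a l else 0)) (\<lambda>T A B. (\<lambda>z B. g z) (A - T) B)"
  proof (rule represents_subst_AmT)
    fix z B :: real assume "\<bar>z\<bar> < 1/4" "\<bar>B\<bar> < 1/8"
    then have "((\<lambda>n. a n * z ^ n) has_sum g z) UNIV" by (intro assms) auto
    also have "?this \<longleftrightarrow> ((\<lambda>(l, k). (if k = 0 then a l else 0) * z ^ l * B ^ k) has_sum g z) (UNIV \<times> {0})"
      by (rule has_sum_reindex_bij_witness[where j = "\<lambda>n. (n, 0)" and i = fst]) auto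
    also have "\<dots> \<longleftrightarrow> ((\<lambda>(l, k). (if k = 0 then a l else 0) * z ^ l * B ^ k) has_sum g z) UNIV"
      by (rule has_sum_cong_neutral) (auto split: if_splits)
    finally show "((\<lambda>(l, k). (if k = 0 then a l else 0) * z ^ l * B ^ k) has_sum g z) UNIV" .
  qed
  then show ?thesis using that by simp
qed

lemma represents_B:
  fixes a :: "nat \<Rightarrow> real"
  assumes "\<And>z. \<bar>z\<bar> < 1 \<Longrightarrow> ((\<lambda>n. a n * z ^ n) has_sum g z) UNIV"
  obtains c where "represents c (\<lambda>T A B. g B)"
proof -
  have "represents (subst_AmT (\<lambda>l k. if l = 0 then a k else 0)) (\<lambda>T A B. (\<lambda>z B. g B) (A - T) B)"
  proof (rule represents_subst_AmT)
    fix z B :: real assume "\<bar>z\<bar> < 1/4" "\<bar>B\<bar> < 1/8"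
    then have "((\<lambda>n. a n * B ^ n) has_sum g B) UNIV" by (intro assms) auto
    also have "?this \<longleftrightarrow> ((\<lambda>(l, k). (if l = 0 then a k else 0) * z ^ l * B ^ k) has_sum g B) ({0} \<times> UNIV)"
      by (rule has_sum_reindex_bij_witness[where j = "\<lambda>n. (0, n)" and i = snd]) auto
    also have "\<dots> \<longleftrightarrow> ((\<lambda>(l, k). (if l = 0 then a k else 0) * z ^ l * B ^ k) has_sum g B) UNIV"
      by (rule has_sum_cong_neutral) (auto split: if_splits)
    finally show "((\<lambda>(l, k). (if l = 0 then a k else 0) * z ^ l * B ^ k) has_sum g B) UNIV" .
  qed
  then show ?thesis using that by simp
qed

text \<open>\<open>Gamma\<close> and \<open>rGamma\<close> are holomorphic on the unit disc around
  1. Each of the four factors depends on \<open>B\<close> or on \<open>A - T\<close>, or arises from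
  such a function by exchanging \<open>A\<close> and \<open>B\<close>. Some series thus represents
  the product, and by \<open>represents_taylor\<close> it is the Taylor series.\<close>

lemma represents_gamma_quotient: "represents (taylor_TAB gamma_quotient) gamma_quotient"
proof -
  have ball: "z \<notin> \<int>\<^sub>\<le>\<^sub>0" if "z \<in> ball 1 1" for z :: complex
  proof
    assume "z \<in> \<int>\<^sub>\<le>\<^sub>0"
    then obtain n where "z = - of_nat n" by (auto elim!: nonpos_Ints_cases')
    then have "dist 1 z = norm (of_nat (Suc n) :: complex)" by (simp add: dist_norm)
    also have "\<dots> \<ge> 1" unfolding norm_of_nat by simp
    finally show False using that by simp
  qed
  have "Gamma holomorphic_on ball 1 1" using ball by (auto intro!: holomorphic_intros)
  then obtain a where a: "\<forall>z::real. \<bar>z\<bar> < 1 \<longrightarrow> ((\<lambda>n. a n * z ^ n) has_sum Gamma (1 + z)) UNIV"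
    using Gamma_complex_of_real by (rule real_power_series)
  have "rGamma holomorphic_on ball 1 1" by (intro holomorphic_intros)
  then obtain b where b: "\<forall>z::real. \<bar>z\<bar> < 1 \<longrightarrow> ((\<lambda>n. b n * z ^ n) has_sum rGamma (1 + z)) UNIV"
    using rGamma_complex_of_real by (rule real_power_series)
  obtain c1 where c1: "represents c1 (\<lambda>T A B. Gamma (1 + B))" by (rule represents_B[OF a[rule_format]])
  obtain c2 where c2: "represents c2 (\<lambda>T A B. Gamma (1 + (A - T)))" by (rule represents_AmT[OF a[rule_format]])
  obtain c3 where c3: "represents c3 (\<lambda>T A B. rGamma (1 + B))" by (rule represents_B[OF b[rule_format]])
  obtain c4 where c4: "represents c4 (\<lambda>T A B. rGamma (1 + (A - T)))" by (rule represents_AmT[OF b[rule_format]])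
  have "represents (swapAB c1 * swapAB c2 * (c3 * c4))
    (\<lambda>T A B. (Gamma (1 + A) * Gamma (1 + (B - T))) * (rGamma (1 + B) * rGamma (1 + (A - T))))"
    by (intro represents_mult represents_swap[OF c1] represents_swap[OF c2] c3 c4)
  also have "(\<lambda>T A B. (Gamma (1 + A) * Gamma (1 + (B - T))) * (rGamma (1 + B) * rGamma (1 + (A - T)))) = gamma_quotient"
    by (intro ext) (simp add: gamma_quotient_def rGamma_inverse_Gamma divide_inverse algebra_simps)
  finally show ?thesis using represents_taylor by metis
qed

section \<open>Generating functions\<close>

lemma suminf_swap_ennreal: "suminf (\<lambda>i. suminf (\<lambda>j. f i j :: ennreal)) = suminf (\<lambda>j. suminf (\<lambda>i. f i j))"
proof -
  have "suminf (\<lambda>i. suminf (\<lambda>j. f i j)) = (\<integral>\<^sup>+ i. suminf (\<lambda>j. f i j) \<partial>count_space UNIV)"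
    by (simp add: nn_integral_count_space_nat)
  also have "\<dots> = suminf (\<lambda>j. \<integral>\<^sup>+ i. f i j \<partial>count_space UNIV)"
    by (rule nn_integral_suminf) simp
  finally show ?thesis by (simp add: nn_integral_count_space_nat)
qed

lemma suminf_sum_ennreal: "suminf (\<lambda>i. \<Sum>k\<in>A. f i k :: ennreal) = (\<Sum>k\<in>A. suminf (\<lambda>i. f i k))"
  by (rule suminf_sum) simp

lemma suminf_multl_ennreal: "suminf (\<lambda>i. f i * c :: ennreal) = suminf f * c"
  by (subst mult.commute) (simp add: mult.commute[of _ c])

lemma suminf_single_ennreal:
  "(\<And>n. n \<noteq> k \<Longrightarrow> f n = 0) \<Longrightarrow> suminf f = (f k :: ennreal)"
  by (subst suminf_finite[of "{k}"]) auto

lemma suminf_Cauchy_ennreal: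
  "suminf (\<lambda>n. \<Sum>i\<le>n. f i * g (n - i) :: ennreal) = suminf f * suminf g"
proof -
  have "suminf (\<lambda>n. \<Sum>i\<le>n. f i * g (n - i)) = suminf (\<lambda>n. suminf (\<lambda>i. if i \<le> n then f i * g (n - i) else 0))"
    by (intro arg_cong[where f = suminf] ext, subst suminf_finite[of "{..n}" for n]) auto
  also have "\<dots> = suminf (\<lambda>i. suminf (\<lambda>n. if i \<le> n then f i * g (n - i) else 0))"
    by (rule suminf_swap_ennreal)
  also have "\<dots> = suminf (\<lambda>i. f i * suminf g)"
  proof (intro arg_cong[where f = suminf] ext)
    fix i
    have "suminf (\<lambda>n. if i \<le> n then f i * g (n - i) else 0) =
      suminf (\<lambda>n. if i \<le> n + i then f i * g (n + i - i) else 0) + (\<Sum>n<i. if i \<le> n then f i * g (n - i) else 0)"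
      by (rule suminf_offset) simp
    then show "suminf (\<lambda>n. if i \<le> n then f i * g (n - i) else 0) = f i * suminf g" by simp
  qed
  also have "\<dots> = suminf f * suminf g" by (rule suminf_multl_ennreal)
  finally show ?thesis .
qed

lemma suminf_exp_ennreal: "x \<ge> 0 \<Longrightarrow> suminf (\<lambda>n. ennreal (x ^ n / fact n)) = ennreal (exp x)"
  using exp_converges[of x] by (intro suminf_ennreal_eq) (auto simp: divide_inverse mult_ac)

lemma suminf_geometric_ennreal:
  "0 \<le> x \<Longrightarrow> x < 1 \<Longrightarrow> suminf (\<lambda>n. ennreal x ^ n) = ennreal (1 / (1 - x))"
proof -
  assume x: "0 \<le> x" "x < 1"
  have "suminf (\<lambda>n. ennreal (x ^ n)) = ennreal (1 / (1 - x))"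
    using x by (intro suminf_ennreal_eq geometric_sums) auto
  moreover have "(\<lambda>n. ennreal x ^ n) = (\<lambda>n. ennreal (x ^ n))" using x by (simp add: ennreal_power)
  ultimately show ?thesis by (simp only:)
qed

section \<open>The words produced by sigma and their generating functions\<close>

text \<open>Reversed words, with multiplicity, of the coefficient of \<open>T\<^sup>i\<close> in \<open>\<sigma>\<close> of the word \<open>rev r\<close>.\<close>

fun sigma_words :: "letter list \<Rightarrow> nat \<Rightarrow> letter list list" where
  "sigma_words [] i = (if i = 0 then [[]] else [])"
| "sigma_words (LX # r) i = map ((#) LX) (sigma_words r i)"
| "sigma_words (LY # r) i = concat (map (\<lambda>j. map (\<lambda>u. replicate (i - j) LX @ LY # u) (sigma_words r j)) [0..<Suc i])"

definition sigma_sum :: "(letter list \<Rightarrow> 'a::comm_monoid_add) \<Rightarrow> letter list \<Rightarrow> nat \<Rightarrow> 'a" where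
  "sigma_sum f r i = sum_list (map f (sigma_words r i))"

lemma sigma_sum_Nil [simp]: "sigma_sum f [] i = (if i = 0 then f [] else 0)"
  by (simp add: sigma_sum_def)

lemma sigma_sum_LX [simp]: "sigma_sum f (LX # r) i = sigma_sum (\<lambda>u. f (LX # u)) r i"
  by (simp add: sigma_sum_def o_def)

lemma sum_list_map_concat: "sum_list (map f (concat xss)) = sum_list (map (\<lambda>xs. sum_list (map f xs)) xss)"
  by (induction xss) auto

lemma sigma_sum_LY [simp]: "sigma_sum f (LY # r) i = (\<Sum>j\<le>i. sigma_sum (\<lambda>u. f (replicate (i - j) LX @ LY # u)) r j)"
proof -
  have "sigma_sum f (LY # r) i = sum_list (map (\<lambda>j. sigma_sum (\<lambda>u. f (replicate (i - j) LX @ LY # u)) r j) [0..<Suc i])"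
    by (simp add: sigma_sum_def sum_list_map_concat o_def del: upt_Suc)
  also have "\<dots> = (\<Sum>j\<in>set [0..<Suc i]. sigma_sum (\<lambda>u. f (replicate (i - j) LX @ LY # u)) r j)"
    by (rule interv_sum_list_conv_sum_set_nat)
  also have "set [0..<Suc i] = {..i}" by auto
  finally show ?thesis .
qed

lemma sigma_sum_conv_sum: "sigma_sum f r i = (\<Sum>k<length (sigma_words r i). f (sigma_words r i ! k))"
  by (simp add: sigma_sum_def sum_list_sum_nth atLeast0LessThan)

lemma sigma_sum_cong: "(\<And>u. u \<in> set (sigma_words r i) \<Longrightarrow> f u = g u) \<Longrightarrow> sigma_sum f r i = sigma_sum g r i"
  unfolding sigma_sum_def by (metis map_cong)

lemma sigma_sum_cmult: "sigma_sum (\<lambda>u. c * f u) r i = c * (sigma_sum f r i :: 'a::semiring_0)"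
  by (simp add: sigma_sum_conv_sum sum_distrib_left)

lemma sigma_sum_multr: "sigma_sum (\<lambda>u. f u * c) r i = (sigma_sum f r i :: 'a::semiring_0) * c"
  by (simp add: sigma_sum_conv_sum sum_distrib_right)

lemma sigma_sum_sum: "sigma_sum (\<lambda>u. \<Sum>k\<in>A. f k u) r i = (\<Sum>k\<in>A. sigma_sum (f k) r i)"
  unfolding sigma_sum_conv_sum by (rule sum.swap)

lemma sigma_sum_suminf: "sigma_sum (\<lambda>u. suminf (\<lambda>k. f k u)) r i = suminf (\<lambda>k. sigma_sum (f k) r i :: ennreal)"
  by (simp add: sigma_sum_conv_sum suminf_sum_ennreal)

lemma sigma_sum_nonneg: "(\<And>u. u \<in> set (sigma_words r i) \<Longrightarrow> f u \<ge> (0::real)) \<Longrightarrow> sigma_sum f r i \<ge> 0"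
  unfolding sigma_sum_conv_sum by (intro sum_nonneg) auto

text \<open>Extra letters \<open>x\<close> are inserted only behind a \<open>y\<close>, so an
  initial \<open>y\<close> stays initial; in the reversed words it is the last letter.\<close>

lemma last_sigma_words: "u \<in> set (sigma_words r i) \<Longrightarrow> (r = [] \<longleftrightarrow> u = []) \<and> (last r = LY \<longrightarrow> last u = LY)"
proof (induction r i arbitrary: u rule: sigma_words.induct)
  case (1 i)
  then show ?case by (auto split: if_splits)
next
  case (2 r i)
  then show ?case by fastforce
next
  case (3 r i)
  then have "\<exists>j\<le>i. \<exists>u'\<in>set (sigma_words r j). u = replicate (i - j) LX @ LY # u'"
    by (auto simp: less_Suc_eq_le simp del: upt_Suc)
  then obtain j u' where "j \<in> set [0..<Suc i]" "u' \<in> set (sigma_words r j)" "u = replicate (i - j) LX @ LY # u'"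
    by (auto simp: less_Suc_eq_le simp del: upt_Suc)
  then show ?case using 3(1)[of j u'] by auto
qed

text \<open>\<open>al\<close> stands for \<open>-A\<close>, so this is the factor
  \<open>1 / (m + A)\<close> of a letter \<open>x\<close>; the value 0 at \<open>m = 0\<close>
  matches \<open>dv_at_0\<close>.\<close>

definition cx :: "real \<Rightarrow> nat \<Rightarrow> ennreal" where
  "cx al m = (if m = 0 then 0 else ennreal (1 / (real m - al)))"

definition cy :: "real \<Rightarrow> real \<Rightarrow> nat \<Rightarrow> ennreal" where
  "cy al T m = (if m = 0 then 0 else ennreal (1 / (real m - al - T)))"

text \<open>For \<open>rev r = y x\<^sup>k\<^sup>1\<^sup>-\<^sup>1 \<cdots> y x\<^sup>k\<^sup>d\<^sup>-\<^sup>1\<close> this is the sum over \<open>0 < m\<^sub>1 < \<cdots> < m\<^sub>d = m\<close> of the products of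
  \<open>1 / ((m\<^sub>i - \<alpha>)\<^sup>k\<^sup>i\<^sup>-\<^sup>1 (m\<^sub>i - \<alpha> - T))\<close>: \<open>\<sigma>\<close> turns the factor of a letter \<open>y\<close> into a geometric series in \<open>T\<close>, and
  leading letters \<open>x\<close> shift \<open>m\<^sub>i\<close> by \<open>A = -\<alpha>\<close>.\<close>

fun nested_sum :: "real \<Rightarrow> real \<Rightarrow> letter list \<Rightarrow> nat \<Rightarrow> ennreal" where
  "nested_sum al T [] m = (if m = 0 then 1 else 0)"
| "nested_sum al T (LX # r) m = cx al m * nested_sum al T r m"
| "nested_sum al T (LY # r) m = cy al T m * (\<Sum>k<m. nested_sum al T r k)"

lemma nested_sum_at_0: "r \<noteq> [] \<Longrightarrow> nested_sum al T r 0 = 0"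
  by (induction al T r "0::nat" rule: nested_sum.induct) (auto simp: cx_def cy_def)

definition pcoef_gf :: "real \<Rightarrow> letter list \<Rightarrow> nat \<Rightarrow> ennreal" where
  "pcoef_gf al u m = suminf (\<lambda>j. ennreal (al ^ j * pcoef u m j))"

context
  fixes al T :: real
  assumes al: "0 < al" "al < 1/8" and T: "0 < T" "T < 1/8"
begin

text \<open>\<open>dv\<close> is a Cauchy product with the geometric series of
  \<open>1 / (m - al)\<close>, which converges for \<open>m > 0\<close> as
  \<open>al < 1\<close>.\<close>

lemma suminf_dv:
  assumes q: "\<And>j. q j \<ge> 0"
  shows "suminf (\<lambda>j. ennreal (al ^ j * dv m q j)) = cx al m * suminf (\<lambda>j. ennreal (al ^ j * q j))"
proof (cases "m = 0")
  case True
  then show ?thesis by (simp add: cx_def)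
next
  case False
  have geo: "suminf (\<lambda>k. ennreal (al ^ k / real m ^ Suc k)) = cx al m"
  proof -
    have "(\<lambda>k. (al / real m) ^ k / real m) sums (1 / (1 - al / real m) / real m)"
      using al False by (intro sums_divide geometric_sums) (auto simp: field_simps)
    also have "1 / (1 - al / real m) / real m = 1 / (real m - al)"
      using al False by (simp add: field_simps)
    also have "(\<lambda>k. (al / real m) ^ k / real m) = (\<lambda>k. al ^ k / real m ^ Suc k)"
      by (simp add: power_divide mult.commute)
    finally show ?thesis using False al by (simp only: cx_def if_False) (intro suminf_ennreal_eq, auto)
  qed
  have "ennreal (al ^ j * dv m q j) = (\<Sum>i\<le>j. ennreal (al ^ i * q i) * ennreal (al ^ (j - i) / real m ^ Suc (j - i)))" for j
  proof -
    have "al ^ j * dv m q j = (\<Sum>i\<le>j. (al ^ i * q i) * (al ^ (j - i) / real m ^ Suc (j - i)))"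
      unfolding dv_def sum_distrib_left
    proof (intro sum.cong refl)
      fix i assume "i \<in> {..j}"
      then have "al ^ j = al ^ i * al ^ (j - i)" by (simp flip: power_add)
      then show "al ^ j * (q i / real m ^ Suc (j - i)) = (al ^ i * q i) * (al ^ (j - i) / real m ^ Suc (j - i))"
        by (simp only: times_divide_eq_right mult_ac)
    qed
    also have "ennreal \<dots> = (\<Sum>i\<le>j. ennreal ((al ^ i * q i) * (al ^ (j - i) / real m ^ Suc (j - i))))"
      using q al by (subst sum_ennreal) auto
    also have "\<dots> = (\<Sum>i\<le>j. ennreal (al ^ i * q i) * ennreal (al ^ (j - i) / real m ^ Suc (j - i)))"
      using q al by (intro sum.cong ennreal_mult refl) auto
    finally show ?thesis .
  qed
  then have "suminf (\<lambda>j. ennreal (al ^ j * dv m q j)) =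
      suminf (\<lambda>j. ennreal (al ^ j * q j)) * suminf (\<lambda>k. ennreal (al ^ k / real m ^ Suc k))"
    using suminf_Cauchy_ennreal[of "\<lambda>i. ennreal (al ^ i * q i)" "\<lambda>k. ennreal (al ^ k / real m ^ Suc k)"]
    by (simp only:)
  then show ?thesis by (simp only: geo mult.commute)
qed

lemma pcoef_gf_Nil: "pcoef_gf al [] m = (if m = 0 then 1 else 0)"
  unfolding pcoef_gf_def by (subst suminf_single_ennreal[of 0]) auto

lemma pcoef_gf_LX: "pcoef_gf al (LX # u) m = cx al m * pcoef_gf al u m"
  unfolding pcoef_gf_def pcoef.simps by (rule suminf_dv) (rule pcoef_nonneg)

lemma pcoef_gf_LY: "pcoef_gf al (LY # u) m = cx al m * (\<Sum>k<m. pcoef_gf al u k)"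
proof -
  have "pcoef_gf al (LY # u) m = cx al m * suminf (\<lambda>j. ennreal (al ^ j * (\<Sum>k<m. pcoef u k j)))"
    unfolding pcoef_gf_def pcoef.simps by (rule suminf_dv) (auto intro: sum_nonneg pcoef_nonneg)
  also have "suminf (\<lambda>j. ennreal (al ^ j * (\<Sum>k<m. pcoef u k j))) = (\<Sum>k<m. pcoef_gf al u k)"
    unfolding pcoef_gf_def suminf_sum_ennreal[symmetric] sum_distrib_left
    using al by (subst sum_ennreal) (auto intro: pcoef_nonneg mult_nonneg_nonneg)
  finally show ?thesis .
qed

lemma pcoef_gf_replicate: "pcoef_gf al (replicate k LX @ u) m = cx al m ^ k * pcoef_gf al u m"
  by (induction k) (simp_all add: pcoef_gf_LX mult.assoc)

text \<open>Each extra \<open>x\<close> produced from a \<open>y\<close> contributes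
  \<open>T / (m - al)\<close>; with the factor \<open>1 / (m - al)\<close> of the \<open>y\<close>
  itself the geometric series adds up to \<open>1 / (m - al - T)\<close>, which is the fact
  \<open>geo\<close>.\<close>

lemma suminf_sigma_sum_pcoef_gf: "suminf (\<lambda>i. ennreal T ^ i * sigma_sum (\<lambda>u. pcoef_gf al u m) r i) = nested_sum al T r m"
proof (induction r arbitrary: m)
  case Nil
  then show ?case by (subst suminf_single_ennreal[of 0]) (auto simp: pcoef_gf_Nil)
next
  case (Cons c r)
  show ?case
  proof (cases c)
    case LX
    have "suminf (\<lambda>i. ennreal T ^ i * sigma_sum (\<lambda>u. pcoef_gf al u m) (c # r) i) =
      suminf (\<lambda>i. cx al m * (ennreal T ^ i * sigma_sum (\<lambda>u. pcoef_gf al u m) r i))"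
      using LX by (simp add: pcoef_gf_LX sigma_sum_cmult mult_ac)
    then show ?thesis using LX Cons by simp
  next
    case LY
    have geo: "suminf (\<lambda>k. (ennreal T * cx al m) ^ k) * cx al m = cy al T m"
    proof (cases "m = 0")
      case False
      have "real m \<ge> 1" using False by simp
      then have pos: "real m - al > 0" "T < real m - al" using al T by auto
      have "ennreal T * cx al m = ennreal (T / (real m - al))"
        using False T by (simp add: cx_def flip: ennreal_mult')
      then have "suminf (\<lambda>k. (ennreal T * cx al m) ^ k) = ennreal (1 / (1 - T / (real m - al)))"
        using suminf_geometric_ennreal[of "T / (real m - al)"] T pos by (simp add: divide_simps)
      also have "1 / (1 - T / (real m - al)) = (real m - al) / (real m - al - T)"
        using pos by (simp add: field_simps)
      finally show ?thesis using False pos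
        by (simp add: cx_def cy_def flip: ennreal_mult'')
    qed (simp add: cx_def cy_def)
    have "suminf (\<lambda>i. ennreal T ^ i * sigma_sum (\<lambda>u. pcoef_gf al u m) (c # r) i) =
      suminf (\<lambda>i. \<Sum>j\<le>i. (ennreal T ^ j * (\<Sum>k<m. sigma_sum (\<lambda>u. pcoef_gf al u k) r j)) * ((ennreal T * cx al m) ^ (i - j) * cx al m))"
    proof (intro arg_cong[where f = suminf] ext)
      fix i
      have *: "ennreal T ^ i * (cx al m ^ (i - j) * (cx al m * S)) =
        (ennreal T ^ j * S) * ((ennreal T * cx al m) ^ (i - j) * cx al m)" if "j \<le> i" for j S
      proof -
        have "ennreal T ^ i = ennreal T ^ j * ennreal T ^ (i - j)" using that by (simp flip: power_add)
        then show ?thesis by (simp add: power_mult_distrib mult_ac)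
      qed
      show "ennreal T ^ i * sigma_sum (\<lambda>u. pcoef_gf al u m) (c # r) i =
        (\<Sum>j\<le>i. (ennreal T ^ j * (\<Sum>k<m. sigma_sum (\<lambda>u. pcoef_gf al u k) r j)) * ((ennreal T * cx al m) ^ (i - j) * cx al m))"
        unfolding LY sigma_sum_LY sum_distrib_left[of "ennreal T ^ i"]
        by (intro sum.cong refl) (simp add: pcoef_gf_replicate pcoef_gf_LY sigma_sum_cmult sigma_sum_sum *)
    qed
    also have "\<dots> = suminf (\<lambda>j. ennreal T ^ j * (\<Sum>k<m. sigma_sum (\<lambda>u. pcoef_gf al u k) r j)) *
       suminf (\<lambda>k. (ennreal T * cx al m) ^ k * cx al m)"
      by (rule suminf_Cauchy_ennreal[where g = "\<lambda>k. (ennreal T * cx al m) ^ k * cx al m"])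
    also have "suminf (\<lambda>k. (ennreal T * cx al m) ^ k * cx al m) = cy al T m"
      by (simp only: suminf_multl_ennreal geo)
    also have "suminf (\<lambda>j. ennreal T ^ j * (\<Sum>k<m. sigma_sum (\<lambda>u. pcoef_gf al u k) r j)) = (\<Sum>k<m. nested_sum al T r k)"
      by (simp add: sum_distrib_left suminf_sum_ennreal Cons)
    finally show ?thesis using LY by (simp add: mult.commute)
  qed
qed

text \<open>The powers of \<open>- ln t\<close> split off as a Cauchy factor and sum to
  \<open>t powr (- al)\<close>.\<close>

lemma suminf_Li_abs:
  assumes t: "0 < t" "t < 1"
  shows "suminf (\<lambda>a. ennreal (al ^ a) * ennreal (Li_abs a u t)) =
     ennreal (t powr (- al)) * suminf (\<lambda>m. ennreal (t ^ m) * pcoef_gf al u m)"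
proof -
  have l: "- ln t > 0" using t by simp
  have PS: "ennreal (PS u j t) = suminf (\<lambda>m. ennreal (pcoef u m j * t ^ m))" for j
    unfolding PS_def using t pcoef_nonneg summable_PS[of t u j]
    by (intro suminf_ennreal_eq[symmetric]) (auto intro: summable_sums)
  have "ennreal (al ^ a) * ennreal (Li_abs a u t) =
     (\<Sum>j\<le>a. ennreal ((al * - ln t) ^ j / fact j) * (ennreal (al ^ (a - j)) * ennreal (PS u (a - j) t)))" for a
  proof -
    have "al ^ a * Li_abs a u t = (\<Sum>j\<le>a. ((al * - ln t) ^ j / fact j) * (al ^ (a - j) * PS u (a - j) t))"
      unfolding Li_abs_def sum_distrib_left
    proof (intro sum.cong refl)
      fix j assume "j \<in> {..a}"
      then have "al ^ a = al ^ j * al ^ (a - j)" by (simp flip: power_add)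
      then show "al ^ a * ((- ln t) ^ j / fact j * PS u (a - j) t) =
         ((al * - ln t) ^ j / fact j) * (al ^ (a - j) * PS u (a - j) t)"
        unfolding power_mult_distrib by simp
    qed
    moreover have "ennreal (\<Sum>j\<le>a. ((al * - ln t) ^ j / fact j) * (al ^ (a - j) * PS u (a - j) t)) =
      (\<Sum>j\<le>a. ennreal ((al * - ln t) ^ j / fact j) * (ennreal (al ^ (a - j)) * ennreal (PS u (a - j) t)))"
    proof -
      have gen: "ennreal (\<Sum>j\<le>a. X j * (Y j * Z j)) = (\<Sum>j\<le>a. ennreal (X j) * (ennreal (Y j) * ennreal (Z j)))"
        if "\<And>j. X j \<ge> 0" "\<And>j. Y j \<ge> 0" "\<And>j. Z j \<ge> 0" for X Y Z :: "nat \<Rightarrow> real"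
        using that by (subst sum_ennreal[symmetric]) (auto simp: ennreal_mult mult_nonneg_nonneg)
      have nn: "(al * - ln t) ^ j / fact j \<ge> 0" for j
        using al l by (intro divide_nonneg_pos zero_le_power mult_nonneg_nonneg) auto
      show ?thesis by (rule gen[OF nn]) (use al t PS_nonneg[of t] in auto)
    qed
    ultimately show ?thesis using al Li_abs_nonneg[OF t] by (simp add: ennreal_mult[symmetric])
  qed
  then have "suminf (\<lambda>a. ennreal (al ^ a) * ennreal (Li_abs a u t)) =
     suminf (\<lambda>j. ennreal ((al * - ln t) ^ j / fact j)) * suminf (\<lambda>j. ennreal (al ^ j) * ennreal (PS u j t))"
    by (simp only: suminf_Cauchy_ennreal[where g = "\<lambda>j. ennreal (al ^ j) * ennreal (PS u j t)"])
  also have "suminf (\<lambda>j. ennreal ((al * - ln t) ^ j / fact j)) = ennreal (t powr (- al))"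
    using al l t by (subst suminf_exp_ennreal) (auto simp: powr_def mult_nonneg_nonpos)
  also have "suminf (\<lambda>j. ennreal (al ^ j) * ennreal (PS u j t)) =
      suminf (\<lambda>j. suminf (\<lambda>m. ennreal (al ^ j) * ennreal (pcoef u m j * t ^ m)))"
    by (simp add: PS)
  also have "\<dots> = suminf (\<lambda>m. suminf (\<lambda>j. ennreal (al ^ j) * ennreal (pcoef u m j * t ^ m)))"
    by (rule suminf_swap_ennreal)
  also have "(\<lambda>m j. ennreal (al ^ j) * ennreal (pcoef u m j * t ^ m)) = (\<lambda>m j. ennreal (t ^ m) * ennreal (al ^ j * pcoef u m j))"
    using al t pcoef_nonneg by (auto simp: fun_eq_iff mult_ac simp flip: ennreal_mult)
  finally show ?thesis by (simp add: pcoef_gf_def)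
qed

lemma suminf_sigma_sum_Li_abs:
  assumes t: "0 < t" "t < 1"
  shows "suminf (\<lambda>a. ennreal (al ^ a) * suminf (\<lambda>i. ennreal (T ^ i) * sigma_sum (\<lambda>u. ennreal (Li_abs a u t)) r i)) =
     ennreal (t powr (- al)) * suminf (\<lambda>m. ennreal (t ^ m) * nested_sum al T r m)"
proof -
  have "suminf (\<lambda>a. ennreal (al ^ a) * suminf (\<lambda>i. ennreal (T ^ i) * sigma_sum (\<lambda>u. ennreal (Li_abs a u t)) r i)) =
    suminf (\<lambda>a. suminf (\<lambda>i. ennreal (T ^ i) * sigma_sum (\<lambda>u. ennreal (al ^ a) * ennreal (Li_abs a u t)) r i))"
    by (simp add: sigma_sum_cmult mult_ac flip: ennreal_suminf_cmult)
  also have "\<dots> = suminf (\<lambda>i. suminf (\<lambda>a. ennreal (T ^ i) * sigma_sum (\<lambda>u. ennreal (al ^ a) * ennreal (Li_abs a u t)) r i))"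
    by (rule suminf_swap_ennreal)
  also have "\<dots> = suminf (\<lambda>i. ennreal (T ^ i) * sigma_sum (\<lambda>u. ennreal (t powr (- al)) * suminf (\<lambda>m. ennreal (t ^ m) * pcoef_gf al u m)) r i)"
    by (simp add: sigma_sum_suminf[symmetric] suminf_Li_abs[OF t])
  also have "\<dots> = suminf (\<lambda>i. suminf (\<lambda>m. ennreal (t powr (- al)) * (ennreal (t ^ m) * (ennreal T ^ i * sigma_sum (\<lambda>u. pcoef_gf al u m) r i))))"
    using T by (simp add: sigma_sum_cmult sigma_sum_multr sigma_sum_suminf mult_ac ennreal_power flip: ennreal_suminf_cmult)
  also have "\<dots> = suminf (\<lambda>m. suminf (\<lambda>i. ennreal (t powr (- al)) * (ennreal (t ^ m) * (ennreal T ^ i * sigma_sum (\<lambda>u. pcoef_gf al u m) r i))))"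
    by (rule suminf_swap_ennreal)
  also have "\<dots> = ennreal (t powr (- al)) * suminf (\<lambda>m. ennreal (t ^ m) * nested_sum al T r m)"
    by (simp add: suminf_sigma_sum_pcoef_gf)
  finally show ?thesis .
qed

text \<open>The counterpart of \<open>pcoef_bound\<close> after summation over the exponents; it
  supplies the finiteness in \<open>generating_sum\<close>.\<close>

lemma nested_sum_bound: "\<exists>K\<ge>0. \<forall>m. nested_sum al T r m \<le> ennreal (K * ew m)"
proof (induction r)
  case Nil
  have "nested_sum al T [] m \<le> ennreal (1 * ew m)" for m
    by (cases "m = 0") (auto simp: ew_def)
  then show ?case by (intro exI[of _ 1]) auto
next
  case (Cons c r)
  then obtain K where K: "K \<ge> 0" "\<And>m. nested_sum al T r m \<le> ennreal (K * ew m)" by blast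
  \<comment> \<open>As \<open>al\<close> and \<open>T\<close> are below 1/8 and
    \<open>m \<ge> 1\<close>, both denominators exceed half of \<open>m\<close>. The 8 below is this
    2 times the 4 of \<open>sum_ew\<close>.\<close>
  have m: "1 / (real m - al) \<le> 2" "1 / (real m - al - T) \<le> 2 / real m" if "m > 0" for m
  proof -
    have "real m \<ge> 1" using that by simp
    then show "1 / (real m - al) \<le> 2" "1 / (real m - al - T) \<le> 2 / real m" using al T by (auto simp: field_simps)
  qed
  have x: "nested_sum al T (LX # r) m \<le> ennreal (2 * K * ew m)" for m
  proof (cases "m = 0")
    case False
    have "nested_sum al T (LX # r) m \<le> ennreal 2 * ennreal (K * ew m)"
      using False m[of m] ennreal_leI[OF m(1)[of m]] K(2)[of m] by (auto simp: cx_def intro!: mult_mono ennreal_leI)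
    also have "\<dots> = ennreal (2 * K * ew m)"
      using K(1) ew_pos[of m] by (subst ennreal_mult[symmetric]) (auto simp: mult.assoc)
    finally show ?thesis .
  qed (simp add: cx_def)
  have y: "nested_sum al T (LY # r) m \<le> ennreal (8 * K * ew m)" for m
  proof (cases "m = 0")
    case False
    have "(\<Sum>k<m. nested_sum al T r k) \<le> (\<Sum>k<m. ennreal (K * ew k))" by (intro sum_mono K)
    also have "\<dots> = ennreal (K * (4 * real m * ew m))"
      using K(1) ew_pos by (subst sum_ennreal) (auto simp: sum_ew less_imp_le simp flip: sum_distrib_left)
    finally have "nested_sum al T (LY # r) m \<le> ennreal (2 / real m) * ennreal (K * (4 * real m * ew m))"
      using False m(2)[of m] by (auto simp: cy_def intro!: mult_mono ennreal_leI)
    also have "\<dots> = ennreal (8 * K * ew m)"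
      using K(1) ew_pos[of m] False by (simp add: ennreal_mult[symmetric])
    finally show ?thesis .
  qed (simp add: cy_def)
  show ?case
  proof (cases c)
    case LX
    then show ?thesis using x K(1) by (intro exI[of _ "2 * K"]) auto
  next
    case LY
    then show ?thesis using y K(1) by (intro exI[of _ "8 * K"]) auto
  qed
qed

end

section \<open>The generating function of the tails as an integral and as a series\<close>

lemma Li_abs_measurable [measurable]: "Li_abs a r \<in> borel_measurable borel"
  unfolding Li_abs_def[abs_def] PS_def by measurable

lemma sigma_sum_nn_integral:
  "(\<And>u. f u \<in> borel_measurable M) \<Longrightarrow> (\<integral>\<^sup>+t. sigma_sum (\<lambda>u. f u t) r i \<partial>M) = sigma_sum (\<lambda>u. \<integral>\<^sup>+t. f u t \<partial>M) r i"
  unfolding sigma_sum_conv_sum by (subst nn_integral_sum) auto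

lemma nn_integral_suminf3:
  assumes "\<And>b a n. f b a n \<in> borel_measurable M"
  shows "suminf (\<lambda>b. suminf (\<lambda>a. suminf (\<lambda>n. \<integral>\<^sup>+t. f b a n t \<partial>M))) =
    (\<integral>\<^sup>+t. suminf (\<lambda>b. suminf (\<lambda>a. suminf (\<lambda>n. f b a n t))) \<partial>M)"
  using assms by (simp add: nn_integral_suminf)

text \<open>The coefficient of \<open>B^b A^a T^n\<close> in the regularized value of 1/(1 - xA)
  sigma(\<open>rev r\<close>) x 1/(1 - xT - yB). The isolated \<open>x\<close> is the cut; the
  shuffle of powers of \<open>x\<close> and \<open>y\<close> is the sum of all words with these
  letters.\<close>

definition tail_coeff :: "letter list \<Rightarrow> nat \<Rightarrow> nat \<Rightarrow> nat \<Rightarrow> real" where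
  "tail_coeff r a b n = (\<Sum>i\<le>n. sigma_sum (\<lambda>u. shuffle_sum (\<lambda>h. reg_zeta ((replicate a LX @ rev u) @ LX # h))
      (replicate (n - i) LX) (replicate b LY)) r i)"

text \<open>The integrals of \<open>reg_zeta_trail\<close> for all words of sigma carry the same
  sign \<open>(-1)^(a+b)\<close>, so their sum can be taken inside one nonnegative integral.\<close>

lemma tail_coeff_integral:
  assumes r: "r = [] \<or> last r = LY" and rb: "r \<noteq> [] \<or> b > 0"
  shows "ennreal ((- 1) ^ (a + b) * tail_coeff r a b n) =
      (\<integral>\<^sup>+t\<in>{0<..<1}. (\<Sum>i\<le>n. sigma_sum (\<lambda>u. ennreal (Li_abs a u t)) r i * ennreal ((- ln t) ^ (n - i) / fact (n - i))) *
         ennreal ((- ln (1 - t)) ^ b / fact b / t) \<partial>lborel)" (is "?lhs = ?rhs")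
    and "(- 1) ^ (a + b) * tail_coeff r a b n \<ge> 0"
proof -
  let ?s = "\<lambda>u k. (- 1) ^ (a + b) * shuffle_sum (\<lambda>h. reg_zeta ((replicate a LX @ rev u) @ LX # h)) (replicate k LX) (replicate b LY)"
  let ?g = "\<lambda>u k t. ennreal (Li_abs a u t * ((- ln t) ^ k / fact k) * ((- ln (1 - t)) ^ b / fact b) / t)
           * indicator {0<..<1} t"
  have u: "(u = [] \<or> last u = LY) \<and> (u \<noteq> [] \<or> b > 0)" if "u \<in> set (sigma_words r i)" for u i
    using last_sigma_words[OF that] r rb by auto
  have tr: "(\<integral>\<^sup>+t. ?g u k t \<partial>lborel) = ennreal (?s u k)" "?s u k \<ge> 0" if "u \<in> set (sigma_words r i)" for u k i
    using reg_zeta_trail[of u b a k] u[OF that] by auto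
  have X: "(- 1) ^ (a + b) * tail_coeff r a b n = (\<Sum>i\<le>n. sigma_sum (\<lambda>u. ?s u (n - i)) r i)"
    unfolding tail_coeff_def by (simp add: sum_distrib_left flip: sigma_sum_cmult)
  have nn: "sigma_sum (\<lambda>u. ?s u (n - i)) r i \<ge> 0" for i by (rule sigma_sum_nonneg) (rule tr)
  show "(- 1) ^ (a + b) * tail_coeff r a b n \<ge> 0" unfolding X by (intro sum_nonneg nn)
  have "?lhs = (\<Sum>i\<le>n. ennreal (sigma_sum (\<lambda>u. ?s u (n - i)) r i))"
    unfolding X using nn by (subst sum_ennreal) auto
  also have "\<dots> = (\<Sum>i\<le>n. sigma_sum (\<lambda>u. ennreal (?s u (n - i))) r i)"
  proof (intro sum.cong refl)
    fix i show "ennreal (sigma_sum (\<lambda>u. ?s u (n - i)) r i) = sigma_sum (\<lambda>u. ennreal (?s u (n - i))) r i"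
      unfolding sigma_sum_conv_sum using tr(2)[of _ i] by (subst sum_ennreal) auto
  qed
  also have "\<dots> = (\<Sum>i\<le>n. sigma_sum (\<lambda>u. \<integral>\<^sup>+t. ?g u (n - i) t \<partial>lborel) r i)"
    by (intro sum.cong sigma_sum_cong refl) (simp only: tr(1))
  also have "\<dots> = (\<Sum>i\<le>n. \<integral>\<^sup>+t. sigma_sum (\<lambda>u. ?g u (n - i) t) r i \<partial>lborel)"
    by (intro sum.cong refl sigma_sum_nn_integral[symmetric]) measurable
  also have "\<dots> = (\<integral>\<^sup>+t. (\<Sum>i\<le>n. sigma_sum (\<lambda>u. ?g u (n - i) t) r i) \<partial>lborel)"
    unfolding sigma_sum_conv_sum by (subst nn_integral_sum) auto
  also have "\<dots> = ?rhs"
  proof (intro nn_integral_cong)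
    fix t :: real
    show "(\<Sum>i\<le>n. sigma_sum (\<lambda>u. ?g u (n - i) t) r i) = (\<Sum>i\<le>n. sigma_sum (\<lambda>u. ennreal (Li_abs a u t)) r i * ennreal ((- ln t) ^ (n - i) / fact (n - i))) *
         ennreal ((- ln (1 - t)) ^ b / fact b / t) * indicator {0<..<1} t"
    proof (cases "0 < t \<and> t < 1")
      case True
      then have p: "0 \<le> (- ln t) ^ k / fact k" "0 \<le> (- ln (1 - t)) ^ b / fact b / t" "0 \<le> Li_abs a u t" for k u
        by (auto intro!: divide_nonneg_pos zero_le_power Li_abs_nonneg)
      have "?g u k t = ennreal (Li_abs a u t) * (ennreal ((- ln t) ^ k / fact k) * ennreal ((- ln (1 - t)) ^ b / fact b / t))" for u k
      proof -
        have "?g u k t = ennreal (Li_abs a u t * ((- ln t) ^ k / fact k * ((- ln (1 - t)) ^ b / fact b / t)))"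
          using True by (simp add: mult.assoc)
        then show ?thesis by (simp only: ennreal_mult p mult_nonneg_nonneg)
      qed
      then show ?thesis using True by (simp add: sigma_sum_multr sum_distrib_right mult.assoc)
    next
      case False
      then have "indicator {0<..<1} t = (0::ennreal)" by auto
      then show ?thesis by (simp add: sigma_sum_conv_sum)
    qed
  qed
  finally show "?lhs = ?rhs" .
qed

lemma nn_integral_Beta:
  assumes "a > 0" "b > 0"
  shows "(\<integral>\<^sup>+t\<in>{0<..<1}. ennreal (t powr (a - 1) * (1 - t) powr (b - 1)) \<partial>lborel) = ennreal (Beta a b)"
proof -
  have "((\<lambda>t. t powr (a - 1) * (1 - t) powr (b - 1)) has_integral Beta a b) {0<..<1}"
    using has_integral_Beta_real[OF assms] by (simp add: has_integral_Icc_iff_Ioo)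
  from nn_integral_has_integral_lebesgue[OF _ this]
  have "integral\<^sup>N lborel (\<lambda>t. ennreal (indicator {0<..<1} t * (t powr (a - 1) * (1 - t) powr (b - 1)))) = ennreal (Beta a b)"
    by simp
  then show ?thesis
    by (simp add: ennreal_mult'' ennreal_indicator mult.commute)
qed

context
  fixes al be T :: real
  assumes al: "0 < al" "al < 1/8" and be: "0 < be" "be < 1/8" and T: "0 < T" "T < 1/8"
begin

text \<open>The sums factor. The one over \<open>b\<close> is exponential and gives
  \<open>(1 - t) powr (- be)\<close>; the one over \<open>n\<close> is a Cauchy product of the sigma
  part with the expansion of \<open>t powr (- T)\<close>; the one over \<open>a\<close> is
  \<open>suminf_sigma_sum_Li_abs\<close>.\<close>

lemma generating_integrand:
  assumes t: "0 < t" "t < 1"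
  shows "suminf (\<lambda>b. suminf (\<lambda>a. suminf (\<lambda>n. ennreal (be ^ b) * ennreal (al ^ a) * ennreal (T ^ n) *
      ((\<Sum>i\<le>n. sigma_sum (\<lambda>u. ennreal (Li_abs a u t)) r i * ennreal ((- ln t) ^ (n - i) / fact (n - i))) *
         ennreal ((- ln (1 - t)) ^ b / fact b / t))))) =
     suminf (\<lambda>m. nested_sum al T r m * ennreal (t powr (real m - al - T - 1) * (1 - t) powr (- be)))"
proof -
  have l: "- ln t > 0" "- ln (1 - t) > 0" using t by auto
  let ?S = "\<lambda>a i. sigma_sum (\<lambda>u. ennreal (Li_abs a u t)) r i"
  have W: "suminf (\<lambda>n. ennreal (T ^ n) * (\<Sum>i\<le>n. ?S a i * ennreal ((- ln t) ^ (n - i) / fact (n - i)))) =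
     suminf (\<lambda>i. ennreal (T ^ i) * ?S a i) * ennreal (t powr (- T))" for a
  proof -
    have "ennreal (T ^ n) * (\<Sum>i\<le>n. ?S a i * ennreal ((- ln t) ^ (n - i) / fact (n - i))) =
       (\<Sum>i\<le>n. (ennreal (T ^ i) * ?S a i) * ennreal ((T * - ln t) ^ (n - i) / fact (n - i)))" for n
      unfolding sum_distrib_left
    proof (intro sum.cong refl)
      fix i assume i: "i \<in> {..n}"
      have e1: "ennreal (T ^ n) = ennreal (T ^ i) * ennreal (T ^ (n - i))"
        using i T by (simp flip: ennreal_mult power_add)
      have e2: "ennreal (T ^ (n - i)) * ennreal ((- ln t) ^ (n - i) / fact (n - i)) =
          ennreal ((T * - ln t) ^ (n - i) / fact (n - i))"
        using T l unfolding power_mult_distrib by (subst ennreal_mult[symmetric]) (auto intro!: divide_nonneg_pos)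
      show "ennreal (T ^ n) * (?S a i * ennreal ((- ln t) ^ (n - i) / fact (n - i))) =
         (ennreal (T ^ i) * ?S a i) * ennreal ((T * - ln t) ^ (n - i) / fact (n - i))"
        unfolding e1 e2[symmetric] by (simp only: mult_ac)
    qed
    then have "suminf (\<lambda>n. ennreal (T ^ n) * (\<Sum>i\<le>n. ?S a i * ennreal ((- ln t) ^ (n - i) / fact (n - i)))) =
      suminf (\<lambda>i. ennreal (T ^ i) * ?S a i) * suminf (\<lambda>k. ennreal ((T * - ln t) ^ k / fact k))"
      using suminf_Cauchy_ennreal[of "\<lambda>i. ennreal (T ^ i) * ?S a i" "\<lambda>k. ennreal ((T * - ln t) ^ k / fact k)"]
      by (simp only:)
    also have "suminf (\<lambda>k. ennreal ((T * - ln t) ^ k / fact k)) = ennreal (t powr (- T))"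
      using T l t by (subst suminf_exp_ennreal) (auto simp: powr_def mult_nonneg_nonpos)
    finally show ?thesis .
  qed
  have V: "suminf (\<lambda>b. ennreal (be ^ b) * ennreal ((- ln (1 - t)) ^ b / fact b / t)) = ennreal ((1 - t) powr (- be) / t)"
  proof -
    define c where "c = - ln (1 - t)"
    have c: "c \<ge> 0" "exp (be * c) = (1 - t) powr (- be)" using l t by (auto simp: c_def powr_def)
    have "ennreal (be ^ b) * ennreal (c ^ b / fact b / t) = ennreal ((be * c) ^ b / fact b) * ennreal (1 / t)" for b
    proof -
      have "be ^ b * (c ^ b / fact b / t) = (be * c) ^ b / fact b * (1 / t)"
        unfolding power_mult_distrib by simp
      then show ?thesis using be c(1) t by (simp add: ennreal_mult[symmetric])
    qed
    then have "suminf (\<lambda>b. ennreal (be ^ b) * ennreal (c ^ b / fact b / t)) = ennreal (exp (be * c)) * ennreal (1 / t)"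
      using be c(1) by (simp only: suminf_multl_ennreal) (subst suminf_exp_ennreal, auto)
    then show ?thesis using t unfolding c(2) by (simp add: c_def flip: ennreal_mult)
  qed
  have "suminf (\<lambda>b. suminf (\<lambda>a. suminf (\<lambda>n. ennreal (be ^ b) * ennreal (al ^ a) * ennreal (T ^ n) *
      ((\<Sum>i\<le>n. ?S a i * ennreal ((- ln t) ^ (n - i) / fact (n - i))) *
         ennreal ((- ln (1 - t)) ^ b / fact b / t))))) =
    suminf (\<lambda>b. suminf (\<lambda>a. (ennreal (be ^ b) * ennreal ((- ln (1 - t)) ^ b / fact b / t)) *
      (ennreal (al ^ a) * suminf (\<lambda>n. ennreal (T ^ n) *
      (\<Sum>i\<le>n. ?S a i * ennreal ((- ln t) ^ (n - i) / fact (n - i)))))))"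
    unfolding ennreal_suminf_cmult[symmetric] by (simp only: mult_ac)
  also have "\<dots> = suminf (\<lambda>b. ennreal (be ^ b) * ennreal ((- ln (1 - t)) ^ b / fact b / t)) *
      suminf (\<lambda>a. ennreal (al ^ a) * (suminf (\<lambda>i. ennreal (T ^ i) * ?S a i) * ennreal (t powr (- T))))"
    unfolding W ennreal_suminf_cmult suminf_multl_ennreal ..
  also have "suminf (\<lambda>a. ennreal (al ^ a) * (suminf (\<lambda>i. ennreal (T ^ i) * ?S a i) * ennreal (t powr (- T)))) =
     suminf (\<lambda>a. ennreal (al ^ a) * suminf (\<lambda>i. ennreal (T ^ i) * ?S a i)) * ennreal (t powr (- T))"
    unfolding mult.assoc[symmetric] suminf_multl_ennreal ..
  also have "suminf (\<lambda>a. ennreal (al ^ a) * suminf (\<lambda>i. ennreal (T ^ i) * ?S a i)) =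
     ennreal (t powr (- al)) * suminf (\<lambda>m. ennreal (t ^ m) * nested_sum al T r m)"
    by (rule suminf_sigma_sum_Li_abs[OF al T t])
  also have "suminf (\<lambda>b. ennreal (be ^ b) * ennreal ((- ln (1 - t)) ^ b / fact b / t)) *
      (ennreal (t powr (- al)) * suminf (\<lambda>m. ennreal (t ^ m) * nested_sum al T r m) * ennreal (t powr (- T))) =
     suminf (\<lambda>m. nested_sum al T r m * ennreal (t powr (real m - al - T - 1) * (1 - t) powr (- be)))"
  proof -
    have "ennreal (t powr (real m - al - T - 1) * (1 - t) powr (- be)) =
      ennreal ((1 - t) powr (- be) / t) * (ennreal (t powr (- al)) * (ennreal (t ^ m) * ennreal (t powr (- T))))" for m
    proof -
      have "t powr (real m - al - T - 1) = t ^ m * t powr (- al) * t powr (- T) / t"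
      proof -
        have "t powr (real m - al - T - 1) = t powr (real m + - al + - T + - 1)" by (simp add: algebra_simps)
        also have "\<dots> = t powr real m * t powr (- al) * t powr (- T) * t powr (- 1)" by (simp only: powr_add)
        finally show ?thesis using t by (simp add: powr_realpow powr_minus_divide)
      qed
      then have "t powr (real m - al - T - 1) * (1 - t) powr (- be) =
        ((1 - t) powr (- be) / t) * (t powr (- al) * (t ^ m * t powr (- T)))" by simp
      then show ?thesis using t by (simp only: ennreal_mult mult_nonneg_nonneg powr_ge_zero zero_le_power less_imp_le divide_nonneg_pos)
    qed
    then show ?thesis
      unfolding V by (simp only: ennreal_suminf_cmult[symmetric] suminf_multl_ennreal[symmetric] mult_ac)
  qed
  finally show ?thesis .
qed

lemma generating_sum_integral:
  assumes r: "r = [] \<or> last r = LY" and rb: "r \<noteq> []"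
  shows "suminf (\<lambda>b. suminf (\<lambda>a. suminf (\<lambda>n. ennreal (be ^ b) * ennreal (al ^ a) * ennreal (T ^ n) *
      ennreal ((- 1) ^ (a + b) * tail_coeff r a b n)))) =
     (\<integral>\<^sup>+t\<in>{0<..<1}. suminf (\<lambda>m. nested_sum al T r m * ennreal (t powr (real m - al - T - 1) * (1 - t) powr (- be))) \<partial>lborel)"
proof -
  let ?g = "\<lambda>b a n t. (\<Sum>i\<le>n. sigma_sum (\<lambda>u. ennreal (Li_abs a u t)) r i * ennreal ((- ln t) ^ (n - i) / fact (n - i))) *
         ennreal ((- ln (1 - t)) ^ b / fact b / t)"
  have [measurable]: "?g b a n \<in> borel_measurable lborel" for b a n
    unfolding sigma_sum_conv_sum by measurable
  have "suminf (\<lambda>b. suminf (\<lambda>a. suminf (\<lambda>n. ennreal (be ^ b) * ennreal (al ^ a) * ennreal (T ^ n) *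
      ennreal ((- 1) ^ (a + b) * tail_coeff r a b n)))) =
     suminf (\<lambda>b. suminf (\<lambda>a. suminf (\<lambda>n. \<integral>\<^sup>+t. ennreal (be ^ b) * ennreal (al ^ a) * ennreal (T ^ n) * (?g b a n t * indicator {0<..<1} t) \<partial>lborel)))"
  proof -
    have "c * ennreal ((- 1) ^ (a + b) * tail_coeff r a b n) = (\<integral>\<^sup>+t. c * (?g b a n t * indicator {0<..<1} t) \<partial>lborel)" for c a b n
      unfolding tail_coeff_integral(1)[OF r disjI1[OF rb]] by (rule nn_integral_cmult[symmetric]) measurable
    then show ?thesis by (simp only:)
  qed
  also have "\<dots> = (\<integral>\<^sup>+t. suminf (\<lambda>b. suminf (\<lambda>a. suminf (\<lambda>n. ennreal (be ^ b) * ennreal (al ^ a) * ennreal (T ^ n) * (?g b a n t * indicator {0<..<1} t)))) \<partial>lborel)"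
    by (rule nn_integral_suminf3) measurable
  also have "\<dots> = (\<integral>\<^sup>+t\<in>{0<..<1}. suminf (\<lambda>m. nested_sum al T r m * ennreal (t powr (real m - al - T - 1) * (1 - t) powr (- be))) \<partial>lborel)"
  proof (intro nn_integral_cong)
    fix t :: real
    show "suminf (\<lambda>b. suminf (\<lambda>a. suminf (\<lambda>n. ennreal (be ^ b) * ennreal (al ^ a) * ennreal (T ^ n) * (?g b a n t * indicator {0<..<1} t)))) =
      suminf (\<lambda>m. nested_sum al T r m * ennreal (t powr (real m - al - T - 1) * (1 - t) powr (- be))) * indicator {0<..<1} t"
    proof (cases "0 < t \<and> t < 1")
      case True
      then show ?thesis using generating_integrand[of t r] by simp
    next
      case False
      then have "indicator {0<..<1} t = (0::ennreal)" by auto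
      then show ?thesis by simp
    qed
  qed
  finally show ?thesis .
qed

text \<open>Tonelli's theorem leads to termwise Beta integrals. Finiteness follows from
  \<open>nested_sum_bound\<close>: the weights \<open>ew\<close> sum to
  \<open>(1 - t) powr - (1/4)\<close>, so one Beta integral dominates everything.\<close>

lemma generating_sum:
  assumes r: "r \<noteq> []" "last r = LY"
  shows "suminf (\<lambda>b. suminf (\<lambda>a. suminf (\<lambda>n. ennreal (be ^ b) * ennreal (al ^ a) * ennreal (T ^ n) *
      ennreal ((- 1) ^ (a + b) * tail_coeff r a b n)))) =
     suminf (\<lambda>m. nested_sum al T r m * ennreal (Beta (real m - al - T) (1 - be)))" (is "?lhs = ?rhs")
  and "suminf (\<lambda>m. nested_sum al T r m * ennreal (Beta (real m - al - T) (1 - be))) < top"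
proof -
  let ?k = "\<lambda>m t. ennreal (t powr (real m - al - T - 1) * (1 - t) powr (- be))"
  have "?lhs = (\<integral>\<^sup>+t. suminf (\<lambda>m. nested_sum al T r m * (?k m t * indicator {0<..<1} t)) \<partial>lborel)"
    using generating_sum_integral[of r] r by (simp add: suminf_multl_ennreal[symmetric] mult.assoc)
  also have "\<dots> = suminf (\<lambda>m. nested_sum al T r m * (\<integral>\<^sup>+t\<in>{0<..<1}. ?k m t \<partial>lborel))"
    by (simp add: nn_integral_suminf nn_integral_cmult)
  also have "\<dots> = ?rhs"
  proof (intro arg_cong[where f = suminf] ext)
    fix m show "nested_sum al T r m * (\<integral>\<^sup>+t\<in>{0<..<1}. ?k m t \<partial>lborel) = nested_sum al T r m * ennreal (Beta (real m - al - T) (1 - be))"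
    proof (cases "m = 0")
      case True
      then show ?thesis using r by (simp add: nested_sum_at_0)
    next
      case False
      then have "real m \<ge> 1" by simp
      then have "real m - al - T > 0" "1 - be > 0" using al be T by auto
      from nn_integral_Beta[OF this] show ?thesis by simp
    qed
  qed
  finally show eq: "?lhs = ?rhs" .
  obtain K where K: "K \<ge> 0" "\<And>m. nested_sum al T r m \<le> ennreal (K * ew m)" using nested_sum_bound[OF al T] by blast
  \<comment> \<open>The parameter \<open>3/4 - be\<close> is \<open>1 - be\<close> less the 1/4 lost
    to \<open>ew\<close>; the other parameter is positive because the terms start at
    \<open>m = 1\<close>.\<close>
  have "?lhs \<le> (\<integral>\<^sup>+t. ennreal K * (ennreal (t powr (1 - al - T - 1) * (1 - t) powr (3/4 - be - 1)) * indicator {0<..<1} t) \<partial>lborel)"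
    unfolding generating_sum_integral[OF disjI2[OF r(2)] r(1)]
  proof (intro nn_integral_mono)
    fix t :: real
    show "suminf (\<lambda>m. nested_sum al T r m * ?k m t) * indicator {0<..<1} t \<le>
      ennreal K * (ennreal (t powr (1 - al - T - 1) * (1 - t) powr (3/4 - be - 1)) * indicator {0<..<1} t)"
    proof (cases "0 < t \<and> t < 1")
      case True
      have "suminf (\<lambda>m. nested_sum al T r m * ?k m t) = suminf (\<lambda>m. nested_sum al T r (m + 1) * ?k (m + 1) t) + (\<Sum>m<1. nested_sum al T r m * ?k m t)"
        by (rule suminf_offset) simp
      also have "\<dots> = suminf (\<lambda>m. nested_sum al T r (Suc m) * ?k (Suc m) t)" using r by (simp add: nested_sum_at_0)
      also have "\<dots> \<le> suminf (\<lambda>m. ennreal (K * (t powr (1 - al - T - 1) * (1 - t) powr (- be)) * (ew m * t ^ m)))"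
      proof (intro suminf_le)
        fix m
        have "nested_sum al T r (Suc m) * ?k (Suc m) t \<le> ennreal (K * ew m) * ?k (Suc m) t"
        proof (rule mult_right_mono)
          have "K * ew (Suc m) \<le> K * ew m" by (intro mult_left_mono ew_Suc_le K(1))
          then show "nested_sum al T r (Suc m) \<le> ennreal (K * ew m)" using K(2)[of "Suc m"] by (metis ennreal_leI order_trans)
        qed simp
        also have "t powr (real (Suc m) - al - T - 1) = t ^ m * t powr (1 - al - T - 1)"
          using True by (simp add: powr_diff powr_add powr_minus powr_realpow field_simps)
        then have "ennreal (K * ew m) * ?k (Suc m) t = ennreal (K * (t powr (1 - al - T - 1) * (1 - t) powr (- be)) * (ew m * t ^ m))"
          using K(1) ew_pos[of m] True by (subst ennreal_mult[symmetric]) (auto simp: mult_ac)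
        finally show "nested_sum al T r (Suc m) * ?k (Suc m) t \<le> ennreal (K * (t powr (1 - al - T - 1) * (1 - t) powr (- be)) * (ew m * t ^ m))" .
      qed auto
      also have "\<dots> = ennreal (K * (t powr (1 - al - T - 1) * (1 - t) powr (- be)) * (1 - t) powr - (1/4))"
        using K(1) ew_pos True by (intro suminf_ennreal_eq sums_mult sums_ew) (auto intro!: mult_nonneg_nonneg less_imp_le[OF ew_pos])
      also have "K * (t powr (1 - al - T - 1) * (1 - t) powr (- be)) * (1 - t) powr - (1/4) = K * (t powr (1 - al - T - 1) * (1 - t) powr (3/4 - be - 1))"
      proof -
        have "3/4 - be - 1 = - be + - (1/4)" by simp
        then show ?thesis by (simp only: powr_add mult.assoc)
      qed
      finally show ?thesis using True K(1) by (simp add: ennreal_mult)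
    next
      case False
      then have "indicator {0<..<1} t = (0::ennreal)" by auto
      then show ?thesis by simp
    qed
  qed
  also have "\<dots> = ennreal K * ennreal (Beta (1 - al - T) (3/4 - be))"
    using nn_integral_Beta[of "1 - al - T" "3/4 - be"] al be T by (subst nn_integral_cmult) auto
  also have "\<dots> < top" by (simp add: ennreal_mult_less_top)
  finally show "?rhs < top" unfolding eq .
qed

end

section \<open>Connected sums\<close>

text \<open>This is the connector of Seki and Yamamoto, shifted by \<open>-\<alpha>\<close> and \<open>-\<beta>\<close> and deformed by \<open>T\<close>.\<close>

definition connector :: "real \<Rightarrow> real \<Rightarrow> real \<Rightarrow> nat \<Rightarrow> nat \<Rightarrow> real" where
  "connector al be T m n = Gamma (real m + 1 - al - T) * Gamma (real n + 1 - be - T)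
     / Gamma (real m + real n + 1 - al - be - T)"

definition connected_sum :: "real \<Rightarrow> real \<Rightarrow> real \<Rightarrow> letter list \<Rightarrow> letter list \<Rightarrow> ennreal" where
  "connected_sum al be T r s = suminf (\<lambda>m. suminf (\<lambda>n. nested_sum al T r m * nested_sum be T s n * ennreal (connector al be T m n)))"

lemma connector_commute: "connector al be T m n = connector be al T n m"
  by (simp add: connector_def algebra_simps)

lemma connected_sum_commute: "connected_sum al be T r s = connected_sum be al T s r"
  unfolding connected_sum_def by (subst suminf_swap_ennreal) (simp add: connector_commute[of al] mult_ac)

text \<open>If the limit were positive, the differences, whose telescoping sum is finite, would
  dominate a multiple of the harmonic series.\<close>

lemma harmonic_decay:
  fixes f :: "nat \<Rightarrow> real"
  assumes nn: "\<And>n. f n \<ge> 0" and u: "u > 0" and d: "\<And>n. f n - f (Suc n) \<ge> u * f (Suc n) / real (Suc n)"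
  shows "f \<longlonglongrightarrow> 0"
proof -
  have dec: "decseq f"
    using d nn u by (intro decseq_SucI) (smt (verit) divide_nonneg_nonneg mult_nonneg_nonneg of_nat_0_le_iff)
  obtain l where l: "f \<longlonglongrightarrow> l" "\<And>n. l \<le> f n"
    using decseq_convergent[OF dec, of 0] nn by metis
  have "l \<ge> 0" using l nn by (intro LIMSEQ_le_const) auto
  moreover have "\<not> l > 0"
  proof
    assume "l > 0"
    have "summable (\<lambda>n. f n - f (Suc n))" using telescope_sums'[OF l(1)] by (auto simp: sums_iff)
    moreover have le: "norm (u * l * inverse (real (Suc n))) \<le> f n - f (Suc n)" for n
    proof -
      have "norm (u * l * inverse (real (Suc n))) = u * l / real (Suc n)"
        using u \<open>l > 0\<close> by (simp add: divide_inverse abs_mult)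
      also have "\<dots> \<le> u * f (Suc n) / real (Suc n)"
        using l(2) u by (intro divide_right_mono mult_left_mono) auto
      also have "\<dots> \<le> f n - f (Suc n)" by (rule d)
      finally show ?thesis .
    qed
    ultimately have "summable (\<lambda>n. u * l * inverse (real (Suc n)))"
      using summable_comparison_test'[of "\<lambda>n. f n - f (Suc n)" 0 "\<lambda>n. u * l * inverse (real (Suc n))"] by blast
    then have "summable (\<lambda>n. inverse (real (Suc n)))" using u \<open>l > 0\<close> by (simp add: summable_cmult_iff)
    then have "summable (\<lambda>n. inverse (real n))" by (subst (asm) summable_Suc_iff[where f = "\<lambda>n. inverse (real n)"])
    then show False using not_summable_harmonic[where 'a = real] by simp
  qed
  ultimately show ?thesis using l(1) by simp
qed

context
  fixes al be T :: real
  assumes al: "0 < al" "al < 1/8" and be: "0 < be" "be < 1/8" and T: "0 < T" "T < 1/8"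
begin

lemma connector_pos: "connector al be T m n > 0"
  unfolding connector_def using al be T by (intro divide_pos_pos mult_pos_pos Gamma_real_pos) auto

text \<open>Raising \<open>n\<close> by one multiplies the connector by \<open>x / y\<close> with
  \<open>y - x = m - al\<close>, by the functional equation of \<open>Gamma\<close>. This is the
  telescoping relation that drives the transport.\<close>

lemma connector_Suc:
  assumes m: "m > 0"
  shows "(real m - al) * connector al be T m (Suc n) / (real (Suc n) - be - T) = connector al be T m n - connector al be T m (Suc n)"
proof -
  define x y where "x = real n + 1 - be - T" and "y = real m + real n + 1 - al - be - T"
  have xy: "x > 0" "y > 0" "y = x + (real m - al)" using al be T m by (auto simp: x_def y_def)
  have gx: "Gamma (real (Suc n) + 1 - be - T) = x * Gamma x"
  proof -
    have "real (Suc n) + 1 - be - T = x + 1" "x \<notin> \<int>\<^sub>\<le>\<^sub>0" using xy nonpos_Ints_nonpos by (fastforce simp: x_def)+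
    then show ?thesis using Gamma_plus1[of x] by (metis mult.commute)
  qed
  have gy: "Gamma (real m + real (Suc n) + 1 - al - be - T) = y * Gamma y"
  proof -
    have "real m + real (Suc n) + 1 - al - be - T = y + 1" "y \<notin> \<int>\<^sub>\<le>\<^sub>0" using xy nonpos_Ints_nonpos by (fastforce simp: y_def)+
    then show ?thesis using Gamma_plus1[of y] by (metis mult.commute)
  qed
  define c where "c = connector al be T m n"
  have c: "c = Gamma (real m + 1 - al - T) * Gamma x / Gamma y" by (simp add: c_def connector_def x_def y_def)
  have C: "connector al be T m (Suc n) = c * x / y" unfolding connector_def gx gy c by (simp add: mult_ac)
  have "real (Suc n) - be - T = x" by (simp add: x_def)
  moreover have "z * (c * x / y) / x = c - c * x / y" if "y = x + z" for z
  proof -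
    have "c - c * x / y = c * (y - x) / y" using xy(2) by (simp add: right_diff_distrib diff_divide_distrib)
    moreover have "y - x = z" using that by simp
    moreover have "z * (c * x / y) / x = c * z / y" using xy(1) by (simp add: mult_ac)
    ultimately show ?thesis by simp
  qed
  ultimately show ?thesis unfolding C using xy by (simp add: c_def[symmetric])
qed

text \<open>\<open>connector_Suc\<close> telescopes from \<open>k\<close> on, and
  \<open>harmonic_decay\<close> gives the limit 0. A summation with the factor of a \<open>y\<close>
  on the side of \<open>n\<close> thus becomes the factor of an \<open>x\<close> on the side of
  \<open>m\<close>.\<close>

lemma connector_tail:
  assumes m: "m > 0"
  shows "suminf (\<lambda>n. if k < n then cy be T n * ennreal (connector al be T m n) else 0) = cx al m * ennreal (connector al be T m k)"
proof -
  have u: "real m - al > 0" using m al by (cases m) auto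
  have lim: "(\<lambda>n. connector al be T m n) \<longlonglongrightarrow> 0"
  proof (rule harmonic_decay[OF _ u])
    fix n
    have "(real m - al) * connector al be T m (Suc n) / real (Suc n) \<le> (real m - al) * connector al be T m (Suc n) / (real (Suc n) - be - T)"
      using u be T connector_pos[of m "Suc n"] by (intro divide_left_mono mult_nonneg_nonneg mult_pos_pos) auto
    then show "(real m - al) * connector al be T m (Suc n) / real (Suc n) \<le> connector al be T m n - connector al be T m (Suc n)"
      using connector_Suc[OF m, of n] by simp
  qed (use connector_pos in \<open>auto intro: less_imp_le\<close>)
  have "(\<lambda>i. connector al be T m (i + k)) \<longlonglongrightarrow> 0" using lim by (rule LIMSEQ_ignore_initial_segment)
  from telescope_sums'[OF this]
  have "(\<lambda>i. connector al be T m (i + k) - connector al be T m (Suc i + k)) sums connector al be T m k" by simp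
  then have "(\<lambda>i. (real m - al) * connector al be T m (Suc (i + k)) / (real (Suc (i + k)) - be - T)) sums connector al be T m k"
    by (simp only: connector_Suc[OF m] add_Suc)
  from sums_divide[OF this, of "real m - al"]
  have s: "(\<lambda>i. 1 / (real (Suc (i + k)) - be - T) * connector al be T m (Suc (i + k))) sums (connector al be T m k / (real m - al))"
    using u by simp
  have "suminf (\<lambda>n. if k < n then cy be T n * ennreal (connector al be T m n) else 0) =
    suminf (\<lambda>i. if k < i + Suc k then cy be T (i + Suc k) * ennreal (connector al be T m (i + Suc k)) else 0)
     + (\<Sum>n<Suc k. if k < n then cy be T n * ennreal (connector al be T m n) else 0)"
    by (rule suminf_offset) simp
  also have "(\<Sum>n<Suc k. if k < n then cy be T n * ennreal (connector al be T m n) else 0) = 0"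
    by (intro sum.neutral) auto
  also have "(\<lambda>i. if k < i + Suc k then cy be T (i + Suc k) * ennreal (connector al be T m (i + Suc k)) else 0) =
     (\<lambda>i. ennreal (1 / (real (Suc (i + k)) - be - T) * connector al be T m (Suc (i + k))))"
  proof
    fix i
    have "cy be T (i + Suc k) = ennreal (1 / (real (Suc (i + k)) - be - T))" by (simp add: cy_def)
    moreover have "ennreal a * ennreal (connector al be T m (i + Suc k)) = ennreal (a * connector al be T m (i + Suc k))" for a
      using connector_pos by (intro ennreal_mult''[symmetric] less_imp_le)
    ultimately show "(if k < i + Suc k then cy be T (i + Suc k) * ennreal (connector al be T m (i + Suc k)) else 0) =
       ennreal (1 / (real (Suc (i + k)) - be - T) * connector al be T m (Suc (i + k)))" by simp
  qed
  also have "suminf \<dots> = ennreal (connector al be T m k / (real m - al))"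
    using be T connector_pos by (intro suminf_ennreal_eq s) (auto intro!: mult_nonneg_nonneg less_imp_le)
  also have "\<dots> = cx al m * ennreal (connector al be T m k)"
    using m u connector_pos[of m k] by (simp add: cx_def ennreal_mult'[symmetric])
  finally show ?thesis by simp
qed

text \<open>Exchanging the sums over \<open>n\<close> and \<open>k < n\<close> brings the inner sum
  into the form of \<open>connector_tail\<close>. The index \<open>m = 0\<close>, excluded there,
  contributes nothing for nonempty \<open>r\<close>.\<close>

lemma connected_sum_LX:
  assumes r: "r \<noteq> []"
  shows "connected_sum al be T (LX # r) s = connected_sum al be T r (LY # s)"
proof -
  have "connected_sum al be T r (LY # s) = suminf (\<lambda>m. nested_sum al T r m *
      suminf (\<lambda>n. (\<Sum>k<n. nested_sum be T s k) * (cy be T n * ennreal (connector al be T m n))))"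
    unfolding connected_sum_def by (simp add: mult_ac flip: ennreal_suminf_cmult)
  also have "\<dots> = suminf (\<lambda>m. nested_sum al T r m * suminf (\<lambda>k. nested_sum be T s k * (cx al m * ennreal (connector al be T m k))))"
  proof (intro arg_cong[where f = suminf] ext)
    fix m
    show "nested_sum al T r m * suminf (\<lambda>n. (\<Sum>k<n. nested_sum be T s k) * (cy be T n * ennreal (connector al be T m n))) =
      nested_sum al T r m * suminf (\<lambda>k. nested_sum be T s k * (cx al m * ennreal (connector al be T m k)))"
    proof (cases "m = 0")
      case True
      then show ?thesis using r by (simp add: nested_sum_at_0)
    next
      case False
      have "suminf (\<lambda>n. (\<Sum>k<n. nested_sum be T s k) * (cy be T n * ennreal (connector al be T m n))) =
        suminf (\<lambda>n. suminf (\<lambda>k. nested_sum be T s k * (if k < n then cy be T n * ennreal (connector al be T m n) else 0)))"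
      proof (intro arg_cong[where f = suminf] ext)
        fix n
        have "suminf (\<lambda>k. nested_sum be T s k * (if k < n then cy be T n * ennreal (connector al be T m n) else 0)) =
          (\<Sum>k<n. nested_sum be T s k * (if k < n then cy be T n * ennreal (connector al be T m n) else 0))"
          by (rule suminf_finite) auto
        then show "(\<Sum>k<n. nested_sum be T s k) * (cy be T n * ennreal (connector al be T m n)) =
          suminf (\<lambda>k. nested_sum be T s k * (if k < n then cy be T n * ennreal (connector al be T m n) else 0))"
          by (simp add: sum_distrib_right)
      qed
      also have "\<dots> = suminf (\<lambda>k. suminf (\<lambda>n. nested_sum be T s k * (if k < n then cy be T n * ennreal (connector al be T m n) else 0)))"
        by (rule suminf_swap_ennreal)
      also have "\<dots> = suminf (\<lambda>k. nested_sum be T s k * (cx al m * ennreal (connector al be T m k)))"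
        using False by (simp add: connector_tail)
      finally show ?thesis by simp
    qed
  qed
  also have "\<dots> = connected_sum al be T (LX # r) s"
    unfolding connected_sum_def by (simp add: mult_ac flip: ennreal_suminf_cmult)
  finally show ?thesis ..
qed

end

text \<open>An \<open>x\<close> moves by \<open>connected_sum_LX\<close>, a \<open>y\<close> by the
  same rule read backwards with the two sides exchanged, which uses that the receiving side is
  nonempty. Since \<open>r\<close> ends in \<open>y\<close>, it is still nonempty after losing an
  \<open>x\<close>.\<close>

lemma connected_sum_transport:
  assumes al: "0 < al" "al < 1/8" and be: "0 < be" "be < 1/8" and T: "0 < T" "T < 1/8"
    and r: "r = [] \<or> last r = LY" and s: "s \<noteq> []"
  shows "connected_sum al be T r s = connected_sum al be T [] (rev (map swap_letter r) @ s)"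
  using r s
proof (induction r arbitrary: s)
  case (Cons c r)
  have "connected_sum al be T (c # r) s = connected_sum al be T r (swap_letter c # s)"
  proof (cases c)
    case LX
    then have "r \<noteq> []" using Cons.prems by auto
    then show ?thesis using connected_sum_LX[OF al be T] LX by simp
  next
    case LY
    have "connected_sum al be T (LY # r) s = connected_sum be al T s (LY # r)" by (rule connected_sum_commute)
    also have "\<dots> = connected_sum be al T (LX # s) r" using connected_sum_LX[OF be al T Cons.prems(2)] by simp
    also have "\<dots> = connected_sum al be T r (LX # s)" by (rule connected_sum_commute)
    finally show ?thesis using LY by simp
  qed
  also have "\<dots> = connected_sum al be T [] (rev (map swap_letter r) @ swap_letter c # s)"
    using Cons.prems by (intro Cons.IH) (auto split: if_splits)
  finally show ?case by simp
qed simp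

text \<open>The first \<open>x\<close> may move to an empty right side and makes it nonempty; the
  other letters follow by transport, and exchanging the two sides exchanges \<open>al\<close> and
  \<open>be\<close>.\<close>

lemma connected_sum_duality:
  assumes al: "0 < al" "al < 1/8" and be: "0 < be" "be < 1/8" and T: "0 < T" "T < 1/8"
    and r: "r \<noteq> []" "last r = LY"
  shows "connected_sum al be T (LX # r) [] = connected_sum be al T (rev (map swap_letter (LX # r))) []"
proof -
  have "connected_sum al be T (LX # r) [] = connected_sum al be T r [LY]" by (rule connected_sum_LX[OF al be T r(1)])
  also have "\<dots> = connected_sum al be T [] (rev (map swap_letter r) @ [LY])"
    using r by (intro connected_sum_transport[OF al be T]) auto
  also have "\<dots> = connected_sum be al T (rev (map swap_letter r) @ [LY]) []" by (rule connected_sum_commute)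
  finally show ?thesis by simp
qed

section \<open>Duality for admissible words\<close>

lemma has_sum_suminf_ennreal:
  assumes x: "\<And>n. x n \<ge> 0" and fin: "suminf (\<lambda>n. ennreal (x n)) < top"
  shows "(x has_sum enn2real (suminf (\<lambda>n. ennreal (x n)))) UNIV"
proof -
  have "summable x" using x fin by (intro summable_suminf_not_top) auto
  then have "x sums suminf x" "suminf (\<lambda>n. ennreal (x n)) = ennreal (suminf x)" "suminf x \<ge> 0"
    using x by (auto intro: summable_sums suminf_ennreal2 suminf_nonneg)
  then show ?thesis using x by (simp add: sums_nonneg_imp_has_sum)
qed

lemma has_sum_suminf_ennreal_pair:
  assumes x: "\<And>b p. x b p \<ge> 0" and E: "\<And>b. E b < top \<Longrightarrow> (x b has_sum enn2real (E b)) UNIV"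
    and fin: "suminf E < (top::ennreal)"
  shows "((\<lambda>(b, p). x b p) has_sum enn2real (suminf E)) UNIV"
proof -
  have top: "E b < top" for b using ennreal_suminf_lessD[OF fin] .
  then have eq: "(\<lambda>b. ennreal (enn2real (E b))) = E" by auto
  have g: "((\<lambda>b. enn2real (E b)) has_sum enn2real (suminf E)) UNIV"
    using has_sum_suminf_ennreal[of "\<lambda>b. enn2real (E b)"] fin by (simp add: eq)
  have "((\<lambda>(b, p). x b p) has_sum enn2real (suminf E)) (Sigma UNIV (\<lambda>_. UNIV))"
    by (intro has_sum_SigmaI[OF _ g] summable_on_SigmaI[where g = "\<lambda>b. enn2real (E b)"])
       (use E top x g in \<open>auto simp: summable_on_def\<close>)
  then show ?thesis by simp
qed

lemma has_sum_suminf_ennreal3: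
  assumes x: "\<And>b a n. x b a n \<ge> 0" and fin: "suminf (\<lambda>b. suminf (\<lambda>a. suminf (\<lambda>n. ennreal (x b a n)))) < top"
  shows "((\<lambda>(b, a, n). x b a n) has_sum enn2real (suminf (\<lambda>b. suminf (\<lambda>a. suminf (\<lambda>n. ennreal (x b a n)))))) UNIV"
proof -
  have "((\<lambda>(a, n). x b a n) has_sum enn2real (suminf (\<lambda>a. suminf (\<lambda>n. ennreal (x b a n))))) UNIV"
    if "suminf (\<lambda>a. suminf (\<lambda>n. ennreal (x b a n))) < top" for b
    by (rule has_sum_suminf_ennreal_pair[OF x _ that]) (rule has_sum_suminf_ennreal[OF x])
  then show ?thesis
    by (intro has_sum_suminf_ennreal_pair[where x = "\<lambda>b (a, n). x b a n"] fin) (use x in auto)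
qed

text \<open>On the cone T > 0 > A, B the sign pattern makes all terms nonnegative, so finiteness in
  \<open>ennreal\<close> is absolute convergence; the values there also dominate the series on the
  whole polydisc.\<close>

lemma represents_nonnegI:
  fixes c :: "real fps fps fps"
  assumes sgn: "\<And>b a n. (- 1) ^ (a + b) * fps_nth (fps_nth (fps_nth c b) a) n \<ge> 0"
  defines "S \<equiv> \<lambda>al be T. suminf (\<lambda>b. suminf (\<lambda>a. suminf (\<lambda>n.
      ennreal (be ^ b) * ennreal (al ^ a) * ennreal (T ^ n) * ennreal ((- 1) ^ (a + b) * fps_nth (fps_nth (fps_nth c b) a) n))))"
  assumes fin: "\<And>al be T. 0 < al \<Longrightarrow> al < 1/8 \<Longrightarrow> 0 < be \<Longrightarrow> be < 1/8 \<Longrightarrow> 0 < T \<Longrightarrow> T < 1/8 \<Longrightarrow> S al be T < top"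
  obtains f where "represents c f"
    "\<forall>al be T. 0 < al \<longrightarrow> al < 1/8 \<longrightarrow> 0 < be \<longrightarrow> be < 1/8 \<longrightarrow> 0 < T \<longrightarrow> T < 1/8 \<longrightarrow>
       f T (- al) (- be) = enn2real (S al be T)"
proof -
  let ?c = "\<lambda>k j i. fps_nth (fps_nth (fps_nth c k) j) i"
  let ?x = "\<lambda>al be T b a n. be ^ b * al ^ a * T ^ n * ((- 1) ^ (a + b) * ?c b a n)"
  have hs: "((\<lambda>(b, a, n). ?x al be T b a n) has_sum enn2real (S al be T)) UNIV"
    if "0 < al" "al < 1/8" "0 < be" "be < 1/8" "0 < T" "T < 1/8" for al be T
  proof -
    have nn: "?x al be T b a n \<ge> 0" for b a n
      by (rule mult_nonneg_nonneg[OF _ sgn]) (use that in auto)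
    have "ennreal (?x al be T b a n) = ennreal (be ^ b) * ennreal (al ^ a) * ennreal (T ^ n) * ennreal ((- 1) ^ (a + b) * ?c b a n)" for b a n
      using that sgn[of a b n] by (subst ennreal_mult[symmetric], simp, simp)+ simp
    then have eq: "S al be T = suminf (\<lambda>b. suminf (\<lambda>a. suminf (\<lambda>n. ennreal (?x al be T b a n))))"
      unfolding S_def by (simp only:)
    show ?thesis unfolding eq
      by (rule has_sum_suminf_ennreal3[where x = "?x al be T"]) (use nn fin[OF that] in \<open>simp_all only: eq\<close>)
  qed
  define f where "f T A B = infsum (\<lambda>(k, j, i). ?c k j i * T ^ i * A ^ j * B ^ k) UNIV" for T A B
  have "represents c f"
    unfolding represents_def
  proof (intro allI impI)
    fix T A B :: real assume small: "\<bar>T\<bar> < 1/8" "\<bar>A\<bar> < 1/8" "\<bar>B\<bar> < 1/8"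
    \<comment> \<open>Finiteness is given for strictly positive arguments; the maximum with 1/16
      moves vanishing coordinates into that range.\<close>
    let ?m = "\<lambda>x::real. max \<bar>x\<bar> (1/16)"
    have "(\<lambda>p. norm (case p of (k, j, i) \<Rightarrow> ?c k j i * T ^ i * A ^ j * B ^ k)) summable_on UNIV"
    proof (rule summable_on_comparison_test)
      show "(\<lambda>(b, a, n). ?x (?m A) (?m B) (?m T) b a n) summable_on UNIV"
        by (rule has_sum_imp_summable[OF hs]) (use small in auto)
      fix p :: "nat \<times> nat \<times> nat"
      obtain k j i where p: "p = (k, j, i)" by (metis prod_cases3)
      have sg: "\<bar>?c k j i\<bar> = (- 1) ^ (j + k) * ?c k j i"
        using abs_of_nonneg[OF sgn[of j k i]] by (simp add: abs_mult power_abs)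
      have "norm (case p of (k, j, i) \<Rightarrow> ?c k j i * T ^ i * A ^ j * B ^ k) = \<bar>B\<bar> ^ k * \<bar>A\<bar> ^ j * \<bar>T\<bar> ^ i * \<bar>?c k j i\<bar>"
        by (simp add: p abs_mult power_abs mult_ac)
      also have "\<bar>B\<bar> ^ k * \<bar>A\<bar> ^ j * \<bar>T\<bar> ^ i * \<bar>?c k j i\<bar> \<le> ?m B ^ k * ?m A ^ j * ?m T ^ i * \<bar>?c k j i\<bar>"
      proof -
        have "\<bar>x\<bar> ^ n \<le> ?m x ^ n" "0 \<le> ?m x ^ n" for x :: real and n
          by (auto intro!: power_mono zero_le_power)
        then show ?thesis by (intro mult_mono mult_nonneg_nonneg) simp_all
      qed
      also have "\<dots> = (case p of (b, a, n) \<Rightarrow> ?x (?m A) (?m B) (?m T) b a n)"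
        unfolding sg by (simp add: p)
      finally show "norm (case p of (k, j, i) \<Rightarrow> ?c k j i * T ^ i * A ^ j * B ^ k) \<le> (case p of (b, a, n) \<Rightarrow> ?x (?m A) (?m B) (?m T) b a n)" .
    qed auto
    then have "(\<lambda>(k, j, i). ?c k j i * T ^ i * A ^ j * B ^ k) summable_on UNIV" by (rule abs_summable_summable)
    then show "((\<lambda>(k, j, i). ?c k j i * T ^ i * A ^ j * B ^ k) has_sum f T A B) UNIV"
      unfolding f_def by (rule has_sum_infsum)
  qed
  moreover have "f T (- al) (- be) = enn2real (S al be T)"
    if "0 < al" "al < 1/8" "0 < be" "be < 1/8" "0 < T" "T < 1/8" for al be T
  proof -
    have "(\<lambda>(k, j, i). ?c k j i * T ^ i * (- al) ^ j * (- be) ^ k) = (\<lambda>(b, a, n). ?x al be T b a n)"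
      by (auto simp: fun_eq_iff power_minus[of al] power_minus[of be] power_add)
    then show ?thesis unfolding f_def using infsumI[OF hs[OF that]] by simp
  qed
  ultimately show ?thesis using that by blast
qed

lemma represents_diff:
  assumes "represents c f" "represents d g" shows "represents (c - d) (\<lambda>T A B. f T A B - g T A B)"
  unfolding represents_def
proof (intro allI impI)
  fix T A B :: real assume small: "\<bar>T\<bar> < 1/8" "\<bar>A\<bar> < 1/8" "\<bar>B\<bar> < 1/8"
  show "((\<lambda>(k, j, i). fps_nth (fps_nth (fps_nth (c - d) k) j) i * T ^ i * A ^ j * B ^ k) has_sum f T A B - g T A B) UNIV"
    using has_sum_add[OF trepD[OF assms(1) small] has_sum_cmult_right[OF trepD[OF assms(2) small], of "- 1"]]
    by (simp add: case_prod_unfold algebra_simps)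
qed

lemma represents_T: "represents (fps_const (fps_const fps_X)) (\<lambda>T A B. T)"
  unfolding represents_def
proof (intro allI impI)
  fix T A B :: real
  have "((\<lambda>(k, j, i). fps_nth (fps_nth (fps_nth (fps_const (fps_const fps_X)) k) j) i * T ^ i * A ^ j * B ^ k) has_sum T) {(0, 0, 1)}"
    by (rule has_sum_finiteI) auto
  also have "?this \<longleftrightarrow> ((\<lambda>(k, j, i). fps_nth (fps_nth (fps_nth (fps_const (fps_const fps_X)) k) j) i * T ^ i * A ^ j * B ^ k) has_sum T) UNIV"
    by (rule has_sum_cong_neutral) (auto simp: fps_const_def fps_X_def split: if_splits)
  finally show "((\<lambda>(k, j, i). fps_nth (fps_nth (fps_nth (fps_const (fps_const fps_X)) k) j) i * T ^ i * A ^ j * B ^ k) has_sum T) UNIV" .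
qed

section \<open>The series attached to an element of the algebra\<close>

definition Z_series :: "ncpoly \<Rightarrow> real fps fps fps" where
  "Z_series w = coeffwise (coeffwise (coeffwise Z_sh \<circ> \<sigma>)) (sandwich w)"

lemma Z_series_nth: "fps_nth (fps_nth (fps_nth (Z_series w) b) a) n = ev reg_zeta (fps_nth (\<sigma> (lx ^ a * w * ly ^ b)) n)"
  by (simp add: Z_series_def coeffwise_def sandwich_nth Z_sh_eq)

lemma tau_power: "\<tau> (p ^ n) = \<tau> p ^ n"
  by (induction n) (simp_all add: tau_antihom power_commutes)

text \<open>As an anti-automorphism exchanging the letters, tau sends \<open>x^a w y^b\<close> to
  \<open>x^b (\<tau> w) y^a\<close>, so applying it inside amounts to exchanging \<open>A\<close>
  and \<open>B\<close> in the series of \<open>\<tau> w\<close>.\<close>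

lemma coeffwise_tau_eq:
  "coeffwise (coeffwise (coeffwise Z_sh \<circ> \<sigma> \<circ> \<tau>)) (sandwich w) = swapAB (Z_series (\<tau> w))"
  by (rule fps3_eqI)
     (simp add: swapAB_def Z_series_nth coeffwise_def sandwich_nth Z_sh_eq tau_antihom tau_power mult.assoc)

lemma word_poly_append: "word_poly (u @ v) = word_poly u * word_poly v"
  by (simp add: mult_single plus_word_def)

lemma word_poly_Nil: "word_poly [] = 1"
  by (simp flip: zero_word_def)

lemma lx_power: "lx ^ a = word_poly (replicate a LX)"
  by (induction a) (simp_all add: word_poly_Nil mult_single plus_word_def)

lemma sigma_power: "\<sigma> (p ^ n) = \<sigma> p ^ n"
  by (induction n) (simp_all add: sigma_hom)

lemma sigma_lx_power: "\<sigma> (lx ^ n) = fps_const (lx ^ n)"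
  by (simp add: sigma_power sigma_hom fps_const_power)

text \<open>The coefficient of \<open>B^b\<close> in 1/(1 - xT - yB), as a series in
  \<open>T\<close>: the shuffle of \<open>x^n\<close> and \<open>y^b\<close> contains each word with
  these letters exactly once.\<close>

definition HH :: "nat \<Rightarrow> ncpoly fps" where
  "HH b = Abs_fps (\<lambda>n. shuffle_words (replicate n LX) (replicate b LY))"

lemma geom_inverse_right:
  fixes p :: "'a::ring_1"
  shows "geom p * (1 - fps_const p * fps_X) = 1"
  by (rule fps_ext)
    (auto simp: geom_def right_diff_distrib power_commutes mult.assoc[symmetric] split: nat.splits
       simp flip: power_Suc power_Suc2)

lemma HH_0: "HH 0 = geom lx"
proof (rule fps_ext)
  fix n
  show "fps_nth (HH 0) n = fps_nth (geom lx) n"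
    by (cases n) (simp_all add: HH_def geom_def lx_power)
qed

text \<open>A word counted by \<open>HH (Suc b)\<close> starts either with \<open>x\<close>, which
  accounts for one \<open>T\<close>, or with \<open>y\<close>, followed by a word counted by
  \<open>HH b\<close>.\<close>

lemma HH_Suc: "(1 - fps_const lx * fps_X) * HH (Suc b) = fps_const ly * HH b"
proof (rule fps_ext)
  fix n
  show "fps_nth ((1 - fps_const lx * fps_X) * HH (Suc b)) n = fps_nth (fps_const ly * HH b) n"
    by (cases n) (simp_all add: HH_def left_diff_distrib mult.assoc mult_single plus_word_def)
qed

text \<open>This is \<open>\<sigma> (1/(1 - yB)) = (1 - xT) \<cdot> 1/(1 - xT - yB)\<close>, coefficient by coefficient in \<open>B\<close>.\<close>

lemma sigma_ly_power: "\<sigma> (ly ^ b) = (1 - fps_const lx * fps_X) * HH b"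
proof (induction b)
  case 0
  show ?case by (simp add: sigma_hom HH_0 geom_inverse)
next
  case (Suc b)
  have "\<sigma> (ly ^ Suc b) = fps_const ly * (geom lx * (1 - fps_const lx * fps_X)) * HH b"
    by (simp add: sigma_hom Suc mult.assoc)
  then show ?case by (simp only: geom_inverse_right mult_1_right HH_Suc)
qed

lemma ev_sigma_word: "ev \<phi> (fps_nth (\<sigma> (word_poly (rev r))) i) = sigma_sum (\<lambda>u. \<phi> (rev u)) r i"
proof (induction r arbitrary: \<phi> i)
  case Nil
  have "ev \<phi> 1 = \<phi> []" using ev_single[of \<phi> "Word []" 1] by (simp add: word_poly_Nil)
  then show ?case by (simp add: word_poly_Nil sigma_hom)
next
  case (Cons c r)
  have *: "\<sigma> (word_poly (rev (c # r))) = \<sigma> (word_poly (rev r)) * sigma_letter c"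
    by (cases c) (simp_all only: rev.simps word_poly_append sigma_hom sigma_letter.simps)
  show ?case
  proof (cases c)
    case LX
    then show ?thesis using * by (simp add: ev_mult Cons)
  next
    case LY
    have "fps_nth (\<sigma> (word_poly (rev r)) * (fps_const ly * geom lx)) i =
      (\<Sum>j\<le>i. fps_nth (\<sigma> (word_poly (rev r))) j * (ly * lx ^ (i - j)))"
      by (subst fps_mult_nth) (simp add: geom_def atLeast0AtMost)
    then show ?thesis using * LY by (simp add: ev_sum ev_mult lx_power Cons)
  qed
qed

definition qc :: "nat \<Rightarrow> nat \<Rightarrow> nat \<Rightarrow> real" where
  "qc a b n = shuffle_sum (\<lambda>h. reg_zeta (replicate a LX @ h)) (replicate n LX) (replicate b LY)"

lemma fps_X_left_commute: "f * (fps_X * g) = fps_X * (f * (g :: 'a::semiring_1 fps))"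
  by (metis fps_mult_fps_X_commute mult.assoc)

text \<open>The subtracted term comes from the \<open>xT\<close> in \<open>sigma_ly_power\<close>:
  its \<open>x\<close> joins the prefix \<open>x^a\<close>, its \<open>T\<close> lowers
  \<open>n\<close>.\<close>

lemma Z_series_one_nth:
  "fps_nth (fps_nth (fps_nth (Z_series 1) b) a) n = qc a b n - (if n = 0 then 0 else qc (Suc a) b (n - 1))"
proof -
  have "\<sigma> (lx ^ a * 1 * ly ^ b) = fps_const (lx ^ a) * HH b - fps_X * (fps_const (lx ^ Suc a) * HH b)"
  proof -
    have c: "fps_const (lx ^ Suc a) = fps_const (lx ^ a) * fps_const lx" by (simp add: power_commutes)
    show ?thesis unfolding c
      by (simp add: sigma_hom sigma_lx_power sigma_ly_power algebra_simps
          fps_X_left_commute fps_mult_fps_X_commute[symmetric] del: fps_const_mult)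
  qed
  then show ?thesis
    unfolding Z_series_nth by (simp add: ev_diff ev_mult lx_power HH_def ev_shuffle_words qc_def del: power_Suc)
qed

text \<open>The factor \<open>1 - xT\<close> of \<open>sigma_ly_power\<close> yields the word itself
  and, shifted in \<open>T\<close>, the word with one more final \<open>x\<close>; in both the last
  \<open>x\<close> is the cut.\<close>

lemma Z_series_word_nth:
  "fps_nth (fps_nth (fps_nth (Z_series (word_poly (rev (LX # r)))) b) a) n =
     tail_coeff r a b n - (if n = 0 then 0 else tail_coeff (LX # r) a b (n - 1))"
proof -
  let ?G = "\<lambda>r. fps_const (lx ^ a) * \<sigma> (word_poly (rev r)) * fps_const lx * HH b"
  have G: "ev reg_zeta (fps_nth (?G r) n) = tail_coeff r a b n" for r n
  proof -
    have "ev reg_zeta (fps_nth (?G r) n) = (\<Sum>i=0..n. ev reg_zeta (lx ^ a * fps_nth (\<sigma> (word_poly (rev r))) i * lx *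
        shuffle_words (replicate (n - i) LX) (replicate b LY)))"
      by (subst fps_mult_nth) (simp add: ev_sum HH_def)
    also have "\<dots> = tail_coeff r a b n"
      unfolding tail_coeff_def atLeast0AtMost
      by (intro sum.cong refl) (simp add: ev_mult ev_shuffle_words lx_power ev_sigma_word)
    finally show ?thesis .
  qed
  have "\<sigma> (lx ^ a * word_poly (rev (LX # r)) * ly ^ b) = ?G r - fps_X * ?G (LX # r)"
    by (simp add: word_poly_append sigma_hom sigma_lx_power sigma_ly_power algebra_simps
        fps_X_left_commute fps_mult_fps_X_commute[symmetric] del: fps_const_mult)
  then show ?thesis
    unfolding Z_series_nth using G[of "LX # r"] by (simp add: ev_diff G)
qed

definition tail_series :: "letter list \<Rightarrow> real fps fps fps" where
  "tail_series r = Abs_fps (\<lambda>b. Abs_fps (\<lambda>a. Abs_fps (tail_coeff r a b)))"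

lemma Z_series_word: "Z_series (word_poly (rev (LX # r))) = tail_series r - fps_const (fps_const fps_X) * tail_series (LX # r)"
proof (rule fps3_eqI)
  fix k j i
  show "fps_nth (fps_nth (fps_nth (Z_series (word_poly (rev (LX # r)))) k) j) i =
    fps_nth (fps_nth (fps_nth (tail_series r - fps_const (fps_const fps_X) * tail_series (LX # r)) k) j) i"
    unfolding Z_series_word_nth by (simp add: tail_series_def)
qed

lemma Gamma_pos_plus1: "x > 0 \<Longrightarrow> Gamma (x + 1) = x * Gamma (x::real)"
  by (rule Gamma_plus1) (use nonpos_Ints_nonpos in fastforce)

lemma represents_tail_series:
  assumes r: "r \<noteq> []" "last r = LY"
  obtains f where "represents (tail_series r) f"
    "\<forall>al be T. 0 < al \<longrightarrow> al < 1/8 \<longrightarrow> 0 < be \<longrightarrow> be < 1/8 \<longrightarrow> 0 < T \<longrightarrow> T < 1/8 \<longrightarrow>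
       f T (- al) (- be) = enn2real (suminf (\<lambda>m. nested_sum al T r m * ennreal (Beta (real m - al - T) (1 - be))))"
proof -
  have nth: "fps_nth (fps_nth (fps_nth (tail_series r) b) a) n = tail_coeff r a b n" for a b n by (simp add: tail_series_def)
  have sgn: "(- 1) ^ (a + b) * fps_nth (fps_nth (fps_nth (tail_series r) b) a) n \<ge> 0" for a b n
    unfolding nth using r by (intro tail_coeff_integral(2)) auto
  obtain f where f: "represents (tail_series r) f"
    "\<forall>al be T. 0 < al \<longrightarrow> al < 1/8 \<longrightarrow> 0 < be \<longrightarrow> be < 1/8 \<longrightarrow> 0 < T \<longrightarrow> T < 1/8 \<longrightarrow>
       f T (- al) (- be) = enn2real (suminf (\<lambda>b. suminf (\<lambda>a. suminf (\<lambda>n.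
      ennreal (be ^ b) * ennreal (al ^ a) * ennreal (T ^ n) * ennreal ((- 1) ^ (a + b) * fps_nth (fps_nth (fps_nth (tail_series r) b) a) n)))))"
    by (rule represents_nonnegI[OF sgn]) (use generating_sum[OF _ _ _ _ _ _ r] in \<open>simp_all add: nth\<close>)
  show ?thesis
    by (rule that[OF f(1)]) (use f(2) generating_sum(1)[OF _ _ _ _ _ _ r] in \<open>simp add: nth\<close>)
qed

text \<open>With \<open>z = m - al - T\<close>, the difference of the tail series has terms
  \<open>nested_sum al T (LX # r) m\<close> times \<open>z * Beta z (1 - be)\<close>. This last
  product is the connector at \<open>n = 0\<close> up to the ratio
  \<open>Gamma (1 - be) / Gamma (1 - be - T)\<close>.\<close>

lemma represents_Z_series_word:
  assumes r: "r \<noteq> []" "last r = LY"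
  obtains f where "represents (Z_series (word_poly (rev (LX # r)))) f"
    "\<forall>al be T. 0 < al \<longrightarrow> al < 1/8 \<longrightarrow> 0 < be \<longrightarrow> be < 1/8 \<longrightarrow> 0 < T \<longrightarrow> T < 1/8 \<longrightarrow>
       f T (- al) (- be) = Gamma (1 - be) / Gamma (1 - be - T) * enn2real (connected_sum al be T (LX # r) [])"
proof -
  obtain f1 where f1: "represents (tail_series r) f1"
    "\<forall>al be T. 0 < al \<longrightarrow> al < 1/8 \<longrightarrow> 0 < be \<longrightarrow> be < 1/8 \<longrightarrow> 0 < T \<longrightarrow> T < 1/8 \<longrightarrow>
       f1 T (- al) (- be) = enn2real (suminf (\<lambda>m. nested_sum al T r m * ennreal (Beta (real m - al - T) (1 - be))))"
    by (rule represents_tail_series[OF r])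
  have r': "LX # r \<noteq> []" "last (LX # r) = LY" using r by auto
  obtain f2 where f2: "represents (tail_series (LX # r)) f2"
    "\<forall>al be T. 0 < al \<longrightarrow> al < 1/8 \<longrightarrow> 0 < be \<longrightarrow> be < 1/8 \<longrightarrow> 0 < T \<longrightarrow> T < 1/8 \<longrightarrow>
       f2 T (- al) (- be) = enn2real (suminf (\<lambda>m. nested_sum al T (LX # r) m * ennreal (Beta (real m - al - T) (1 - be))))"
    by (rule represents_tail_series[OF r'])
  have rep: "represents (Z_series (word_poly (rev (LX # r)))) (\<lambda>T A B. f1 T A B - T * f2 T A B)"
    unfolding Z_series_word by (intro represents_diff represents_mult represents_T f1(1) f2(1))
  have "f1 T (- al) (- be) - T * f2 T (- al) (- be) = Gamma (1 - be) / Gamma (1 - be - T) * enn2real (connected_sum al be T (LX # r) [])"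
    if c: "0 < al" "al < 1/8" "0 < be" "be < 1/8" "0 < T" "T < 1/8" for al be T
  proof -
    let ?B = "\<lambda>m. Beta (real m - al - T) (1 - be)"
    let ?S = "\<lambda>r. suminf (\<lambda>m. nested_sum al T r m * ennreal (?B m))"
    let ?g = "Gamma (1 - be) / Gamma (1 - be - T)"
    have g: "?g > 0" using c by (intro divide_pos_pos Gamma_real_pos) auto
    have fin: "?S r < top" "?S (LX # r) < top"
      using generating_sum(2)[OF c r] generating_sum(2)[OF c r'] by auto
    \<comment> \<open>The difference is stated as a sum to stay within \<open>ennreal\<close>;
      finiteness of all parts then allows the passage to real numbers.\<close>
    have "?S r = suminf (\<lambda>m. ennreal T * (nested_sum al T (LX # r) m * ennreal (?B m)) + ennreal ?g * (nested_sum al T (LX # r) m * ennreal (connector al be T m 0)))"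
    proof (intro arg_cong[where f = suminf] ext)
      fix m
      show "nested_sum al T r m * ennreal (?B m) = ennreal T * (nested_sum al T (LX # r) m * ennreal (?B m)) + ennreal ?g * (nested_sum al T (LX # r) m * ennreal (connector al be T m 0))"
      proof (cases "m = 0")
        case True
        then show ?thesis using r by (simp add: nested_sum_at_0)
      next
        case False
        then have "real m \<ge> 1" by simp
        define z where "z = real m - al - T"
        have z: "z > 0" "real m - al = z + T" using \<open>real m \<ge> 1\<close> c by (auto simp: z_def)
        have B: "?B m > 0" unfolding Beta_def z_def[symmetric] using z c
          by (intro divide_pos_pos mult_pos_pos Gamma_real_pos) auto
        have "Gamma (1 - be - T) > 0" using c by (intro Gamma_real_pos) auto
        then have G: "Gamma (1 - be - T) \<noteq> 0" by simp
        have e: "real m + 1 - al - T = z + 1" "real m + real 0 + 1 - al - be - T = z + (1 - be)" by (simp_all add: z_def)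
        have "connector al be T m 0 = Gamma (z + 1) * Gamma (1 - be - T) / Gamma (z + (1 - be))"
          by (simp only: connector_def e) simp
        then have C: "?g * connector al be T m 0 = z * ?B m"
          using G by (simp add: Gamma_pos_plus1[OF z(1)] Beta_def z_def[symmetric])
        have 1: "1 / (z + T) * (T * ?B m + ?g * connector al be T m 0) = ?B m"
          unfolding C using z c by (simp add: field_simps)
        have "ennreal T * (nested_sum al T (LX # r) m * ennreal (?B m)) + ennreal ?g * (nested_sum al T (LX # r) m * ennreal (connector al be T m 0)) =
          nested_sum al T r m * (cx al m * (ennreal T * ennreal (?B m) + ennreal ?g * ennreal (connector al be T m 0)))"
          by (simp add: distrib_left mult_ac)
        also have "cx al m * (ennreal T * ennreal (?B m) + ennreal ?g * ennreal (connector al be T m 0)) =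
          ennreal (1 / (z + T) * (T * ?B m + ?g * connector al be T m 0))"
        proof -
          have cxm: "cx al m = ennreal (1 / (z + T))" using False by (simp add: cx_def z(2))
          have gen: "ennreal x * (ennreal a * ennreal b + ennreal d * ennreal e) = ennreal (x * (a * b + d * e))"
            if "0 \<le> x" "0 \<le> a" "0 \<le> b" "0 \<le> d" "0 \<le> e" for x a b d e
            using that by (simp add: ennreal_mult)
          show ?thesis unfolding cxm
            by (rule gen[OF _ less_imp_le[OF c(5)] less_imp_le[OF B] less_imp_le[OF g] less_imp_le[OF connector_pos[OF c]]])
               (use z(1) c(5) in simp)
        qed
        finally show ?thesis unfolding 1 by simp
      qed
    qed
    also have "\<dots> = ennreal T * ?S (LX # r) + ennreal ?g * connected_sum al be T (LX # r) []"
    proof -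
      have "connected_sum al be T (LX # r) [] = suminf (\<lambda>m. nested_sum al T (LX # r) m * ennreal (connector al be T m 0))"
        unfolding connected_sum_def
        by (intro arg_cong[where f = suminf] ext, subst suminf_single_ennreal[of 0]) auto
      then show ?thesis by (simp only: suminf_add[symmetric] summableI ennreal_suminf_cmult)
    qed
    finally have eq: "?S r = ennreal T * ?S (LX # r) + ennreal ?g * connected_sum al be T (LX # r) []" .
    have 2: "ennreal T * ?S (LX # r) < top" using fin by (simp add: ennreal_mult_less_top)
    have "ennreal ?g * connected_sum al be T (LX # r) [] \<le> ?S r" unfolding eq by (rule add_increasing) auto
    then have 3: "ennreal ?g * connected_sum al be T (LX # r) [] < top" using fin(1) by (rule le_less_trans)
    have "enn2real (?S r) = T * enn2real (?S (LX # r)) + ?g * enn2real (connected_sum al be T (LX # r) [])"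
      unfolding eq using 2 3 c g by (simp add: enn2real_plus enn2real_mult)
    then show ?thesis unfolding f1(2)[rule_format, OF c] f2(2)[rule_format, OF c] by simp
  qed
  then show ?thesis by (intro that[OF rep]) auto
qed

lemma tau_word: "\<tau> (word_poly u) = word_poly (rev (map swap_letter u))"
  by (simp add: \<tau>_def)

text \<open>Duality equates the two connected sums, so the series differ by the ratio of their Gamma
  prefactors at exchanged arguments, which is \<open>gamma_quotient\<close>.\<close>

lemma duality_word:
  assumes r: "r \<noteq> []" "last r = LY"
  shows "swapAB (Z_series (\<tau> (word_poly (rev (LX # r))))) = Z_series (word_poly (rev (LX # r))) * taylor_TAB gamma_quotient"
proof -
  \<comment> \<open>\<open>r\<close> ends in \<open>y\<close>, so the reversed dual word starts with
    \<open>x\<close> again; \<open>q\<close> is what follows this \<open>x\<close>.\<close>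
  define q where "q = tl (rev (map swap_letter r)) @ [LY]"
  have m: "LX # tl (rev (map swap_letter r)) = rev (map swap_letter r)"
    using r by (cases r rule: rev_cases) auto
  have "LX # q = (LX # tl (rev (map swap_letter r))) @ [LY]" by (simp add: q_def)
  also have "\<dots> = rev (map swap_letter (LX # r))" unfolding m by simp
  finally have q: "LX # q = rev (map swap_letter (LX # r))" .
  have q': "q \<noteq> []" "last q = LY" by (auto simp: q_def)
  have tau: "\<tau> (word_poly (rev (LX # r))) = word_poly (rev (LX # q))"
    unfolding q tau_word by (simp add: rev_map)
  obtain f where f: "represents (Z_series (word_poly (rev (LX # r)))) f"
    "\<forall>al be T. 0 < al \<longrightarrow> al < 1/8 \<longrightarrow> 0 < be \<longrightarrow> be < 1/8 \<longrightarrow> 0 < T \<longrightarrow> T < 1/8 \<longrightarrow>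
       f T (- al) (- be) = Gamma (1 - be) / Gamma (1 - be - T) * enn2real (connected_sum al be T (LX # r) [])"
    by (rule represents_Z_series_word[OF r])
  obtain g where g: "represents (Z_series (word_poly (rev (LX # q)))) g"
    "\<forall>al be T. 0 < al \<longrightarrow> al < 1/8 \<longrightarrow> 0 < be \<longrightarrow> be < 1/8 \<longrightarrow> 0 < T \<longrightarrow> T < 1/8 \<longrightarrow>
       g T (- al) (- be) = Gamma (1 - be) / Gamma (1 - be - T) * enn2real (connected_sum al be T (LX # q) [])"
    by (rule represents_Z_series_word[OF q'])
  show ?thesis unfolding tau
  proof (rule represents_unique[OF represents_swap[OF g(1)] represents_mult[OF f(1) represents_gamma_quotient]])
    fix T A B :: real
    assume T: "0 < T" "T < 1/8" and A: "- (1/8) < A" "A < 0" and B: "- (1/8) < B" "B < 0"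
    define al be where "al = - A" and "be = - B"
    have c: "0 < al" "al < 1/8" "0 < be" "be < 1/8" "A = - al" "B = - be" using A B by (auto simp: al_def be_def)
    have "Gamma (1 - be) > 0" "Gamma (1 - be - T) > 0"
      using c T by (auto intro!: Gamma_real_pos)
    then have nz: "Gamma (1 - be) \<noteq> 0" "Gamma (1 - be - T) \<noteq> 0" by auto
    have Z: "connected_sum be al T (LX # q) [] = connected_sum al be T (LX # r) []"
      unfolding q using connected_sum_duality[OF c(1-4) T r] by simp
    have gq: "gamma_quotient T A B = Gamma (1 - al) * Gamma (1 - be - T) / (Gamma (1 - be) * Gamma (1 - al - T))"
      by (simp add: gamma_quotient_def c(5,6) algebra_simps)
    have "a / d * z = b / e * z * (a * e / (b * d))" if "b \<noteq> 0" "e \<noteq> 0" for a b d e z :: real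
      using that by simp
    from this[OF nz, of "Gamma (1 - al)" "Gamma (1 - al - T)" "enn2real (connected_sum al be T (LX # r) [])"]
    show "g T B A = f T A B * gamma_quotient T A B"
      unfolding gq unfolding c(5,6) f(2)[rule_format, OF c(1-4) T] g(2)[rule_format, OF c(3,4,1,2) T] Z .
  qed
qed

section \<open>Duality for the empty word\<close>

text \<open>By \<open>Jc_integral\<close>, for \<open>k > 0\<close> the integral of
  \<open>(- ln t)^l / l! (- ln (1 - t))^k / k!\<close> against dt/t; the second logarithm makes it
  converge at 0.\<close>

definition Jc :: "nat \<Rightarrow> nat \<Rightarrow> real" where
  "Jc l k = (- 1) ^ k * tail_coeff [] 0 k l"

lemma tail_coeff_Nil: "tail_coeff [] a b n = qc (Suc a) b n"
proof -
  have "tail_coeff [] a b n = (\<Sum>i\<in>{0}. sigma_sum (\<lambda>u. shuffle_sum (\<lambda>h. reg_zeta ((replicate a LX @ rev u) @ LX # h))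
      (replicate (n - i) LX) (replicate b LY)) [] i)"
    unfolding tail_coeff_def by (rule sum.mono_neutral_right) auto
  then show ?thesis by (simp add: qc_def replicate_app_Cons_same)
qed

lemma tail_coeff_Nil_integral:
  assumes "b > 0"
  shows "ennreal ((- 1) ^ (a + b) * tail_coeff [] a b n) =
      (\<integral>\<^sup>+t\<in>{0<..<1}. ennreal ((- ln t) ^ a / fact a * ((- ln t) ^ n / fact n) * ((- ln (1 - t)) ^ b / fact b / t)) \<partial>lborel)"
    and "(- 1) ^ (a + b) * tail_coeff [] a b n \<ge> 0"
proof -
  show "(- 1) ^ (a + b) * tail_coeff [] a b n \<ge> 0" by (rule tail_coeff_integral(2)) (use assms in auto)
  have "ennreal ((- 1) ^ (a + b) * tail_coeff [] a b n) =
     (\<integral>\<^sup>+t\<in>{0<..<1}. (\<Sum>i\<le>n. sigma_sum (\<lambda>u. ennreal (Li_abs a u t)) [] i * ennreal ((- ln t) ^ (n - i) / fact (n - i))) *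
         ennreal ((- ln (1 - t)) ^ b / fact b / t) \<partial>lborel)"
    by (rule tail_coeff_integral(1)) (use assms in auto)
  also have "\<dots> = (\<integral>\<^sup>+t\<in>{0<..<1}. ennreal ((- ln t) ^ a / fact a * ((- ln t) ^ n / fact n) * ((- ln (1 - t)) ^ b / fact b / t)) \<partial>lborel)"
  proof (intro nn_integral_cong)
    fix t :: real
    show "(\<Sum>i\<le>n. sigma_sum (\<lambda>u. ennreal (Li_abs a u t)) [] i * ennreal ((- ln t) ^ (n - i) / fact (n - i))) *
         ennreal ((- ln (1 - t)) ^ b / fact b / t) * indicator {0<..<1} t =
       ennreal ((- ln t) ^ a / fact a * ((- ln t) ^ n / fact n) * ((- ln (1 - t)) ^ b / fact b / t)) * indicator {0<..<1} t"
    proof (cases "0 < t \<and> t < 1")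
      case True
      then have p: "0 \<le> (- ln t) ^ k / fact k" "0 \<le> (- ln (1 - t)) ^ b / fact b / t" for k
        by (auto intro!: divide_nonneg_pos zero_le_power)
      have "(\<Sum>i\<le>n. sigma_sum (\<lambda>u. ennreal (Li_abs a u t)) [] i * ennreal ((- ln t) ^ (n - i) / fact (n - i))) =
        (\<Sum>i\<in>{0}. sigma_sum (\<lambda>u. ennreal (Li_abs a u t)) [] i * ennreal ((- ln t) ^ (n - i) / fact (n - i)))"
        by (rule sum.mono_neutral_right) auto
      also have "\<dots> = ennreal ((- ln t) ^ a / fact a) * ennreal ((- ln t) ^ n / fact n)"
        by (simp add: Li_abs_Nil)
      finally show ?thesis by (simp only: ennreal_mult p mult_nonneg_nonneg)
    next
      case False
      then have "indicator {0<..<1} t = (0::ennreal)" by auto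
      then show ?thesis by simp
    qed
  qed
  finally show "ennreal ((- 1) ^ (a + b) * tail_coeff [] a b n) =
      (\<integral>\<^sup>+t\<in>{0<..<1}. ennreal ((- ln t) ^ a / fact a * ((- ln t) ^ n / fact n) * ((- ln (1 - t)) ^ b / fact b / t)) \<partial>lborel)" .
qed

lemma Jc_integral:
  assumes "b > 0"
  shows "ennreal (Jc n b) = (\<integral>\<^sup>+t\<in>{0<..<1}. ennreal ((- ln t) ^ n / fact n * ((- ln (1 - t)) ^ b / fact b / t)) \<partial>lborel)"
    and "Jc n b \<ge> 0"
  using tail_coeff_Nil_integral[OF assms, of 0 n] by (simp_all add: Jc_def)

text \<open>Two powers of the same logarithm merge into one of exponent \<open>a + n\<close> with a
  binomial coefficient. This is why only A - T enters the series of the empty word.\<close>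

lemma tail_coeff_Nil_eq_Jc:
  assumes "b > 0"
  shows "tail_coeff [] a b n = (- 1) ^ (a + b) * (real ((a + n) choose n) * Jc (a + n) b)"
proof -
  have f: "x ^ a / fact a * (x ^ n / fact n) = real ((a + n) choose n) * (x ^ (a + n) / fact (a + n))" for x :: real
    by (simp add: binomial_fact power_add)
  have "ennreal ((- 1) ^ (a + b) * tail_coeff [] a b n) = (\<integral>\<^sup>+t. ennreal (real ((a + n) choose n)) *
      (ennreal ((- ln t) ^ (a + n) / fact (a + n) * ((- ln (1 - t)) ^ b / fact b / t)) * indicator {0<..<1} t) \<partial>lborel)"
    unfolding tail_coeff_Nil_integral(1)[OF assms] f
    by (intro nn_integral_cong) (simp only: mult.assoc ennreal_mult' of_nat_0_le_iff)
  also have "\<dots> = ennreal (real ((a + n) choose n)) * ennreal (Jc (a + n) b)"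
    unfolding Jc_integral(1)[OF assms] by (rule nn_integral_cmult) measurable
  also have "\<dots> = ennreal (real ((a + n) choose n) * Jc (a + n) b)"
    using Jc_integral(2)[OF assms] by (simp add: ennreal_mult)
  finally have "(- 1) ^ (a + b) * tail_coeff [] a b n = real ((a + n) choose n) * Jc (a + n) b"
    using tail_coeff_Nil_integral(2)[OF assms] Jc_integral(2)[OF assms] by (subst (asm) ennreal_inj) auto
  moreover have "(- 1) ^ (a + b) * ((- 1) ^ (a + b) * x) = x" for x :: real
    by (simp flip: mult.assoc power_add power_mult_distrib)
  ultimately show ?thesis by metis
qed

text \<open>Coefficients of \<open>(A - T)^l B^k\<close> in the series of the empty word. The shift
  \<open>l - 1\<close> accounts for the \<open>x\<close> at the cut; nonempty words in a single
  letter have regularized value 0.\<close>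

definition dc :: "nat \<Rightarrow> nat \<Rightarrow> real" where
  "dc l k = (if l = 0 \<and> k = 0 then 1 else if l = 0 \<or> k = 0 then 0
     else - ((- 1) ^ (l + k) * Jc (l - 1) k))"

lemma reg_zeta_replicate: "k > 0 \<Longrightarrow> reg_zeta (replicate k c) = 0"
proof -
  assume "k > 0"
  then obtain j where k: "k = Suc j" by (cases k) auto
  have "shuffle_sum reg_zeta [c] ([] @ replicate j c) = 0" using shuffle_hom_reg_zeta reg_zeta_letter[of c] by (simp add: shuffle_hom_def)
  from shuffle_sum_eqI_last[OF this] show ?thesis unfolding k by simp
qed

lemma Z_series_one: "Z_series 1 = subst_AmT dc"
proof (rule fps3_eqI)
  fix b a n
  have rhs: "fps_nth (fps_nth (fps_nth (subst_AmT dc) b) a) n = (- 1) ^ n * real ((n + a) choose n) * dc (n + a) b"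
    by (simp add: subst_AmT_def)
  show "fps_nth (fps_nth (fps_nth (Z_series 1) b) a) n = fps_nth (fps_nth (fps_nth (subst_AmT dc) b) a) n"
  proof (cases "b = 0")
    case True
    have q: "qc a 0 n = (if a + n = 0 then 1 else 0)" for a n
      using reg_zeta_replicate[of "a + n" LX] shuffle_hom_reg_zeta by (simp add: qc_def shuffle_hom_def replicate_add)
    show ?thesis unfolding Z_series_one_nth rhs unfolding True q by (auto simp: dc_def)
  next
    case False
    then have b: "b > 0" by simp
    have q0: "qc 0 b n = 0" for n
      using shuffle_hom_reg_zeta reg_zeta_replicate[OF b, of LY] by (simp add: qc_def shuffle_hom_def)
    have qS: "qc (Suc a) b n = (- 1) ^ (a + b) * (real ((a + n) choose n) * Jc (a + n) b)" for a n
      using tail_coeff_Nil_eq_Jc[OF b, of a n] by (simp add: tail_coeff_Nil)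
    show ?thesis
    proof (cases a)
      case 0
      show ?thesis
      proof (cases n)
        case 0
        then show ?thesis unfolding Z_series_one_nth rhs using \<open>a = 0\<close> b by (simp add: q0 dc_def)
      next
        case (Suc m)
        have "(- 1) ^ m * (- 1) ^ (m + b) = ((- 1) ^ b :: real)"
          by (simp add: power_add flip: mult.assoc power_mult_distrib)
        then show ?thesis unfolding Z_series_one_nth rhs using \<open>a = 0\<close> Suc b by (simp add: q0 qS dc_def)
      qed
    next
      case a: (Suc a')
      show ?thesis
      proof (cases n)
        case 0
        then show ?thesis unfolding Z_series_one_nth rhs unfolding a using b by (simp add: qS dc_def)
      next
        case (Suc m)
        have s: "(- 1) ^ Suc m * ((- 1) ^ (Suc m + Suc a' + b) * x) = (- 1) ^ (Suc a' + b) * x" for x :: real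
          by (simp add: power_add flip: mult.assoc power_mult_distrib)
        \<comment> \<open>Pascal's rule merges the two terms of \<open>Z_series_one_nth\<close> into
          the coefficient of the expansion of \<open>(A - T)^(n + a)\<close>.\<close>
        have ch: "real ((Suc m + Suc a') choose Suc m) = real ((a' + Suc m) choose Suc m) + real ((Suc a' + m) choose m)"
          by (simp add: add.commute)
        have "fps_nth (fps_nth (fps_nth (Z_series 1) b) a) n =
          (- 1) ^ (a' + b) * (real ((a' + Suc m) choose Suc m) * Jc (a' + Suc m) b)
          - (- 1) ^ (Suc a' + b) * (real ((Suc a' + m) choose m) * Jc (Suc a' + m) b)"
          unfolding Z_series_one_nth a Suc by (simp only: qS) simp
        also have "\<dots> = - ((- 1) ^ (Suc a' + b) * (real ((Suc m + Suc a') choose Suc m) * Jc (Suc a' + m) b))"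
          unfolding ch by (simp add: algebra_simps)
        also have "\<dots> = (- 1) ^ n * real ((n + a) choose n) * dc (n + a) b"
        proof -
          have "dc (n + a) b = - ((- 1) ^ (Suc m + Suc a' + b) * Jc (Suc a' + m) b)"
            using b by (simp add: dc_def a Suc add.commute)
          then show ?thesis unfolding a Suc using s[of "real ((Suc m + Suc a') choose Suc m) * Jc (Suc a' + m) b"]
            by (simp only: mult_minus_right mult_ac)
        qed
        finally show ?thesis unfolding rhs .
      qed
    qed
  qed
qed

text \<open>At 0 the bounds \<open>1 - t \<le> (1 - t) powr (1 - be) \<le> 1\<close> leave at most
  \<open>t powr (1 - z)\<close>.\<close>

lemma one_minus_powr_tendsto:
  fixes z be :: real
  assumes z: "0 < z" "z < 1/4" and be: "0 < be" "be < 1/8"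
  shows "((\<lambda>t. t powr (- z) * (1 - (1 - t) powr (1 - be))) \<longlongrightarrow> 0) (at_right 0)"
    and "((\<lambda>t. t powr (- z) * (1 - (1 - t) powr (1 - be))) \<longlongrightarrow> 1) (at_left 1)"
proof -
  show "((\<lambda>t. t powr (- z) * (1 - (1 - t) powr (1 - be))) \<longlongrightarrow> 0) (at_right 0)"
  proof (rule real_tendsto_sandwich)
    show "\<forall>\<^sub>F t in at_right 0. 0 \<le> t powr (- z) * (1 - (1 - t) powr (1 - be))"
      using ev_at_right_0
    proof eventually_elim
      case (elim t)
      have "(1 - t) powr (1 - be) \<le> 1 powr (1 - be)" using elim be by (intro powr_mono2) auto
      then show ?case by (intro mult_nonneg_nonneg) auto
    qed
    show "\<forall>\<^sub>F t in at_right 0. t powr (- z) * (1 - (1 - t) powr (1 - be)) \<le> t powr (1 - z)"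
      using ev_at_right_0
    proof eventually_elim
      case (elim t)
      have "(1 - t) powr 1 \<le> (1 - t) powr (1 - be)" using elim be by (intro powr_mono') auto
      then have "1 - (1 - t) powr (1 - be) \<le> t" using elim by simp
      then have "t powr (- z) * (1 - (1 - t) powr (1 - be)) \<le> t powr (- z) * t powr 1"
        using elim by (intro mult_left_mono) auto
      also have "\<dots> = t powr (1 - z)" by (simp only: powr_add[symmetric]) simp
      finally show ?case .
    qed
    have "((\<lambda>t::real. t powr (1 - z)) \<longlongrightarrow> 0 powr (1 - z)) (at_right 0)"
      using z by (intro tendsto_powr2 tendsto_intros) (auto simp: eventually_at_right[of 0 1] intro: exI[of _ 1])
    then show "((\<lambda>t::real. t powr (1 - z)) \<longlongrightarrow> 0) (at_right 0)" by simp
  qed auto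
  have "((\<lambda>t::real. (1 - t) powr (1 - be)) \<longlongrightarrow> (1 - 1) powr (1 - be)) (at_left 1)"
    using be by (intro tendsto_powr2 tendsto_intros) (auto simp: eventually_at_left[of 0 1] intro: exI[of _ 0])
  then have "((\<lambda>t::real. t powr (- z) * (1 - (1 - t) powr (1 - be))) \<longlongrightarrow> 1 powr (- z) * (1 - 0)) (at_left 1)"
    by (intro tendsto_mult tendsto_diff tendsto_const tendsto_powr tendsto_ident_at) auto
  then show "((\<lambda>t. t powr (- z) * (1 - (1 - t) powr (1 - be))) \<longlongrightarrow> 1) (at_left 1)" by simp
qed

text \<open>The integral is evaluated through the antiderivative
  \<open>t\<^sup>-\<^sup>z (1 - (1 - t)\<^sup>1\<^sup>-\<^sup>\<beta>)\<close> of the sum of the two integrands.\<close>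

lemma Jc_integral_eval:
  fixes z be :: real
  assumes z: "0 < z" "z < 1/4" and be: "0 < be" "be < 1/8"
  shows "(\<integral>\<^sup>+t\<in>{0<..<1}. ennreal (z * (t powr (- z - 1) * ((1 - t) powr (- be) - 1))) \<partial>lborel)
     + ennreal (Gamma (1 - z) * Gamma (1 - be) / Gamma (1 - z - be)) = 1"
proof -
  let ?f = "\<lambda>t. z * (t powr (- z - 1) * ((1 - t) powr (- be) - 1))"
  let ?g = "\<lambda>t. (1 - z - be) * (t powr (- z) * (1 - t) powr (- be))"
  let ?\<Phi> = "\<lambda>t. t powr (- z) * (1 - (1 - t) powr (1 - be))"
  have nn: "?f t \<ge> 0" "?g t \<ge> 0" if t: "0 < t" "t < 1" for t
  proof -
    have "1 powr (- be) \<le> (1 - t) powr (- be)" using t be by (intro powr_mono2') auto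
    then show "?f t \<ge> 0" using z by (intro mult_nonneg_nonneg) auto
    show "?g t \<ge> 0" using z be by (intro mult_nonneg_nonneg) auto
  qed
  have D: "(?\<Phi> has_real_derivative ?f t + ?g t) (at t)" if t: "0 < t" "t < 1" for t
  proof -
    have 1: "((\<lambda>t. t powr (- z)) has_real_derivative - z * t powr (- z - 1)) (at t)"
      using t(1) by (rule has_real_derivative_powr)
    have 2: "((\<lambda>t. (1 - t) powr (1 - be)) has_real_derivative ((1 - be) * (1 - t) powr (1 - be - 1)) * - 1) (at t)"
      by (rule DERIV_chain'[where f = "\<lambda>t. 1 - t"])
         (use t in \<open>auto intro!: derivative_eq_intros has_real_derivative_powr[of "1 - t" "1 - be", simplified]\<close>)
    have "(?\<Phi> has_real_derivative (- z * t powr (- z - 1)) * (1 - (1 - t) powr (1 - be))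
       + (0 - ((1 - be) * (1 - t) powr (1 - be - 1)) * - 1) * t powr (- z)) (at t)"
      by (rule DERIV_mult[OF 1 DERIV_diff[OF DERIV_const 2]])
    moreover have "(1 - t) powr (1 - be) = (1 - t) * (1 - t) powr (- be)" "t powr (- z) = t * t powr (- z - 1)"
      "(1 - t) powr (1 - be - 1) = (1 - t) powr (- be)"
    proof -
      show "(1 - t) powr (1 - be) = (1 - t) * (1 - t) powr (- be)" using t powr_add[of "1 - t" 1 "- be"] by simp
      show "t powr (- z) = t * t powr (- z - 1)" using t powr_add[of t 1 "- z - 1"] by simp
    qed simp
    ultimately show ?thesis by (simp add: algebra_simps)
  qed
  have C: "isCont (\<lambda>t. ?f t + ?g t) t" if "0 < t" "t < 1" for t
    using that by (intro continuous_intros) auto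
  have N: "?f t + ?g t \<ge> 0" if "0 < t" "t < 1" for t using nn[OF that] by simp
  have "(\<integral>\<^sup>+t\<in>{0<..<1}. ennreal (?f t + ?g t) \<partial>lborel) = ennreal (1 - 0)"
    by (rule nn_FTC_unit_interval(1)[OF D C N one_minus_powr_tendsto[OF z be]])
  also have "(\<integral>\<^sup>+t\<in>{0<..<1}. ennreal (?f t + ?g t) \<partial>lborel) =
     (\<integral>\<^sup>+t. ennreal (?f t) * indicator {0<..<1} t + ennreal (?g t) * indicator {0<..<1} t \<partial>lborel)"
    using nn by (intro nn_integral_cong) (auto simp: indicator_def ennreal_plus[symmetric] simp del: ennreal_plus)
  also have "\<dots> = (\<integral>\<^sup>+t\<in>{0<..<1}. ennreal (?f t) \<partial>lborel) + (\<integral>\<^sup>+t\<in>{0<..<1}. ennreal (?g t) \<partial>lborel)"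
    by (rule nn_integral_add) measurable
  also have "(\<integral>\<^sup>+t\<in>{0<..<1}. ennreal (?g t) \<partial>lborel) =
     (\<integral>\<^sup>+t. ennreal (1 - z - be) * (ennreal (t powr ((1 - z) - 1) * (1 - t) powr ((1 - be) - 1)) * indicator {0<..<1} t) \<partial>lborel)"
    using z be by (intro nn_integral_cong) (simp add: ennreal_mult mult.assoc)
  also have "\<dots> = ennreal (1 - z - be) * ennreal (Beta (1 - z) (1 - be))"
    using nn_integral_Beta[of "1 - z" "1 - be"] z be by (subst nn_integral_cmult) auto
  also have "\<dots> = ennreal (Gamma (1 - z) * Gamma (1 - be) / Gamma (1 - z - be))"
  proof -
    have y: "1 - z - be > 0" "1 - z + (1 - be) = 1 - z - be + 1" using z be by auto
    have "(1 - z - be) * Beta (1 - z) (1 - be) = Gamma (1 - z) * Gamma (1 - be) / Gamma (1 - z - be)"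
      unfolding Beta_def y(2) Gamma_pos_plus1[OF y(1)] using y(1) by simp
    then show ?thesis using y(1) by (metis ennreal_mult' less_imp_le)
  qed
  finally show ?thesis by simp
qed

text \<open>Both sums are exponential series. The exponent of \<open>be\<close> starts at 1, hence
  the subtracted 1; the spare \<open>z\<close> and the \<open>1 / t\<close> of the integrand
  complete \<open>z * t powr (- z - 1)\<close>.\<close>

lemma suminf_Jc:
  fixes z be :: real
  assumes z: "0 < z" "z < 1/4" and be: "0 < be" "be < 1/8"
  shows "suminf (\<lambda>k. suminf (\<lambda>l. ennreal (z ^ Suc l * be ^ Suc k * Jc l (Suc k)))) =
    (\<integral>\<^sup>+t\<in>{0<..<1}. ennreal (z * (t powr (- z - 1) * ((1 - t) powr (- be) - 1))) \<partial>lborel)"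
proof -
  let ?g = "\<lambda>k l t. ennreal (z ^ Suc l * be ^ Suc k) * (ennreal ((- ln t) ^ l / fact l * ((- ln (1 - t)) ^ Suc k / fact (Suc k) / t)) * indicator {0<..<1} t)"
  have "ennreal (z ^ Suc l * be ^ Suc k * Jc l (Suc k)) = (\<integral>\<^sup>+t. ?g k l t \<partial>lborel)" for k l
  proof -
    have "ennreal (z ^ Suc l * be ^ Suc k * Jc l (Suc k)) = ennreal (z ^ Suc l * be ^ Suc k) * ennreal (Jc l (Suc k))"
      using z be Jc_integral(2)[of "Suc k" l] by (intro ennreal_mult) auto
    then show ?thesis unfolding Jc_integral(1)[OF zero_less_Suc]
      by (simp only:) (rule nn_integral_cmult[symmetric], measurable)
  qed
  then have "suminf (\<lambda>k. suminf (\<lambda>l. ennreal (z ^ Suc l * be ^ Suc k * Jc l (Suc k)))) =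
     suminf (\<lambda>k. suminf (\<lambda>l. \<integral>\<^sup>+t. ?g k l t \<partial>lborel))" by (simp only:)
  also have "\<dots> = suminf (\<lambda>k. \<integral>\<^sup>+t. suminf (\<lambda>l. ?g k l t) \<partial>lborel)"
    by (intro arg_cong[where f = suminf] ext nn_integral_suminf[symmetric]) measurable
  also have "\<dots> = (\<integral>\<^sup>+t. suminf (\<lambda>k. suminf (\<lambda>l. ?g k l t)) \<partial>lborel)"
    by (rule nn_integral_suminf[symmetric]) measurable
  also have "\<dots> = (\<integral>\<^sup>+t\<in>{0<..<1}. ennreal (z * (t powr (- z - 1) * ((1 - t) powr (- be) - 1))) \<partial>lborel)"
  proof (intro nn_integral_cong)
    fix t :: real
    show "suminf (\<lambda>k. suminf (\<lambda>l. ?g k l t)) = ennreal (z * (t powr (- z - 1) * ((1 - t) powr (- be) - 1))) * indicator {0<..<1} t"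
    proof (cases "0 < t \<and> t < 1")
      case True
      define c d where "c = - ln t" and "d = - ln (1 - t)"
      have c: "c \<ge> 0" "exp (z * c) = t powr (- z)" and d: "d \<ge> 0" "exp (be * d) = (1 - t) powr (- be)"
        using True by (auto simp: c_def d_def powr_def)
      have g: "?g k l t = ennreal ((be * d) ^ Suc k / fact (Suc k)) * (ennreal ((z * c) ^ l / fact l) * ennreal (z / t))" for k l
      proof -
        have eq: "z ^ Suc l * be ^ Suc k * (c ^ l / fact l * (d ^ Suc k / fact (Suc k) / t)) =
          (be * d) ^ Suc k / fact (Suc k) * ((z * c) ^ l / fact l * (z / t))"
          unfolding power_mult_distrib by (simp add: mult_ac)
        have n: "0 \<le> c ^ l / fact l * (d ^ Suc k / fact (Suc k) / t)" "0 \<le> z ^ Suc l * be ^ Suc k"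
          "0 \<le> (be * d) ^ Suc k / fact (Suc k)" "0 \<le> (z * c) ^ l / fact l" "0 \<le> z / t"
          using c(1) d(1) z be True by (auto intro!: mult_nonneg_nonneg divide_nonneg_pos)
        have i: "indicator {0<..<1} t = (1::ennreal)" using True by simp
        show ?thesis unfolding c_def[symmetric] d_def[symmetric] i mult_1_right
          by (simp only: ennreal_mult[OF n(2,1), symmetric] ennreal_mult[OF n(4,5), symmetric]
              ennreal_mult[OF n(3) mult_nonneg_nonneg[OF n(4,5)], symmetric] eq)
      qed
      have e: "suminf (\<lambda>k. ennreal ((be * d) ^ Suc k / fact (Suc k))) = ennreal ((1 - t) powr (- be) - 1)"
      proof (rule suminf_ennreal_eq)
        have "(\<lambda>n. (be * d) ^ n / fact n) sums exp (be * d)"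
          using exp_converges[of "be * d"] by (simp add: divide_inverse mult.commute)
        then show "(\<lambda>k. (be * d) ^ Suc k / fact (Suc k)) sums ((1 - t) powr (- be) - 1)"
          unfolding d(2)[symmetric] by (subst sums_Suc_iff) simp
        show "0 \<le> (be * d) ^ Suc k / fact (Suc k)" for k
          using be d(1) by (intro divide_nonneg_pos zero_le_power mult_nonneg_nonneg) auto
      qed
      have e2: "suminf (\<lambda>l. ennreal ((z * c) ^ l / fact l)) = ennreal (t powr (- z))"
        unfolding c(2)[symmetric] using z c(1) by (intro suminf_exp_ennreal) auto
      have p: "(1 - t) powr (- be) - 1 \<ge> 0" unfolding d(2)[symmetric] using be d(1) by simp
      have "suminf (\<lambda>k. suminf (\<lambda>l. ?g k l t)) = ennreal ((1 - t) powr (- be) - 1) * (ennreal (t powr (- z)) * ennreal (z / t))"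
        unfolding g ennreal_suminf_cmult suminf_multl_ennreal e e2 ..
      also have "\<dots> = ennreal (z * (t powr (- z - 1) * ((1 - t) powr (- be) - 1)))"
        using True z p by (simp add: ennreal_mult[symmetric] powr_diff)
      finally show ?thesis using True by simp
    next
      case False
      then have "indicator {0<..<1} t = (0::ennreal)" by auto
      then show ?thesis by simp
    qed
  qed
  finally show ?thesis .
qed

lemma Jc_has_sum:
  fixes z be :: real
  assumes z: "0 < z" "z < 1/4" and be: "0 < be" "be < 1/8"
  shows "((\<lambda>(k, l). z ^ Suc l * be ^ Suc k * Jc l (Suc k)) has_sum
     (1 - Gamma (1 - z) * Gamma (1 - be) / Gamma (1 - z - be))) UNIV"
proof -
  let ?E = "Gamma (1 - z) * Gamma (1 - be) / Gamma (1 - z - be)"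
  let ?S = "suminf (\<lambda>k. suminf (\<lambda>l. ennreal (z ^ Suc l * be ^ Suc k * Jc l (Suc k))))"
  have E: "?E \<ge> 0" using z be by (intro divide_nonneg_pos mult_nonneg_nonneg less_imp_le Gamma_real_pos) auto
  have S: "?S + ennreal ?E = 1" unfolding suminf_Jc[OF z be] by (rule Jc_integral_eval[OF z be])
  have "?S \<le> ?S + ennreal ?E" by (rule add_increasing2) auto
  then have fin: "?S < top" unfolding S by (rule le_less_trans) simp
  have nn: "z ^ Suc l * be ^ Suc k * Jc l (Suc k) \<ge> 0" for k l
    using z be Jc_integral(2)[of "Suc k" l] by (intro mult_nonneg_nonneg) auto
  have "((\<lambda>(k, l). z ^ Suc l * be ^ Suc k * Jc l (Suc k)) has_sum enn2real ?S) UNIV"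
    by (rule has_sum_suminf_ennreal_pair[OF nn _ fin]) (rule has_sum_suminf_ennreal[OF nn])
  moreover have "enn2real ?S + ?E = 1"
  proof -
    have "enn2real (?S + ennreal ?E) = enn2real ?S + ?E" using fin E by (simp add: enn2real_plus del: ennreal_plus)
    then show ?thesis unfolding S by simp
  qed
  then have "enn2real ?S = 1 - ?E" by linarith
  ultimately show ?thesis by (simp only:)
qed

text \<open>At negative arguments the series of \<open>dc\<close> is 1 minus that of
  \<open>Jc\<close>, so the 1 in \<open>Jc_has_sum\<close> cancels and the bare Gamma expression
  remains.\<close>

lemma dc_has_sum:
  obtains g where "\<forall>z B. \<bar>z\<bar> < 1/4 \<longrightarrow> \<bar>B\<bar> < 1/8 \<longrightarrow> ((\<lambda>(l, k). dc l k * z ^ l * B ^ k) has_sum g z B) UNIV"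
    "\<forall>z be. 0 < z \<longrightarrow> z < 1/4 \<longrightarrow> 0 < be \<longrightarrow> be < 1/8 \<longrightarrow>
       g (- z) (- be) = Gamma (1 - z) * Gamma (1 - be) / Gamma (1 - z - be)"
proof -
  let ?P = "{(l, k). l > 0 \<and> k > (0::nat)} :: (nat \<times> nat) set"
  have reindex: "(h has_sum s) ?P \<longleftrightarrow> ((\<lambda>(k, l). h (Suc l, Suc k)) has_sum s) UNIV" for h :: "nat \<times> nat \<Rightarrow> real" and s
    by (rule has_sum_reindex_bij_witness[where j = "\<lambda>(l, k). (k - 1, l - 1)" and i = "\<lambda>(k, l). (Suc l, Suc k)"]) auto
  have full: "((\<lambda>(l, k). dc l k * z ^ l * B ^ k) has_sum 1 + s) UNIV"
    if "((\<lambda>(k, l). dc (Suc l) (Suc k) * z ^ Suc l * B ^ Suc k) has_sum s) UNIV" for z B s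
  proof -
    have "((\<lambda>(l, k). dc l k * z ^ l * B ^ k) has_sum s) ?P"
      unfolding reindex using that by simp
    then have "((\<lambda>(l, k). dc l k * z ^ l * B ^ k) has_sum (case (0::nat, 0::nat) of (l, k) \<Rightarrow> dc l k * z ^ l * B ^ k) + s) (insert (0, 0) ?P)"
      by (intro has_sum_insert) auto
    also have "?this \<longleftrightarrow> ((\<lambda>(l, k). dc l k * z ^ l * B ^ k) has_sum (case (0::nat, 0::nat) of (l, k) \<Rightarrow> dc l k * z ^ l * B ^ k) + s) UNIV"
      by (rule has_sum_cong_neutral) (auto simp: dc_def split: if_splits)
    finally show ?thesis by (simp add: dc_def)
  qed
  have dS: "dc (Suc l) (Suc k) * z ^ Suc l * B ^ Suc k = - ((- z) ^ Suc l * (- B) ^ Suc k * Jc l (Suc k))" for l k z B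
    by (simp add: dc_def power_add power_minus[of z] power_minus[of B] mult_ac)
  have ex: "\<exists>s. ((\<lambda>(l, k). dc l k * z ^ l * B ^ k) has_sum s) UNIV" if "\<bar>z\<bar> < 1/4" "\<bar>B\<bar> < 1/8" for z B
  proof -
    let ?m = "\<lambda>x::real. max \<bar>x\<bar> (1/16)"
    have "(\<lambda>p. norm (case p of (k, l) \<Rightarrow> dc (Suc l) (Suc k) * z ^ Suc l * B ^ Suc k)) summable_on UNIV"
    proof (rule summable_on_comparison_test)
      show "(\<lambda>(k, l). ?m z ^ Suc l * ?m B ^ Suc k * Jc l (Suc k)) summable_on UNIV"
        by (rule has_sum_imp_summable[OF Jc_has_sum]) (use that in auto)
      fix p :: "nat \<times> nat"
      obtain k l where p: "p = (k, l)" by fastforce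
      have J: "Jc l (Suc k) \<ge> 0" by (rule Jc_integral) simp
      have m: "\<bar>x\<bar> ^ n \<le> ?m x ^ n" "0 \<le> ?m x ^ n" for x :: real and n
        by (auto intro!: power_mono zero_le_power)
      have "norm (case p of (k, l) \<Rightarrow> dc (Suc l) (Suc k) * z ^ Suc l * B ^ Suc k) = \<bar>z\<bar> ^ Suc l * \<bar>B\<bar> ^ Suc k * Jc l (Suc k)"
        unfolding p case_prod_conv dS using J by (simp add: abs_mult power_abs del: power_Suc)
      also have "\<dots> \<le> ?m z ^ Suc l * ?m B ^ Suc k * Jc l (Suc k)"
        using m J by (intro mult_right_mono mult_mono) (auto simp del: power_Suc)
      finally show "norm (case p of (k, l) \<Rightarrow> dc (Suc l) (Suc k) * z ^ Suc l * B ^ Suc k) \<le> (case p of (k, l) \<Rightarrow> ?m z ^ Suc l * ?m B ^ Suc k * Jc l (Suc k))"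
        by (simp add: p)
    qed auto
    then have "(\<lambda>(k, l). dc (Suc l) (Suc k) * z ^ Suc l * B ^ Suc k) summable_on UNIV" by (rule abs_summable_summable)
    then show ?thesis using full unfolding summable_on_def by blast
  qed
  define g where "g z B = infsum (\<lambda>(l, k). dc l k * z ^ l * B ^ k) UNIV" for z B
  have "((\<lambda>(l, k). dc l k * z ^ l * B ^ k) has_sum g z B) UNIV" if "\<bar>z\<bar> < 1/4" "\<bar>B\<bar> < 1/8" for z B
    unfolding g_def using ex[OF that] by (intro has_sum_infsum) (auto simp: summable_on_def)
  moreover have "g (- z) (- be) = Gamma (1 - z) * Gamma (1 - be) / Gamma (1 - z - be)"
    if "0 < z" "z < 1/4" "0 < be" "be < 1/8" for z be
  proof -
    have "((\<lambda>(k, l). dc (Suc l) (Suc k) * (- z) ^ Suc l * (- be) ^ Suc k) has_sum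
       - 1 * (1 - Gamma (1 - z) * Gamma (1 - be) / Gamma (1 - z - be))) UNIV"
      unfolding dS using has_sum_cmult_right[OF Jc_has_sum[OF that], of "- 1"]
      by (simp only: minus_minus mult_minus1 case_prod_unfold)
    from infsumI[OF full[OF this]] show ?thesis by (simp add: g_def)
  qed
  ultimately show ?thesis using that by blast
qed

text \<open>The denominator \<open>Gamma (1 + A + B - T)\<close> is symmetric in \<open>A\<close>
  and \<open>B\<close> and cancels; the remaining ratio is \<open>gamma_quotient\<close>. On the
  cone, \<open>T - A\<close> lies between 0 and 1/4, as \<open>dc_has_sum\<close> requires.\<close>

lemma duality_one: "swapAB (Z_series 1) = Z_series 1 * taylor_TAB gamma_quotient"
proof -
  obtain g where g: "\<forall>z B. \<bar>z\<bar> < 1/4 \<longrightarrow> \<bar>B\<bar> < 1/8 \<longrightarrow> ((\<lambda>(l, k). dc l k * z ^ l * B ^ k) has_sum g z B) UNIV"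
    "\<forall>z be. 0 < z \<longrightarrow> z < 1/4 \<longrightarrow> 0 < be \<longrightarrow> be < 1/8 \<longrightarrow>
       g (- z) (- be) = Gamma (1 - z) * Gamma (1 - be) / Gamma (1 - z - be)"
    by (rule dc_has_sum)
  have rep: "represents (Z_series 1) (\<lambda>T A B. g (A - T) B)"
    unfolding Z_series_one by (rule represents_subst_AmT) (use g(1) in auto)
  show ?thesis
  proof (rule represents_unique[OF represents_swap[OF rep] represents_mult[OF rep represents_gamma_quotient]])
    fix T A B :: real
    assume T: "0 < T" "T < 1/8" and A: "- (1/8) < A" "A < 0" and B: "- (1/8) < B" "B < 0"
    have 1: "g (A - T) B = Gamma (1 + A - T) * Gamma (1 + B) / Gamma (1 + A + B - T)"
      using g(2)[rule_format, of "T - A" "- B"] T A B by (simp add: algebra_simps)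
    have 2: "g (B - T) A = Gamma (1 + B - T) * Gamma (1 + A) / Gamma (1 + A + B - T)"
      using g(2)[rule_format, of "T - B" "- A"] T A B by (simp add: algebra_simps)
    have gq: "gamma_quotient T A B = Gamma (1 + A) * Gamma (1 + B - T) / (Gamma (1 + B) * Gamma (1 + A - T))"
      by (simp add: gamma_quotient_def algebra_simps)
    have "Gamma (1 + A - T) > 0" "Gamma (1 + B) > 0" using T A B by (auto intro!: Gamma_real_pos)
    then have nz: "Gamma (1 + A - T) \<noteq> 0" "Gamma (1 + B) \<noteq> 0" by auto
    have "c * d / e = a * b / e * (d * c / (b * a))" if "a \<noteq> 0" "b \<noteq> 0" for a b c d e :: real
      using that by simp
    from this[OF nz] show "g (B - T) A = g (A - T) B * gamma_quotient T A B"
      unfolding 1 2 gq .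
  qed
qed

section \<open>Linearity in w and the general element of \<open>h0\<close>\<close>

lemma Z_series_add: "Z_series (p + q) = Z_series p + Z_series q"
  by (rule fps3_eqI) (simp add: Z_series_nth distrib_left distrib_right sigma_hom ev_add)

lemma sigma_scalar: "\<sigma> (scalar c) = fps_const (scalar c)"
  by (simp add: \<sigma>_def lin_ext_single zero_word_def)

lemma Z_series_scalar_mult: "Z_series (scalar c * p) = fps_const (fps_const (fps_const (of_rat c))) * Z_series p"
proof (rule fps3_eqI)
  fix b a n
  have "lx ^ a * (scalar c * p) * ly ^ b = scalar c * (lx ^ a * p * ly ^ b)"
    by (simp only: mult.assoc[symmetric] scalar_central[of c "lx ^ a"])
  then show "fps_nth (fps_nth (fps_nth (Z_series (scalar c * p)) b) a) n =
    fps_nth (fps_nth (fps_nth (fps_const (fps_const (fps_const (of_rat c))) * Z_series p) b) a) n"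
    by (simp add: Z_series_nth sigma_hom(3)[of "scalar c"] sigma_scalar ev_scalar_mult)
qed

lemma swapAB_add: "swapAB (c + d) = swapAB c + swapAB d"
  by (rule fps3_eqI) (simp add: swapAB_def)

lemma swapAB_const_mult: "swapAB (fps_const (fps_const (fps_const r)) * c) = fps_const (fps_const (fps_const r)) * swapAB c"
  by (rule fps3_eqI) (simp add: swapAB_def)

lemma tau_scalar: "\<tau> (scalar c) = scalar c"
  by (simp add: \<tau>_def lin_ext_single zero_word_def mult_single plus_word_def)

lemma duality_add:
  assumes "swapAB (Z_series (\<tau> p)) = Z_series p * G" "swapAB (Z_series (\<tau> q)) = Z_series q * G"
  shows "swapAB (Z_series (\<tau> (p + q))) = Z_series (p + q) * G"
  using assms by (simp add: tau_antihom Z_series_add swapAB_add distrib_right)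

lemma duality_scalar_mult:
  assumes "swapAB (Z_series (\<tau> p)) = Z_series p * G"
  shows "swapAB (Z_series (\<tau> (scalar c * p))) = Z_series (scalar c * p) * G"
proof -
  have "\<tau> (scalar c * p) = scalar c * \<tau> p"
    by (simp add: tau_antihom(3) tau_scalar scalar_central)
  then show ?thesis using assms by (simp add: Z_series_scalar_mult swapAB_const_mult mult.assoc)
qed

theorem theorem1p5:
  fixes w :: ncpoly
  assumes "w \<in> h0"
  shows "coeffwise (coeffwise (coeffwise Z_sh \<circ> \<sigma> \<circ> \<tau>)) (sandwich w) =
         coeffwise (coeffwise (coeffwise Z_sh \<circ> \<sigma>)) (sandwich w) * taylor_TAB gamma_quotient"
proof -
  let ?G = "taylor_TAB gamma_quotient"
  obtain c p where w: "w = scalar c + ly * p * lx" using assms by (auto simp: h0_def)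
  have "swapAB (Z_series (\<tau> (scalar c * 1))) = Z_series (scalar c * 1) * ?G"
    by (rule duality_scalar_mult) (simp add: tau_antihom duality_one)
  moreover have "swapAB (Z_series (\<tau> (ly * p * lx))) = Z_series (ly * p * lx) * ?G"
  proof (induction p rule: ncpoly_induct)
    case zero
    have "swapAB (Z_series (\<tau> (scalar 0 * 1))) = Z_series (scalar 0 * 1) * ?G"
      by (rule duality_scalar_mult) (simp add: tau_antihom duality_one)
    then show ?case by simp
  next
    case (single_add u d q)
    \<comment> \<open>Every monomial of \<open>y p x\<close> fits \<open>duality_word\<close>: it
      ends in \<open>x\<close>, and the rest, reversed, is nonempty with last letter
      \<open>y\<close>.\<close>
    have "ly * Poly_Mapping.single u d * lx = scalar d * word_poly (rev (LX # rev (LY # letters u)))"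
      by (simp add: mult_single plus_word_def zero_word_def)
    moreover have "swapAB (Z_series (\<tau> (scalar d * word_poly (rev (LX # rev (LY # letters u)))))) =
       Z_series (scalar d * word_poly (rev (LX # rev (LY # letters u)))) * ?G"
      by (intro duality_scalar_mult duality_word) auto
    ultimately show ?case using single_add
      by (simp only: distrib_left distrib_right) (rule duality_add)
  qed
  ultimately have "swapAB (Z_series (\<tau> w)) = Z_series w * ?G" unfolding w by (intro duality_add) simp_all
  then show ?thesis unfolding coeffwise_tau_eq Z_series_def .
qed

end
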